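(* Let $\Omega\subseteq\mathbb{C}$ be a simply connected domain and let $\Phi$ be a family of locally univalent self-maps of $\Omega$ which contains a run-away and eventually injective sequence $(\phi_n)$. Then there is a $\Phi$-universal function in $\mathcal{M}_{l.u.}(\Omega)$, and the set of all such functions is a dense $G_{\delta}$-subset of $\mathcal{M}_{l.u.}(\Omega)$.
   Context: A meromorphic function $f$ on $\Omega$ is locally univalent if it has at most simple poles and $f'(z)\neq0$ for all $z\in\Omega$ with $f(z)\neq\infty$. $\mathcal{M}_{l.u.}(\Omega)$ is the set of locally univalent meromorphic functions on $\Omega$, with the topology of locally uniform convergence on $\Omega$ with respect to the chordal metric $\chi$ on $\hat{\mathbb{C}}=\mathbb{C}\cup\{\infty\}$, where $\chi(z_1,z_2)=\frac{|z_1-z_2|}{\sqrt{1+|z_1|^2}\sqrt{1+|z_2|^2}}$ for $z_1,z_2\in\mathbb{C}$ and $\chi(z_1,\infty)=\frac{1}{\sqrt{1+|z_1|^2}}$. A locally univalent self-map of $\Omega$ is a holomorphic map $\phi:\Omega\to\Omega$ with nowhere vanishing derivative. A function $G\in\mathcal{M}_{l.u.}(\Omega)$ is $\Phi$-universal in $\mathcal{M}_{l.u.}(\Omega)$ if $\{G\circ\phi:\phi\in\Phi\}$ is dense in $\mathcal{M}_{l.u.}(\Omega)$. A sequence $(\phi_n)$ of holomorphic self-maps of $\Omega$ is run-away if for every compact set $K\subseteq\Omega$ there exists $n\in\mathbb{N}$ with $\phi_n(K)\cap K=\emptyset$; it is eventually injective if for every compact set $K\subseteq\Omega$ there exists $N\in\mathbb{N}$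 such that the restriction $\phi_n|_K$ is injective for all $n\ge N$. *)

theory Defs
  imports "HOL-Complex_Analysis.Complex_Analysis"
begin

text \<open>
  The Riemann sphere is modelled as \<^typ>\<open>complex option\<close>, with \<^term>\<open>None\<close> in the role of the
  point at infinity.
\<close>

fun chordal :: "complex option \<Rightarrow> complex option \<Rightarrow> real" where
  "chordal (Some z) (Some w) = cmod (z - w) / (sqrt (1 + (cmod z)\<^sup>2) * sqrt (1 + (cmod w)\<^sup>2))"
| "chordal (Some z) None = 1 / sqrt (1 + (cmod z)\<^sup>2)"
| "chordal None (Some w) = 1 / sqrt (1 + (cmod w)\<^sup>2)"
| "chordal None None = 0"

text \<open>
  The library represents a meromorphic function by a total complex-valued function (with junk value
  0 at the poles). The sphere-valued map it stands for takes the value infinity at the poles;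
  it is made extensional, so that equality of such maps is equality on \<^term>\<open>\<Omega>\<close>.
\<close>

definition sphere_map :: "complex set \<Rightarrow> (complex \<Rightarrow> complex) \<Rightarrow> complex \<Rightarrow> complex option" where
  "sphere_map \<Omega> h = (\<lambda>z\<in>\<Omega>. if is_pole h z then None else Some (h z))"

definition mero_lu :: "complex set \<Rightarrow> (complex \<Rightarrow> complex option) set" where
  "mero_lu \<Omega> = {sphere_map \<Omega> h |h. h nicely_meromorphic_on \<Omega> \<and>
      (\<forall>z\<in>\<Omega>. is_pole h z \<longrightarrow> zorder h z = -1) \<and>
      (\<forall>z\<in>\<Omega>. \<not> is_pole h z \<longrightarrow> deriv h z \<noteq> 0)}"

text \<open>
  Since \<^term>\<open>\<Omega>\<close> will be open in the (locally compact) plane, locally uniform convergence is uniform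
  convergence on compact subsets.
\<close>

definition mero_lu_open :: "complex set \<Rightarrow> (complex \<Rightarrow> complex option) set \<Rightarrow> bool" where
  "mero_lu_open \<Omega> U \<longleftrightarrow> U \<subseteq> mero_lu \<Omega> \<and>
     (\<forall>f\<in>U. \<exists>K \<epsilon>. compact K \<and> K \<subseteq> \<Omega> \<and> \<epsilon> > 0 \<and>
        (\<forall>g\<in>mero_lu \<Omega>. (\<forall>z\<in>K. chordal (f z) (g z) < \<epsilon>) \<longrightarrow> g \<in> U))"

definition mero_lu_topology :: "complex set \<Rightarrow> (complex \<Rightarrow> complex option) topology" where
  "mero_lu_topology \<Omega> = topology (mero_lu_open \<Omega>)"

lemma istopology_mero_lu_open: "istopology (mero_lu_open \<Omega>)"
  unfolding istopology_def
proof (intro conjI allI impI)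
  fix S T assume S: "mero_lu_open \<Omega> S" and T: "mero_lu_open \<Omega> T"
  show "mero_lu_open \<Omega> (S \<inter> T)"
    unfolding mero_lu_open_def
  proof (intro conjI ballI)
    show "S \<inter> T \<subseteq> mero_lu \<Omega>"
      using S by (auto simp: mero_lu_open_def)
  next
    fix f assume f: "f \<in> S \<inter> T"
    obtain K d where K: "compact K" "K \<subseteq> \<Omega>" "d > 0"
      "\<And>g. g \<in> mero_lu \<Omega> \<Longrightarrow> (\<forall>z\<in>K. chordal (f z) (g z) < d) \<Longrightarrow> g \<in> S"
      using S f unfolding mero_lu_open_def by (metis IntD1)
    obtain L e where L: "compact L" "L \<subseteq> \<Omega>" "e > 0"
      "\<And>g. g \<in> mero_lu \<Omega> \<Longrightarrow> (\<forall>z\<in>L. chordal (f z) (g z) < e) \<Longrightarrow> g \<in> T"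
      using T f unfolding mero_lu_open_def by (metis IntD2)
    show "\<exists>K \<epsilon>. compact K \<and> K \<subseteq> \<Omega> \<and> \<epsilon> > 0 \<and>
        (\<forall>g\<in>mero_lu \<Omega>. (\<forall>z\<in>K. chordal (f z) (g z) < \<epsilon>) \<longrightarrow> g \<in> S \<inter> T)"
      by (rule exI[of _ "K \<union> L"], rule exI[of _ "min d e"]) (use K L in auto)
  qed
next
  fix \<K> assume \<K>: "\<forall>K\<in>\<K>. mero_lu_open \<Omega> K"
  show "mero_lu_open \<Omega> (\<Union>\<K>)"
    unfolding mero_lu_open_def
  proof (intro conjI ballI)
    show "\<Union>\<K> \<subseteq> mero_lu \<Omega>"
      using \<K> by (auto simp: mero_lu_open_def)
  next
    fix f assume "f \<in> \<Union>\<K>"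
    then obtain U where U: "U \<in> \<K>" "f \<in> U" by blast
    with \<K> obtain K e where "compact K" "K \<subseteq> \<Omega>" "e > 0"
      "\<And>g. g \<in> mero_lu \<Omega> \<Longrightarrow> (\<forall>z\<in>K. chordal (f z) (g z) < e) \<Longrightarrow> g \<in> U"
      unfolding mero_lu_open_def by meson
    with U show "\<exists>K \<epsilon>. compact K \<and> K \<subseteq> \<Omega> \<and> \<epsilon> > 0 \<and>
        (\<forall>g\<in>mero_lu \<Omega>. (\<forall>z\<in>K. chordal (f z) (g z) < \<epsilon>) \<longrightarrow> g \<in> \<Union>\<K>)"
      by (intro exI[of _ K] exI[of _ e]) auto
  qed
qed

lemma openin_mero_lu_topology: "openin (mero_lu_topology \<Omega>) = mero_lu_open \<Omega>"
  by (simp add: mero_lu_topology_def istopology_mero_lu_open)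

lemma topspace_mero_lu_topology: "topspace (mero_lu_topology \<Omega>) = mero_lu \<Omega>"
proof -
  have "mero_lu_open \<Omega> (mero_lu \<Omega>)"
    by (auto simp: mero_lu_open_def intro!: exI[of _ "{}"] exI[of _ "1::real"])
  moreover have "U \<subseteq> mero_lu \<Omega>" if "mero_lu_open \<Omega> U" for U
    using that by (simp add: mero_lu_open_def)
  ultimately show ?thesis
    unfolding topspace_def openin_mero_lu_topology by blast
qed

text \<open>Values of a self-map outside \<^term>\<open>\<Omega>\<close> are irrelevant.\<close>

definition lu_self_map :: "complex set \<Rightarrow> (complex \<Rightarrow> complex) \<Rightarrow> bool" where
  "lu_self_map \<Omega> \<phi> \<longleftrightarrow> \<phi> holomorphic_on \<Omega> \<and> \<phi> ` \<Omega> \<subseteq> \<Omega> \<and> (\<forall>z\<in>\<Omega>. deriv \<phi> z \<noteq> 0)"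

definition run_away :: "complex set \<Rightarrow> (nat \<Rightarrow> complex \<Rightarrow> complex) \<Rightarrow> bool" where
  "run_away \<Omega> \<phi> \<longleftrightarrow> (\<forall>K. compact K \<and> K \<subseteq> \<Omega> \<longrightarrow> (\<exists>n. \<phi> n ` K \<inter> K = {}))"

definition eventually_injective :: "complex set \<Rightarrow> (nat \<Rightarrow> complex \<Rightarrow> complex) \<Rightarrow> bool" where
  "eventually_injective \<Omega> \<phi> \<longleftrightarrow>
     (\<forall>K. compact K \<and> K \<subseteq> \<Omega> \<longrightarrow> (\<exists>N. \<forall>n\<ge>N. inj_on (\<phi> n) K))"

definition universal_mero_lu ::
    "complex set \<Rightarrow> (complex \<Rightarrow> complex) set \<Rightarrow> (complex \<Rightarrow> complex option) \<Rightarrow> bool" where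
  "universal_mero_lu \<Omega> \<Phi> G \<longleftrightarrow> G \<in> mero_lu \<Omega> \<and>
     mero_lu_topology \<Omega> closure_of {compose \<Omega> G \<phi> |\<phi>. \<phi> \<in> \<Phi>} = topspace (mero_lu_topology \<Omega>)"

end

theory Submission
  imports Defs
begin

text \<open>
A function \<open>G\<close> is universal iff its orbit \<open>{G o \<phi>}\<close> meets every nonempty member of a countable base of
\<open>M_lu(\<Omega>)\<close>, so the universal functions form a countable intersection of open sets. What has
to be shown is that each of these sets is dense and that a Baire argument is available.

\<^bold>\<open>Density.\<close> Given \<open>f\<close>, \<open>g\<close> and a compact subset of \<open>\<Omega>\<close>, the Riemann mapping theorem encloses
the compact set in a closed disc \<open>K = \<psi>(cball 0 1)\<close> with \<open>\<psi>\<close> univalent near the disc. The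
hypotheses on \<open>(\<phi>_n)\<close> provide an \<open>n\<close> for which \<open>\<phi>_n\<close> is univalent near \<open>K\<close> and maps a
neighbourhood of \<open>K\<close> off itself. The function that equals \<open>f\<close> near \<open>K\<close> and \<open>g o \<phi>_n^-1\<close> near
\<open>L = \<phi>_n(K)\<close> is then locally univalent near \<open>K \<union> L\<close>, and any globally locally univalent
approximation \<open>G\<close> of it is close to \<open>f\<close> on \<open>K\<close> while \<open>G o \<phi>_n\<close> is close to \<open>g\<close> on \<open>K\<close>. Such a
\<open>G\<close> is supplied by a Runge theorem for locally univalent functions, \<open>lu_runge_two_discs\<close>.

\<^bold>\<open>The Runge theorem.\<close> Let \<open>P\<close> be the polynomial whose simple zeros are the poles of the given
function \<open>F\<close>. Then \<open>P^2 F'\<close> is zero-free, hence \<open>F' = exp Q / P^2\<close>. If an entire function \<open>Q'\<close>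
agrees with \<open>Q\<close> to first order at the zeros of \<open>P\<close> and is close to \<open>Q\<close> on \<open>K \<union> L\<close>, then
\<open>exp Q' / P^2\<close> has the same principal parts as \<open>F'\<close>; so it has a single-valued primitive \<open>G\<close>
in the plane, which is locally univalent, and \<open>G - F\<close> is holomorphic with small derivative near
\<open>K \<union> L\<close>. The interpolation condition is met by writing \<open>Q = T + P^2 S\<close> with \<open>T\<close> entire and
approximating \<open>S\<close> only. One scalar condition remains: the constants of integration on \<open>K\<close> and on
\<open>L\<close> must fit, that is, the integral of \<open>G'\<close> over a segment joining \<open>K\<close> to \<open>L\<close> is prescribed.
It is arranged by adding to the approximation of \<open>S\<close> an entire function that is tiny on
\<open>K \<union> L\<close> but resembles, on the segment, \<open>1/P^2\<close> times a multiple of the indicator of an interval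
(\<open>segment_bump\<close>, \<open>runge_with_segment_integral\<close>).

\<^bold>\<open>The Baire argument.\<close> Since the approximations differ from the given functions by small
\<^emph>\<open>holomorphic\<close> functions on large compact sets, the usual nested construction produces
\<open>f_(k+1) = f_k + e_k\<close> with \<open>e_k\<close> as small as desired compared with \<open>f_k'\<close>. The limit of such a
sequence is locally univalent (\<open>mero_lu_limit\<close>), and it lies in all the given open sets
(\<open>baire_mero_lu\<close>).
\<close>

section \<open>Local description of locally univalent meromorphic functions\<close>

text \<open>
Reciprocation in the chart at infinity: a sphere-valued map is \<open>recip o k\<close> near its simple
poles, with \<open>k\<close> holomorphic and \<open>k' \<noteq> 0\<close>.
\<close>

definition recip :: "complex \<Rightarrow> complex option" where
  "recip u = (if u = 0 then None else Some (1 / u))"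

text \<open>
Local univalence read in one of the two standard charts of the sphere. Neither alternative fixes
the value at \<open>z\<close>: where \<open>h z \<noteq> 0\<close> the second one describes a finite value, which makes the
condition visibly invariant under composition with locally injective maps.
\<close>

definition locally_univalent_at :: "(complex \<Rightarrow> complex option) \<Rightarrow> complex \<Rightarrow> bool" where
  "locally_univalent_at F z \<longleftrightarrow> (\<exists>r>0. \<exists>h. h holomorphic_on ball z r \<and> deriv h z \<noteq> 0 \<and>
     ((\<forall>w\<in>ball z r. F w = Some (h w)) \<or> (\<forall>w\<in>ball z r. F w = recip (h w))))"

lemma eventually_in_small_ball:
  assumes "eventually P (nhds (z::complex))" "r > 0"
  obtains d where "0 < d" "d \<le> r" "\<forall>w\<in>ball z d. P w"
proof -
  obtain e where "e > 0" "\<forall>w. dist w z < e \<longrightarrow> P w"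
    using assms unfolding eventually_nhds_metric by blast
  then show ?thesis
    using assms by (intro that[of "min e r"]) (auto simp: dist_commute)
qed

lemma nonzero_near:
  assumes "continuous_on (ball z r) h" "r > 0" "h z \<noteq> (0::complex)"
  obtains d where "0 < d" "d \<le> r" "\<forall>w\<in>ball z d. h w \<noteq> 0"
proof -
  have "isCont h z" using assms continuous_on_interior[of "ball z r" h z] by simp
  then have "\<exists>e>0. \<forall>y. dist z y < e \<longrightarrow> h y \<noteq> 0"
    using continuous_at_avoid[of z h 0] assms by auto
  then obtain e where "e > 0" "\<forall>y. dist z y < e \<longrightarrow> h y \<noteq> 0" by blast
  then show ?thesis using assms by (intro that[of "min e r"]) auto
qed

lemma locally_univalent_at_finite:
  assumes "locally_univalent_at F z" "F z \<noteq> None"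
  obtains r h where "r > 0" "h holomorphic_on ball z r" "deriv h z \<noteq> 0"
    "\<And>w. w \<in> ball z r \<Longrightarrow> F w = Some (h w)"
proof -
  obtain r h where r: "r > 0" and h: "h holomorphic_on ball z r" "deriv h z \<noteq> 0"
    and alt: "(\<forall>w\<in>ball z r. F w = Some (h w)) \<or> (\<forall>w\<in>ball z r. F w = recip (h w))"
    using assms unfolding locally_univalent_at_def by blast
  show ?thesis
  proof (cases "\<forall>w\<in>ball z r. F w = Some (h w)")
    case True then show ?thesis using that r h by blast
  next
    case False
    with alt have rec: "\<forall>w\<in>ball z r. F w = recip (h w)" by blast
    then have hz: "h z \<noteq> 0" using assms r by (auto simp: recip_def split: if_splits)
    obtain d where d: "0 < d" "d \<le> r" "\<forall>w\<in>ball z d. h w \<noteq> 0"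
      using nonzero_near[of z r h] h r hz holomorphic_on_imp_continuous_on by blast
    have hol: "h holomorphic_on ball z d" using h d by (meson holomorphic_on_subset subset_ball)
    have "(h has_field_derivative deriv h z) (at z)"
      using h r by (simp add: holomorphic_derivI)
    then have "((\<lambda>w. 1 / h w) has_field_derivative - deriv h z / (h z)^2) (at z)"
      using hz by (auto intro!: derivative_eq_intros simp: power2_eq_square field_simps)
    then have "deriv (\<lambda>w. 1 / h w) z \<noteq> 0"
      using hz h by (simp add: DERIV_imp_deriv)
    then show ?thesis
      using d rec hol by (intro that[of d "\<lambda>w. 1 / h w"]) (auto intro!: holomorphic_intros simp: recip_def)
  qed
qed

text \<open>
With \<open>h(w) = (w - z) k(w)\<close> and \<open>k z = h' z \<noteq> 0\<close>, one has \<open>1/h = (1/k)/(w - z)\<close>, and the divided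
difference of \<open>1/k\<close> at \<open>z\<close> is the holomorphic part.
\<close>

lemma locally_univalent_at_pole:
  assumes "locally_univalent_at F z" "F z = None"
  obtains r b m where "r > 0" "b \<noteq> 0" "m holomorphic_on ball z r"
    "\<And>w. w \<in> ball z r \<Longrightarrow> w \<noteq> z \<Longrightarrow> F w = Some (b / (w - z) + m w)"
proof -
  obtain r h where r: "r > 0" and h: "h holomorphic_on ball z r" "deriv h z \<noteq> 0"
    and alt: "(\<forall>w\<in>ball z r. F w = Some (h w)) \<or> (\<forall>w\<in>ball z r. F w = recip (h w))"
    using assms unfolding locally_univalent_at_def by blast
  then have rec: "\<forall>w\<in>ball z r. F w = recip (h w)" using assms by fastforce
  then have hz: "h z = 0" using assms r by (auto simp: recip_def split: if_splits)
  define k where "k = (\<lambda>w. if w = z then deriv h z else (h w - h z) / (w - z))"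
  have k: "k holomorphic_on ball z r"
    unfolding k_def by (rule pole_lemma_open) (use h in auto)
  have kz: "k z \<noteq> 0" using h by (simp add: k_def)
  obtain d where d: "0 < d" "d \<le> r" "\<forall>w\<in>ball z d. k w \<noteq> 0"
    using nonzero_near[of z r k] k r kz holomorphic_on_imp_continuous_on by blast
  define l where "l = (\<lambda>w. 1 / k w)"
  have l: "l holomorphic_on ball z d"
    unfolding l_def using k d by (intro holomorphic_intros) (auto intro: holomorphic_on_subset)
  define m where "m = (\<lambda>w. if w = z then deriv l z else (l w - l z) / (w - z))"
  have m: "m holomorphic_on ball z d"
    unfolding m_def by (rule pole_lemma_open) (use l in auto)
  have "F w = Some (l z / (w - z) + m w)" if w: "w \<in> ball z d" "w \<noteq> z" for w
  proof -
    have kw: "k w \<noteq> 0" using w d by blast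
    then have "h w = (w - z) * k w" "h w \<noteq> 0" using w hz by (auto simp: k_def field_simps)
    moreover have "F w = recip (h w)" using rec w d by auto
    ultimately show ?thesis
      using w by (simp add: recip_def m_def l_def add_divide_distrib[symmetric] divide_simps)
  qed
  moreover have "l z \<noteq> 0" using kz by (simp add: l_def)
  ultimately show ?thesis using that[of d "l z" m] d m by blast
qed

lemma locally_univalent_at_polar:
  assumes "r > 0" "b \<noteq> 0" "m holomorphic_on ball z r" "F z = None"
    "\<And>w. w \<in> ball z r \<Longrightarrow> w \<noteq> z \<Longrightarrow> F w = Some (b / (w - z) + m w)"
  shows "locally_univalent_at F z"
proof -
  define l where "l = (\<lambda>w. b + (w - z) * m w)"
  have l: "l holomorphic_on ball z r"
    unfolding l_def using assms by (intro holomorphic_intros) 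
  have "l z \<noteq> 0" using assms by (simp add: l_def)
  then obtain d where d: "0 < d" "d \<le> r" "\<forall>w\<in>ball z d. l w \<noteq> 0"
    using nonzero_near[of z r l] l assms holomorphic_on_imp_continuous_on by blast
  define k where "k = (\<lambda>w. (w - z) / l w)"
  have l': "l holomorphic_on ball z d" using l d by (meson holomorphic_on_subset subset_ball)
  have k: "k holomorphic_on ball z d"
    unfolding k_def using l' d by (intro holomorphic_intros) auto
  have "(l has_field_derivative deriv l z) (at z)"
    using l' d by (simp add: holomorphic_derivI)
  then have "(k has_field_derivative 1 / l z) (at z)"
    unfolding k_def using \<open>l z \<noteq> 0\<close> by (auto intro!: derivative_eq_intros simp: field_simps)
  then have dk: "deriv k z \<noteq> 0" using \<open>l z \<noteq> 0\<close> by (simp add: DERIV_imp_deriv)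
  have "F w = recip (k w)" if w: "w \<in> ball z d" for w
  proof (cases "w = z")
    case True then show ?thesis using assms by (simp add: recip_def k_def)
  next
    case False
    then have "F w = Some (b / (w - z) + m w)" using assms(5) w d by auto
    moreover have "1 / k w = b / (w - z) + m w" using False d w by (simp add: k_def l_def field_simps)
    moreover have "k w \<noteq> 0" using False d w by (simp add: k_def)
    ultimately show ?thesis by (simp add: recip_def)
  qed
  then show ?thesis unfolding locally_univalent_at_def using d k dk by blast
qed

text \<open>
This lemma and the following one identify the functions defined through poles, orders and
derivatives with those defined through charts. The chart condition is the one that is stable
under composition, gluing and limits, so membership in \<open>M_lu\<close> is checked through it from here on.
\<close>

lemma mero_lu_imp_locally_univalent_at:
  assumes "open \<Omega>" "F \<in> mero_lu \<Omega>" "z \<in> \<Omega>"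
  shows "locally_univalent_at F z"
proof -
  obtain h where F: "F = sphere_map \<Omega> h" and h: "h nicely_meromorphic_on \<Omega>"
    and pole: "\<forall>z\<in>\<Omega>. is_pole h z \<longrightarrow> zorder h z = -1"
    and npole: "\<forall>z\<in>\<Omega>. \<not> is_pole h z \<longrightarrow> deriv h z \<noteq> 0"
    using assms unfolding mero_lu_def by blast
  obtain R where R: "R > 0" "ball z R \<subseteq> \<Omega>" using assms openE by blast
  show ?thesis
  proof (cases "is_pole h z")
    case False
    then have "h analytic_on {z}" using nicely_meromorphic_on_imp_analytic_at h assms by blast
    then obtain r where r: "r > 0" "h holomorphic_on ball z r" by (auto simp: analytic_at_ball)
    define d where "d = min r R"
    have d: "d > 0" "h holomorphic_on ball z d" "ball z d \<subseteq> \<Omega>"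
      using r R by (auto simp: d_def intro: holomorphic_on_subset)
    have "F w = Some (h w)" if "w \<in> ball z d" for w
      using that d not_is_pole_holomorphic[of "ball z d" w h] by (auto simp: F sphere_map_def)
    then show ?thesis unfolding locally_univalent_at_def using d npole False assms by blast
  next
    case True
    have ord: "zorder h z = -1" using pole True assms by blast
    have "isolated_singularity_at h z" 
      using h assms unfolding nicely_meromorphic_on_def meromorphic_on_altdef by blast
    then obtain r where r: "r > 0" "h analytic_on ball z r - {z}"
      unfolding isolated_singularity_at_def by blast
    then have "h holomorphic_on ball z r - {z}" by (simp add: analytic_imp_holomorphic)
    from zorder_exist_pole[OF this _ _ True] r
    obtain e where e: "e > 0" "cball z e \<subseteq> ball z r" "zor_poly h z holomorphic_on cball z e"
      "\<And>w. w\<in>cball z e - {z} \<Longrightarrow> h w = zor_poly h z w / (w-z) \<and> zor_poly h z w \<noteq> 0"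
      "zor_poly h z z \<noteq> 0"
      by (auto simp: ord)
    define d where "d = min e R"
    define g where "g = zor_poly h z"
    have d: "d > 0" "ball z d \<subseteq> cball z e" "ball z d \<subseteq> \<Omega>" "ball z d \<subseteq> ball z r"
      using e R by (auto simp: d_def)
    have g: "g holomorphic_on ball z d" "g z \<noteq> 0"
      "\<And>w. w\<in>ball z d - {z} \<Longrightarrow> h w = g w / (w-z)"
      using e d unfolding g_def by (auto intro: holomorphic_on_subset)
    define m where "m = (\<lambda>w. if w = z then deriv g z else (g w - g z) / (w - z))"
    have m: "m holomorphic_on ball z d"
      unfolding m_def by (rule pole_lemma_open) (use g in auto)
    show ?thesis
    proof (rule locally_univalent_at_polar[OF d(1) g(2) m])
      show "F z = None" using True assms by (simp add: F sphere_map_def)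
    next
      fix w assume w: "w \<in> ball z d" "w \<noteq> z"
      have "\<not> is_pole h w"
        by (rule not_is_pole_holomorphic[of "ball z r - {z}"])
          (use w d \<open>h holomorphic_on ball z r - {z}\<close> in auto)
      then show "F w = Some (g z / (w - z) + m w)"
        using w d g by (auto simp: F sphere_map_def m_def diff_divide_distrib)
    qed
  qed
qed

lemma mero_lu_if_locally_univalent_at:
  assumes "F \<in> extensional \<Omega>" "open \<Omega>" and lu: "\<And>z. z \<in> \<Omega> \<Longrightarrow> locally_univalent_at F z"
  shows "F \<in> mero_lu \<Omega>"
proof -
  define h where "h = (\<lambda>z. case F z of None \<Rightarrow> 0 | Some u \<Rightarrow> u)"
  have fin: "h analytic_on {z} \<and> deriv h z \<noteq> 0 \<and> F z = Some (h z)" if z: "z \<in> \<Omega>" "F z \<noteq> None" for z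
  proof -
    obtain r k where r: "r > 0" "k holomorphic_on ball z r" "deriv k z \<noteq> 0"
      and eq: "\<And>w. w \<in> ball z r \<Longrightarrow> F w = Some (k w)"
      using locally_univalent_at_finite[OF lu[OF z(1)] z(2)] by metis
    have hk: "h w = k w" if "w \<in> ball z r" for w using eq[OF that] by (simp add: h_def)
    then have "h holomorphic_on ball z r" using r by (metis holomorphic_transform)
    moreover have "deriv h z = deriv k z"
      by (rule complex_derivative_transform_within_open[of _ "ball z r"]) (use calculation r hk in auto)
    ultimately show ?thesis using r eq hk by (auto simp: analytic_at_ball)
  qed
  have inf: "isolated_singularity_at h z \<and> is_pole h z \<and> h z = 0 \<and> zorder h z = -1"
    if z: "z \<in> \<Omega>" "F z = None" for z
  proof -
    obtain r b m where r: "r > 0" "b \<noteq> 0" "m holomorphic_on ball z r"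
      and eq: "\<And>w. w \<in> ball z r \<Longrightarrow> w \<noteq> z \<Longrightarrow> F w = Some (b / (w - z) + m w)"
      using locally_univalent_at_pole[OF lu[OF z(1)] z(2)] by metis
    define g where "g = (\<lambda>w. b + (w - z) * m w)"
    have g: "g holomorphic_on ball z r" unfolding g_def using r by (intro holomorphic_intros)
    have gz: "g z \<noteq> 0" using r by (simp add: g_def)
    have hk: "h w = g w / (w - z)" if "w \<in> ball z r" "w \<noteq> z" for w
      using eq[OF that] that by (simp add: h_def g_def field_simps)
    have "(\<lambda>w. g w / (w - z)) holomorphic_on ball z r - {z}"
      using g by (intro holomorphic_intros) (auto intro: holomorphic_on_subset)
    then have hol: "h holomorphic_on ball z r - {z}"
      by (rule holomorphic_transform) (use hk in auto)
    then have iso: "isolated_singularity_at h z"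
      unfolding isolated_singularity_at_def using r
      by (intro exI[of _ r]) (simp add: analytic_on_open open_delete)
    have "is_pole (\<lambda>w. g w / (w - z)) z"
    proof (rule is_pole_divide)
      show "isCont g z" using g r holomorphic_on_imp_continuous_on continuous_on_interior[of "ball z r" g z] by auto
      show "filterlim (\<lambda>w. w - z) (at 0) (at z)"
        by (auto simp: filterlim_at eventually_at_filter intro!: tendsto_eq_intros)
    qed fact
    moreover have "eventually (\<lambda>w. h w = g w / (w - z)) (at z)"
      using r hk unfolding eventually_at by (auto simp: dist_commute intro!: exI[of _ r])
    ultimately have "is_pole h z" using is_pole_cong by fast
    moreover have "zorder h z = -1"
      by (rule zorder_eqI[of "ball z r" z g]) (use r g gz hk in \<open>auto simp: power_int_minus field_simps\<close>)
    ultimately show ?thesis using iso z by (simp add: h_def)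
  qed
  have pole_iff: "is_pole h z \<longleftrightarrow> F z = None" if z: "z \<in> \<Omega>" for z
  proof
    assume "is_pole h z"
    show "F z = None"
    proof (rule ccontr)
      assume "F z \<noteq> None"
      then have "h analytic_on {z}" using fin z by blast
      then show False using \<open>is_pole h z\<close> analytic_at_imp_no_pole by blast
    qed
  qed (use inf z in blast)
  have "h nicely_meromorphic_on \<Omega>"
    unfolding nicely_meromorphic_on_def meromorphic_on_altdef
  proof (intro conjI ballI)
    fix z assume z: "z \<in> \<Omega>"
    show "isolated_singularity_at h z"
      using z inf fin by (metis isolated_singularity_at_analytic)
    show "not_essential h z"
      using z inf fin by (metis not_essential_analytic not_essential_def)
    show "is_pole h z \<and> h z = 0 \<or> h \<midarrow>z\<rightarrow> h z"
      using z inf fin by (metis analytic_at_imp_isCont isContD)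
  qed
  moreover have "F = sphere_map \<Omega> h"
  proof
    fix z show "F z = sphere_map \<Omega> h z"
      using assms(1) pole_iff[of z] fin[of z] by (cases "z \<in> \<Omega>") (auto simp: sphere_map_def extensional_def)
  qed
  ultimately show ?thesis
    unfolding mero_lu_def using pole_iff inf fin by blast
qed

lemma locally_univalent_at_cong:
  assumes "locally_univalent_at F z" "eventually (\<lambda>w. F w = G w) (nhds z)"
  shows "locally_univalent_at G z"
proof -
  obtain r h where r: "r > 0" and h: "h holomorphic_on ball z r" "deriv h z \<noteq> 0"
    and alt: "(\<forall>w\<in>ball z r. F w = Some (h w)) \<or> (\<forall>w\<in>ball z r. F w = recip (h w))"
    using assms unfolding locally_univalent_at_def by blast
  obtain d where d: "0 < d" "d \<le> r" "\<forall>w\<in>ball z d. F w = G w"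
    using eventually_in_small_ball[OF assms(2) r] by blast
  have "ball z d \<subseteq> ball z r" using d by auto
  then show ?thesis
    unfolding locally_univalent_at_def using d h alt
    by (intro exI[of _ d] conjI exI[of _ h]) (auto intro: holomorphic_on_subset)
qed

lemma locally_univalent_at_compose:
  assumes F: "locally_univalent_at F (\<phi> z)" and \<phi>: "\<phi> holomorphic_on S" "open S" "z \<in> S" "deriv \<phi> z \<noteq> 0"
  shows "locally_univalent_at (F \<circ> \<phi>) z"
proof -
  obtain r h where r: "r > 0" and h: "h holomorphic_on ball (\<phi> z) r" "deriv h (\<phi> z) \<noteq> 0"
    and alt: "(\<forall>w\<in>ball (\<phi> z) r. F w = Some (h w)) \<or> (\<forall>w\<in>ball (\<phi> z) r. F w = recip (h w))"
    using F unfolding locally_univalent_at_def by blast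
  have "isCont \<phi> z" 
    using \<phi> holomorphic_on_imp_continuous_on continuous_on_interior[of S \<phi> z] by (simp add: interior_open)
  then have "(\<phi> \<longlongrightarrow> \<phi> z) (nhds z)" by (simp add: isCont_def tendsto_at_iff_tendsto_nhds)
  then have "eventually (\<lambda>w. \<phi> w \<in> ball (\<phi> z) r) (nhds z)"
    using topological_tendstoD[of \<phi> "\<phi> z" "nhds z" "ball (\<phi> z) r"] r by simp
  with eventually_nhds_in_open[OF \<phi>(2,3)]
  have "eventually (\<lambda>w. \<phi> w \<in> ball (\<phi> z) r \<and> w \<in> S) (nhds z)" by eventually_elim simp
  then obtain d where d: "0 < d" "\<forall>w\<in>ball z d. \<phi> w \<in> ball (\<phi> z) r \<and> w \<in> S"
    by (rule eventually_in_small_ball[OF _ zero_less_one])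
  have 1: "(h \<circ> \<phi>) holomorphic_on ball z d"
  proof (rule holomorphic_on_compose_gen[OF _ h(1)])
    show "\<phi> holomorphic_on ball z d" using \<phi>(1) by (rule holomorphic_on_subset) (use d in auto)
  qed (use d in auto)
  have 2: "deriv (h \<circ> \<phi>) z = deriv h (\<phi> z) * deriv \<phi> z"
  proof (rule deriv_chain)
    show "\<phi> field_differentiable at z" using \<phi> holomorphic_on_imp_differentiable_at by blast
    show "h field_differentiable at (\<phi> z)"
      using h(1) by (rule holomorphic_on_imp_differentiable_at) (use r in auto)
  qed
  show ?thesis
    unfolding locally_univalent_at_def
  proof (intro exI[of _ d] conjI exI[of _ "h \<circ> \<phi>"])
    show "deriv (h \<circ> \<phi>) z \<noteq> 0" using 2 h \<phi> by simp
    show "(\<forall>w\<in>ball z d. (F \<circ> \<phi>) w = Some ((h \<circ> \<phi>) w)) \<or>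
      (\<forall>w\<in>ball z d. (F \<circ> \<phi>) w = recip ((h \<circ> \<phi>) w))"
      using alt d by auto
  qed (use 1 d in auto)
qed

lemma mero_lu_compose:
  assumes F: "F \<in> mero_lu T" and \<phi>: "\<phi> holomorphic_on S" "\<phi> ` S \<subseteq> T" "\<And>z. z \<in> S \<Longrightarrow> deriv \<phi> z \<noteq> 0"
    and "open S" "open T"
  shows "compose S F \<phi> \<in> mero_lu S"
proof (rule mero_lu_if_locally_univalent_at)
  fix z assume z: "z \<in> S"
  have "locally_univalent_at (F \<circ> \<phi>) z"
  proof (rule locally_univalent_at_compose[where S = S])
    show "locally_univalent_at F (\<phi> z)"
      using \<phi>(2) z by (intro mero_lu_imp_locally_univalent_at[OF \<open>open T\<close> F]) blast
  qed (use z \<phi> \<open>open S\<close> in blast)+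
  moreover have "eventually (\<lambda>w. (F \<circ> \<phi>) w = compose S F \<phi> w) (nhds z)"
    using eventually_nhds_in_open[OF \<open>open S\<close> z] by eventually_elim (simp add: compose_def)
  ultimately show "locally_univalent_at (compose S F \<phi>) z" by (rule locally_univalent_at_cong)
qed (simp_all add: \<open>open S\<close> compose_def)

lemma mero_lu_restrict:
  assumes "F \<in> mero_lu T" "S \<subseteq> T" "open S" "open T"
  shows "restrict F S \<in> mero_lu S"
proof -
  have "compose S F (\<lambda>z. z) \<in> mero_lu S"
    by (rule mero_lu_compose[OF assms(1)]) (use assms in \<open>auto intro!: holomorphic_intros\<close>)
  then show ?thesis by (simp add: compose_def restrict_def)
qed

section \<open>Runge approximation by entire functions\<close>

definition entire_approximable :: "complex set \<Rightarrow> (complex \<Rightarrow> complex) \<Rightarrow> bool" where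
  "entire_approximable X u \<longleftrightarrow>
     (\<forall>\<epsilon>>0. \<exists>p. p holomorphic_on UNIV \<and> (\<forall>z\<in>X. cmod (p z - u z) < \<epsilon>))"

lemma entire_approximableD:
  assumes "entire_approximable X u" "\<epsilon> > 0"
  obtains p where "p holomorphic_on UNIV" "\<And>z. z \<in> X \<Longrightarrow> cmod (p z - u z) < \<epsilon>"
  using assms unfolding entire_approximable_def by blast

lemma entire_approximable_entire: "u holomorphic_on UNIV \<Longrightarrow> entire_approximable X u"
  unfolding entire_approximable_def by (intro allI impI exI[of _ u]) auto

lemma entire_approximable_cong:
  "(\<And>z. z \<in> X \<Longrightarrow> u z = v z) \<Longrightarrow> entire_approximable X u \<longleftrightarrow> entire_approximable X v"
  unfolding entire_approximable_def by simp

lemma entire_approximable_limit: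
  assumes "\<And>\<epsilon>. \<epsilon> > 0 \<Longrightarrow> \<exists>v. entire_approximable X v \<and> (\<forall>z\<in>X. cmod (v z - u z) < \<epsilon>)"
  shows "entire_approximable X u"
  unfolding entire_approximable_def
proof (intro allI impI)
  fix \<epsilon> :: real assume "\<epsilon> > 0"
  then obtain v where v: "entire_approximable X v" "\<forall>z\<in>X. cmod (v z - u z) < \<epsilon>/2"
    using assms[of "\<epsilon>/2"] by auto
  obtain p where p: "p holomorphic_on UNIV" "\<And>z. z \<in> X \<Longrightarrow> cmod (p z - v z) < \<epsilon>/2"
    using entire_approximableD[OF v(1), of "\<epsilon>/2"] \<open>\<epsilon> > 0\<close> by auto
  have "cmod (p z - u z) < \<epsilon>" if "z \<in> X" for z
    using norm_triangle_ineq[of "p z - v z" "v z - u z"] p(2)[OF that] v(2) that by fastforce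
  then show "\<exists>p. p holomorphic_on UNIV \<and> (\<forall>z\<in>X. cmod (p z - u z) < \<epsilon>)" using p by blast
qed

lemma entire_approximable_add:
  assumes "entire_approximable X u" "entire_approximable X v"
  shows "entire_approximable X (\<lambda>z. u z + v z)"
  unfolding entire_approximable_def
proof (intro allI impI)
  fix \<epsilon> :: real assume "\<epsilon> > 0"
  obtain p where p: "p holomorphic_on UNIV" "\<And>z. z \<in> X \<Longrightarrow> cmod (p z - u z) < \<epsilon>/2"
    using entire_approximableD[OF assms(1), of "\<epsilon>/2"] \<open>\<epsilon> > 0\<close> by auto
  obtain q where q: "q holomorphic_on UNIV" "\<And>z. z \<in> X \<Longrightarrow> cmod (q z - v z) < \<epsilon>/2"
    using entire_approximableD[OF assms(2), of "\<epsilon>/2"] \<open>\<epsilon> > 0\<close> by auto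
  have "cmod (p z + q z - (u z + v z)) < \<epsilon>" if "z \<in> X" for z
  proof -
    have "p z + q z - (u z + v z) = (p z - u z) + (q z - v z)" by simp
    then have "cmod (p z + q z - (u z + v z)) \<le> cmod (p z - u z) + cmod (q z - v z)"
      by (metis norm_triangle_ineq)
    then show ?thesis using p(2)[OF that] q(2)[OF that] by linarith
  qed
  then show "\<exists>p. p holomorphic_on UNIV \<and> (\<forall>z\<in>X. cmod (p z - (u z + v z)) < \<epsilon>)"
    using p q by (intro exI[of _ "\<lambda>z. p z + q z"]) (auto intro!: holomorphic_intros)
qed

lemma entire_approximable_bounded:
  assumes "entire_approximable X u" "compact X"
  obtains B where "B > 0" "\<And>z. z \<in> X \<Longrightarrow> cmod (u z) \<le> B"
proof -
  obtain p where p: "p holomorphic_on UNIV" "\<And>z. z \<in> X \<Longrightarrow> cmod (p z - u z) < 1"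
    using entire_approximableD[OF assms(1), of 1] by auto
  have "compact (p ` X)"
    using p assms by (meson compact_continuous_image continuous_on_subset holomorphic_on_imp_continuous_on subset_UNIV)
  then obtain B where B: "B > 0" "\<And>z. z \<in> X \<Longrightarrow> cmod (p z) \<le> B"
    by (metis bounded_pos compact_imp_bounded imageI)
  have "cmod (u z) \<le> B + 1" if "z \<in> X" for z
    using norm_triangle_ineq2[of "u z" "p z"] B(2)[OF that] p(2)[OF that]
    by (simp add: norm_minus_commute)
  then show ?thesis using B by (intro that[of "B + 1"]) auto
qed

lemma entire_approximable_mult:
  assumes u: "entire_approximable X u" and v: "entire_approximable X v" and "compact X"
  shows "entire_approximable X (\<lambda>z. u z * v z)"
  unfolding entire_approximable_def
proof (intro allI impI)
  fix \<epsilon> :: real assume \<epsilon>: "\<epsilon> > 0"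
  obtain B where B: "B > 0" "\<And>z. z \<in> X \<Longrightarrow> cmod (u z) \<le> B" 
    using entire_approximable_bounded[OF u \<open>compact X\<close>] by blast
  obtain q where q: "q holomorphic_on UNIV" "\<And>z. z \<in> X \<Longrightarrow> cmod (q z - v z) < \<epsilon>/(2*B)"
    using entire_approximableD[OF v, of "\<epsilon>/(2*B)"] \<epsilon> B by auto
  obtain C where C: "C > 0" "\<And>z. z \<in> X \<Longrightarrow> cmod (q z) \<le> C" 
    using entire_approximable_bounded[OF entire_approximable_entire[OF q(1)] \<open>compact X\<close>] by blast
  obtain p where p: "p holomorphic_on UNIV" "\<And>z. z \<in> X \<Longrightarrow> cmod (p z - u z) < \<epsilon>/(2*C)"
    using entire_approximableD[OF u, of "\<epsilon>/(2*C)"] \<epsilon> C by auto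
  have "cmod (p z * q z - u z * v z) < \<epsilon>" if z: "z \<in> X" for z
  proof -
    have "p z * q z - u z * v z = (p z - u z) * q z + u z * (q z - v z)" by (simp add: algebra_simps)
    also have "cmod \<dots> \<le> cmod (p z - u z) * cmod (q z) + cmod (u z) * cmod (q z - v z)"
      by (metis norm_mult norm_triangle_ineq)
    also have "\<dots> \<le> cmod (p z - u z) * C + B * cmod (q z - v z)"
      by (intro add_mono mult_mono) (use B(2)[OF z] C(2)[OF z] B C in auto)
    also have "\<dots> < \<epsilon>/(2*C) * C + B * (\<epsilon>/(2*B))"
      by (intro add_strict_mono mult_strict_right_mono mult_strict_left_mono p q z B C)
    also have "\<dots> = \<epsilon>" using B C by simp
    finally show ?thesis .
  qed
  then show "\<exists>p. p holomorphic_on UNIV \<and> (\<forall>z\<in>X. cmod (p z - u z * v z) < \<epsilon>)"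
    using p q by (intro exI[of _ "\<lambda>z. p z * q z"]) (auto intro!: holomorphic_intros)
qed

lemma entire_approximable_power:
  assumes "entire_approximable X u" "compact X"
  shows "entire_approximable X (\<lambda>z. u z ^ n)"
proof (induction n)
  case (Suc n)
  then show ?case using entire_approximable_mult[OF assms(1) _ assms(2)] by simp
qed (simp add: entire_approximable_entire)

lemma entire_approximable_sum:
  assumes "\<And>i. i \<in> I \<Longrightarrow> entire_approximable X (u i)"
  shows "entire_approximable X (\<lambda>z. \<Sum>i\<in>I. u i z)"
  using assms
proof (induction I rule: infinite_finite_induct)
  case (insert i I)
  then show ?case using entire_approximable_add[of X "u i" "\<lambda>z. \<Sum>i\<in>I. u i z"] by simp
qed (simp_all add: entire_approximable_entire)

text \<open>
The geometric series converges uniformly on \<open>X\<close> when \<open>|u|\<close> is bounded there by a number below 1.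
It is the mechanism by which poles are moved.
\<close>

lemma entire_approximable_geometric:
  assumes u: "entire_approximable X u" "compact X" and q: "q < 1" "\<And>z. z \<in> X \<Longrightarrow> cmod (u z) \<le> q"
  shows "entire_approximable X (\<lambda>z. 1 / (1 - u z))"
proof (cases "X = {}")
  case True then show ?thesis by (simp add: entire_approximable_def) (use holomorphic_on_const in blast)
next
  case False
  then have "q \<ge> 0" using q by (meson all_not_in_conv norm_ge_zero order_trans)
  show ?thesis
  proof (rule entire_approximable_limit)
    fix \<epsilon> :: real assume "\<epsilon> > 0"
    have "(\<lambda>n. q ^ n) \<longlonglongrightarrow> 0" by (rule LIMSEQ_power_zero) (use q \<open>q \<ge> 0\<close> in simp)
    then have "eventually (\<lambda>n. q ^ n < \<epsilon> * (1 - q)) sequentially"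
      by (rule order_tendstoD) (use \<open>\<epsilon> > 0\<close> q in simp)
    then obtain N where N: "q ^ N < \<epsilon> * (1 - q)" by (auto simp: eventually_sequentially)
    have "cmod ((\<Sum>n<N. u z ^ n) - 1 / (1 - u z)) < \<epsilon>" if z: "z \<in> X" for z
    proof -
      have "u z \<noteq> 1" using q(2)[OF z] q(1) by auto
      then have "(\<Sum>n<N. u z ^ n) = (1 - u z ^ N) / (1 - u z)"
        by (simp add: sum_gp_strict)
      then have "(\<Sum>n<N. u z ^ n) - 1 / (1 - u z) = - (u z ^ N / (1 - u z))"
        by (simp add: diff_divide_distrib)
      then have "cmod ((\<Sum>n<N. u z ^ n) - 1 / (1 - u z)) = cmod (u z) ^ N / cmod (1 - u z)"
        by (simp add: norm_divide norm_power)
      also have "\<dots> \<le> q ^ N / (1 - q)"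
      proof (rule frac_le)
        show "1 - q \<le> cmod (1 - u z)" using norm_triangle_ineq2[of 1 "u z"] q(2)[OF z] by simp
      qed (use q z in \<open>auto intro!: power_mono simp: \<open>q \<ge> 0\<close>\<close>)
      also have "\<dots> < \<epsilon>" using N q by (simp add: field_simps)
      finally show ?thesis .
    qed
    then show "\<exists>v. entire_approximable X v \<and> (\<forall>z\<in>X. cmod (v z - 1 / (1 - u z)) < \<epsilon>)"
      by (intro exI[of _ "\<lambda>z. \<Sum>n<N. u z ^ n"]) (auto intro!: entire_approximable_sum entire_approximable_power u)
  qed
qed

text \<open>
Pole pushing. If \<open>1/(z - x)\<close> is approximable and \<open>y\<close> is close to \<open>x\<close> compared with the distance
from \<open>X\<close>, then \<open>1/(z - y)\<close> is a geometric series in \<open>(y - x)/(z - x)\<close>. So approximability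
spreads through the connected complement of \<open>X\<close>, starting from a pole so far away that the series
in \<open>z\<close> itself converges.
\<close>

lemma entire_approximable_pole:
  assumes X: "compact X" "connected (- X)" and "\<zeta> \<notin> X"
  shows "entire_approximable X (\<lambda>z. 1 / (z - \<zeta>))"
proof -
  obtain R where R: "R > 0" "\<And>z. z \<in> X \<Longrightarrow> cmod z \<le> R"
    using X by (metis bounded_pos compact_imp_bounded)
  \<comment> \<open>A pole at twice the radius of a disc about the origin that contains \<open>X\<close>.\<close>
  define \<zeta>0 :: complex where "\<zeta>0 = of_real (2 * R)"
  have n0: "cmod \<zeta>0 = 2 * R" using R by (simp add: \<zeta>0_def)
  then have z0: "\<zeta>0 \<noteq> 0" "\<zeta>0 \<notin> X" using R(1) R(2)[of \<zeta>0] by auto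
  have start: "entire_approximable X (\<lambda>z. 1 / (z - \<zeta>0))"
  proof -
    have "entire_approximable X (\<lambda>z. - (1 / \<zeta>0) * (1 / (1 - z / \<zeta>0)))"
    proof (intro entire_approximable_mult X entire_approximable_geometric[where q = "1/2"])
      show "cmod (z / \<zeta>0) \<le> 1/2" if "z \<in> X" for z
        using R(1) R(2)[OF that] by (simp add: norm_divide n0 field_simps)
    qed (use z0 in \<open>auto intro!: entire_approximable_entire holomorphic_intros\<close>)
    then show ?thesis
    proof (rule entire_approximable_cong[THEN iffD1, rotated])
      fix z assume "z \<in> X"
      then have "z - \<zeta>0 \<noteq> 0" "1 - z / \<zeta>0 = - (z - \<zeta>0) / \<zeta>0" using z0 by (auto simp: field_simps)
      then show "- (1 / \<zeta>0) * (1 / (1 - z / \<zeta>0)) = 1 / (z - \<zeta>0)" using z0 by (simp add: divide_simps)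
    qed
  qed
  show ?thesis
  proof (rule connected_induction_simple[OF X(2), where P = "\<lambda>\<zeta>. entire_approximable X (\<lambda>z. 1 / (z - \<zeta>))" and a = \<zeta>0 and b = \<zeta>])
    fix \<zeta> assume "\<zeta> \<in> - X"
    moreover have "open (- X)" using X by (simp add: compact_imp_closed open_Compl)
    ultimately obtain e where e: "e > 0" "ball \<zeta> e \<subseteq> - X" using openE by blast
    show "\<exists>T. openin (top_of_set (- X)) T \<and> \<zeta> \<in> T \<and>
      (\<forall>x\<in>T. \<forall>y\<in>T. entire_approximable X (\<lambda>z. 1 / (z - x)) \<longrightarrow> entire_approximable X (\<lambda>z. 1 / (z - y)))"
    proof (intro exI[of _ "ball \<zeta> (e/4)"] conjI ballI impI)
      show "openin (top_of_set (- X)) (ball \<zeta> (e/4))"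
      proof (rule open_subset)
        show "ball \<zeta> (e/4) \<subseteq> - X" using e subset_ball[of "e/4" e \<zeta>] by auto
      qed simp
    next
      fix x y assume x: "x \<in> ball \<zeta> (e/4)" and y: "y \<in> ball \<zeta> (e/4)"
        and ax: "entire_approximable X (\<lambda>z. 1 / (z - x))"
      have xy: "cmod (y - x) \<le> e/2" using x y dist_triangle2[of y x \<zeta>] by (simp add: dist_norm norm_minus_commute)
      have far: "cmod (z - x) \<ge> 3/4 * e" "z \<noteq> y" if "z \<in> X" for z
      proof -
        have "dist \<zeta> z \<ge> e" using e that by force
        then show "cmod (z - x) \<ge> 3/4 * e" "z \<noteq> y" 
          using x y e dist_triangle[of \<zeta> z x] by (auto simp: dist_norm norm_minus_commute)
      qed
      have "entire_approximable X (\<lambda>z. 1 / (z - x) * (1 / (1 - (y - x) * (1 / (z - x)))))"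
      proof (intro entire_approximable_mult ax X entire_approximable_geometric[where q = "2/3"])
        show "cmod ((y - x) * (1 / (z - x))) \<le> 2/3" if "z \<in> X" for z
        proof -
          have "cmod ((y - x) * (1 / (z - x))) = cmod (y - x) / cmod (z - x)" by (simp add: norm_divide)
          also have "\<dots> \<le> (e/2) / (3/4 * e)" by (rule frac_le) (use far[OF that] xy e in auto)
          finally show ?thesis using e by simp
        qed
      qed (auto intro!: entire_approximable_entire holomorphic_intros)
      then show "entire_approximable X (\<lambda>z. 1 / (z - y))"
      proof (rule entire_approximable_cong[THEN iffD1, rotated])
        fix z assume z: "z \<in> X"
        have nz: "z - x \<noteq> 0" "z - y \<noteq> 0" using far[OF z] e by auto
        have "1 - (y - x) * (1 / (z - x)) = (z - y) / (z - x)" using nz by (simp add: field_simps)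
        then show "1 / (z - x) * (1 / (1 - (y - x) * (1 / (z - x)))) = 1 / (z - y)" using nz by simp
      qed
    qed (use e in auto)
  qed (use start z0 \<open>\<zeta> \<notin> X\<close> in auto)
qed

text \<open>
Riemann sums of the integral converge uniformly on \<open>X\<close>, because the integrand is uniformly
continuous on the compact set \<open>{0..1} \<times> X\<close>.
\<close>

lemma entire_approximable_integral:
  fixes F :: "real \<Rightarrow> complex \<Rightarrow> complex"
  assumes "compact X" and cont: "continuous_on ({0..1} \<times> X) (\<lambda>(t, z). F t z)"
    and F: "\<And>t. t \<in> {0..1} \<Longrightarrow> entire_approximable X (F t)"
  shows "entire_approximable X (\<lambda>z. integral {0..1} (\<lambda>t. F t z))"
proof (rule entire_approximable_limit)
  fix \<epsilon> :: real assume "\<epsilon> > 0"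
  have "uniformly_continuous_on ({0..1} \<times> X) (\<lambda>(t, z). F t z)"
    using cont assms by (intro compact_uniformly_continuous compact_Times) auto
  then obtain d where d: "d > 0" "\<And>p q. p \<in> {0..1} \<times> X \<Longrightarrow> q \<in> {0..1} \<times> X \<Longrightarrow> dist q p < d \<Longrightarrow>
     dist ((\<lambda>(t, z). F t z) q) ((\<lambda>(t, z). F t z) p) < \<epsilon>/2"
    using \<open>\<epsilon> > 0\<close> unfolding uniformly_continuous_on_def by (metis half_gt_zero)
  obtain N :: nat where N: "N > 0" "1 / real N < d"
    using d(1) by (metis inverse_eq_divide reals_Archimedean zero_less_Suc)
  define S where "S = (\<lambda>k z. \<Sum>j<k. F (real j / real N) z / of_nat N)"
  have err: "cmod (S k z - integral {0..real k / real N} (\<lambda>t. F t z)) \<le> real k / real N * (\<epsilon>/2)"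
    if "k \<le> N" and z: "z \<in> X" for k z
    using \<open>k \<le> N\<close>
  proof (induction k)
    case 0 then show ?case by (simp add: S_def)
  next
    case (Suc k)
    let ?a = "real k / real N" and ?b = "real (Suc k) / real N"
    have ab: "0 \<le> ?a" "?a \<le> ?b" "?b \<le> 1" using Suc N by (auto simp: field_simps)
    have cz: "continuous_on {0..1} (\<lambda>t. F t z)"
    proof -
      have "continuous_on {0..1} ((\<lambda>(t, z). F t z) \<circ> (\<lambda>t. (t, z)))"
        by (intro continuous_on_compose continuous_intros continuous_on_subset[OF cont]) (use z in auto)
      then show ?thesis by (simp add: o_def)
    qed
    have ib: "(\<lambda>t. F t z) integrable_on {c..e}" if "0 \<le> c" "e \<le> 1" for c e
      by (rule integrable_continuous_real) (use that in \<open>auto intro: continuous_on_subset[OF cz]\<close>)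
    have split: "integral {0..?b} (\<lambda>t. F t z) = integral {0..?a} (\<lambda>t. F t z) + integral {?a..?b} (\<lambda>t. F t z)"
      by (rule Henstock_Kurzweil_Integration.integral_combine[symmetric]) (use ab ib in auto)
    have len: "?b - ?a = 1 / real N" by (simp add: add_divide_distrib)
    have "F ?a z / of_nat N = integral {?a..?b} (\<lambda>t. F ?a z)"
      using ab len by (simp add: scaleR_conv_of_real)
    moreover have "integral {?a..?b} (\<lambda>t. F ?a z - F t z) =
        integral {?a..?b} (\<lambda>t. F ?a z) - integral {?a..?b} (\<lambda>t. F t z)"
      by (rule Henstock_Kurzweil_Integration.integral_diff) (use ib ab in auto)
    ultimately have "F ?a z / of_nat N - integral {?a..?b} (\<lambda>t. F t z) = integral {?a..?b} (\<lambda>t. F ?a z - F t z)"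
      by (simp only:)
    also have "cmod \<dots> \<le> \<epsilon>/2 * (?b - ?a)"
    proof (rule integral_bound)
      show "continuous_on {?a..?b} (\<lambda>t. F ?a z - F t z)"
        by (intro continuous_intros continuous_on_subset[OF cz]) (use ab in auto)
      show "cmod (F ?a z - F t z) \<le> \<epsilon>/2" if "t \<in> {?a..?b}" for t
      proof -
        have "dist (?a, z) (t, z) < d" using that len N by (auto simp: dist_Pair_Pair dist_real_def)
        moreover have "0 \<le> t" "t \<le> 1" using that ab(1,3) by (meson atLeastAtMost_iff order_trans)+
        ultimately have "dist (F ?a z) (F t z) < \<epsilon>/2" using d(2)[of "(t, z)" "(?a, z)"] that z ab by auto
        then show ?thesis by (simp add: dist_norm)
      qed
    qed (use ab in auto)
    finally have "cmod (F ?a z / of_nat N - integral {?a..?b} (\<lambda>t. F t z)) \<le> \<epsilon>/2 * (1 / real N)"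
      by (simp only: len)
    moreover have "cmod (S k z - integral {0..?a} (\<lambda>t. F t z)) \<le> ?a * (\<epsilon>/2)" using Suc by simp
    ultimately have "cmod ((S k z - integral {0..?a} (\<lambda>t. F t z)) + (F ?a z / of_nat N - integral {?a..?b} (\<lambda>t. F t z)))
       \<le> ?a * (\<epsilon>/2) + \<epsilon>/2 * (1 / real N)"
      by (rule norm_triangle_mono[rotated])
    moreover have "S (Suc k) z = S k z + F ?a z / of_nat N" by (simp add: S_def)
    moreover have "?b * (\<epsilon>/2) = ?a * (\<epsilon>/2) + \<epsilon>/2 * (1 / real N)"
    proof -
      have "?b = ?a + 1 / real N" by (simp add: add_divide_distrib)
      then show ?thesis by (metis distrib_right mult.commute)
    qed
    ultimately show ?case unfolding split by (simp only: add_diff_add)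
  qed
  have "cmod (S N z - integral {0..1} (\<lambda>t. F t z)) < \<epsilon>" if "z \<in> X" for z
    using err[of N z] that N \<open>\<epsilon> > 0\<close> by simp
  moreover have "entire_approximable X (S N)"
    unfolding S_def
  proof (rule entire_approximable_sum)
    fix j assume "j \<in> {..<N}"
    then have "entire_approximable X (\<lambda>z. F (real j / real N) z * (1 / of_nat N))"
      by (intro entire_approximable_mult F \<open>compact X\<close> entire_approximable_entire) auto
    then show "entire_approximable X (\<lambda>z. F (real j / real N) z / of_nat N)" by simp
  qed
  ultimately show "\<exists>v. entire_approximable X v \<and> (\<forall>z\<in>X. cmod (v z - integral {0..1} (\<lambda>t. F t z)) < \<epsilon>)"
    by blast
qed

text \<open>
A Cauchy integral over a curve off \<open>X\<close> is a superposition of functions with one simple pole off \<open>X\<close>,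
each of them approximable by pole pushing.
\<close>

lemma entire_approximable_Cauchy_kernel:
  fixes c w :: "real \<Rightarrow> complex"
  assumes X: "compact X" "connected (- X)"
    and c: "continuous_on {0..1} c" "c ` {0..1} \<inter> X = {}" and w: "continuous_on {0..1} w"
  shows "entire_approximable X (\<lambda>z. integral {0..1} (\<lambda>t. w t / (c t - z)))"
proof (rule entire_approximable_integral[OF X(1)])
  have c': "continuous_on ({0..1} \<times> X) (\<lambda>x. c (fst x))"
    by (rule continuous_on_compose2[OF c(1)]) (auto intro!: continuous_intros)
  have w': "continuous_on ({0..1} \<times> X) (\<lambda>x. w (fst x))"
    by (rule continuous_on_compose2[OF w]) (auto intro!: continuous_intros)
  show "continuous_on ({0..1} \<times> X) (\<lambda>(t, z). w t / (c t - z))"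
    unfolding case_prod_unfold
    by (intro continuous_intros c' w') (use c(2) in \<open>auto simp: disjoint_iff image_iff\<close>)
next
  fix t :: real assume t: "t \<in> {0..1}"
  then have "c t \<notin> X" using c(2) by blast
  then have "entire_approximable X (\<lambda>z. (- w t) * (1 / (z - c t)))"
    by (intro entire_approximable_mult X entire_approximable_pole entire_approximable_entire) auto
  then show "entire_approximable X (\<lambda>z. w t / (c t - z))"
    by (rule entire_approximable_cong[THEN iffD1, rotated])
      (metis (no_types, opaque_lifting) minus_diff_eq minus_divide_divide mult_minus_left times_divide_eq_right mult.right_neutral minus_divide_left)
qed

lemma compact_univalent_disc:
  assumes "\<psi> holomorphic_on ball 0 r" "r > 1"
  shows "compact (\<psi> ` cball 0 1)"
proof (rule compact_continuous_image)
  have "cball 0 1 \<subseteq> ball (0::complex) r" using assms by auto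
  then show "continuous_on (cball 0 1) \<psi>"
    using assms(1) holomorphic_on_imp_continuous_on continuous_on_subset by blast
qed auto

lemma connected_complement_univalent_disc:
  fixes \<psi> :: "complex \<Rightarrow> complex"
  assumes "\<psi> holomorphic_on ball 0 r" "inj_on \<psi> (ball 0 r)" "r > 1"
  shows "connected (- \<psi> ` cball 0 1)"
proof (rule connected_complement_homeomorphic_convex_compact)
  have sub: "cball 0 1 \<subseteq> ball (0::complex) r" using assms by auto
  have "cball (0::complex) 1 homeomorphic \<psi> ` cball 0 1"
  proof (rule homeomorphic_compact[OF _ _ refl])
    show "continuous_on (cball 0 1) \<psi>"
      using assms(1) sub holomorphic_on_imp_continuous_on continuous_on_subset by blast
    show "inj_on \<psi> (cball 0 1)" using assms(2) sub inj_on_subset by blast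
  qed auto
  then show "\<psi> ` cball 0 1 homeomorphic cball (0::complex) 1" using homeomorphic_sym by blast
qed auto

text \<open>
Cauchy's formula on the image of a disc, pulled back to the disc: since \<open>\<psi>\<close> is univalent,
\<open>u(\<psi> \<zeta>) \<psi>'(\<zeta>) / (\<psi> \<zeta> - \<psi> x)\<close> has only the simple pole \<open>x\<close>, with residue \<open>u(\<psi> x)\<close>. Working
with the parametrised contour avoids any discussion of winding numbers around the image.
\<close>

lemma Cauchy_integral_univalent_disc:
  assumes \<psi>: "\<psi> holomorphic_on ball 0 r" "inj_on \<psi> (ball 0 r)" and \<rho>: "0 < \<rho>" "\<rho> < r"
    and u: "u holomorphic_on \<psi> ` ball 0 r"
  shows "cmod x < \<rho> \<Longrightarrow> ((\<lambda>\<zeta>. u (\<psi> \<zeta>) * deriv \<psi> \<zeta> / (\<psi> \<zeta> - \<psi> x)) has_contour_integral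
           2 * of_real pi * \<i> * u (\<psi> x)) (circlepath 0 \<rho>)"
    and "z \<notin> \<psi> ` ball 0 r \<Longrightarrow> ((\<lambda>\<zeta>. u (\<psi> \<zeta>) * deriv \<psi> \<zeta> / (\<psi> \<zeta> - z)) has_contour_integral 0)
           (circlepath 0 \<rho>)"
proof -
  have u\<psi>: "(\<lambda>\<zeta>. u (\<psi> \<zeta>)) holomorphic_on ball 0 r"
    using holomorphic_on_compose[OF \<psi>(1) u] by (simp add: o_def)
  have d\<psi>: "deriv \<psi> holomorphic_on ball 0 r" using \<psi>(1) by (simp add: holomorphic_deriv)
  have dn: "deriv \<psi> \<zeta> \<noteq> 0" if "\<zeta> \<in> ball 0 r" for \<zeta>
    using holomorphic_injective_imp_regular[OF \<psi>(1) open_ball \<psi>(2) that] .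
  {
    assume x: "cmod x < \<rho>"
    define k where "k = (\<lambda>\<zeta>. if \<zeta> = x then deriv \<psi> x else (\<psi> \<zeta> - \<psi> x) / (\<zeta> - x))"
    have k: "k holomorphic_on ball 0 r" unfolding k_def by (rule pole_lemma_open) (use \<psi> in auto)
    have kn: "k \<zeta> \<noteq> 0" if "\<zeta> \<in> ball 0 r" for \<zeta>
      using dn that x \<rho> inj_onD[OF \<psi>(2), of \<zeta> x] by (auto simp: k_def)
    define v where "v = (\<lambda>\<zeta>. u (\<psi> \<zeta>) * deriv \<psi> \<zeta> / k \<zeta>)"
    have v: "v holomorphic_on cball 0 \<rho>"
      by (rule holomorphic_on_subset[of _ "ball 0 r"])
        (use u\<psi> d\<psi> k kn \<rho> in \<open>auto simp: v_def intro!: holomorphic_intros\<close>)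
    have "((\<lambda>\<zeta>. v \<zeta> / (\<zeta> - x)) has_contour_integral 2 * of_real pi * \<i> * v x) (circlepath 0 \<rho>)"
      by (rule Cauchy_integral_circlepath_simple[OF v]) (use x in simp)
    moreover have "v x = u (\<psi> x)" using dn[of x] x \<rho> by (simp add: v_def k_def)
    ultimately have "((\<lambda>\<zeta>. v \<zeta> / (\<zeta> - x)) has_contour_integral
        2 * of_real pi * \<i> * u (\<psi> x)) (circlepath 0 \<rho>)" by simp
    then show "((\<lambda>\<zeta>. u (\<psi> \<zeta>) * deriv \<psi> \<zeta> / (\<psi> \<zeta> - \<psi> x)) has_contour_integral
           2 * of_real pi * \<i> * u (\<psi> x)) (circlepath 0 \<rho>)"
    proof (rule has_contour_integral_eq)
      fix \<zeta> assume "\<zeta> \<in> path_image (circlepath 0 \<rho>)"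
      then have "cmod \<zeta> = \<rho>" using \<rho> by auto
      then have "\<zeta> \<noteq> x" using x by auto
      then show "v \<zeta> / (\<zeta> - x) = u (\<psi> \<zeta>) * deriv \<psi> \<zeta> / (\<psi> \<zeta> - \<psi> x)"
        by (simp add: v_def k_def)
    qed
  }
  assume z: "z \<notin> \<psi> ` ball 0 r"
  show "((\<lambda>\<zeta>. u (\<psi> \<zeta>) * deriv \<psi> \<zeta> / (\<psi> \<zeta> - z)) has_contour_integral 0) (circlepath 0 \<rho>)"
  proof (rule Cauchy_theorem_convex_simple)
    show "(\<lambda>\<zeta>. u (\<psi> \<zeta>) * deriv \<psi> \<zeta> / (\<psi> \<zeta> - z)) holomorphic_on ball 0 r"
      by (intro holomorphic_intros u\<psi> d\<psi> \<psi>) (use z in auto)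
  qed (use \<rho> in auto)
qed

text \<open>
The Cauchy integrals over the images of a circle slightly larger than the unit circle represent
\<open>u\<close> on both discs: the integral around one disc vanishes on the other. Janiszewski's theorem
shows that the two discs together do not separate the plane.
\<close>

lemma runge_two_discs:
  assumes r: "r > 1"
    and \<psi>: "\<psi> holomorphic_on ball 0 r" "inj_on \<psi> (ball 0 r)"
    and \<theta>: "\<theta> holomorphic_on ball 0 r" "inj_on \<theta> (ball 0 r)"
    and disj: "\<psi> ` ball 0 r \<inter> \<theta> ` ball 0 r = {}"
    and u: "u holomorphic_on \<psi> ` ball 0 r \<union> \<theta> ` ball 0 r"
  shows "connected (- (\<psi> ` cball 0 1 \<union> \<theta> ` cball 0 1))" 
    and "entire_approximable (\<psi> ` cball 0 1 \<union> \<theta> ` cball 0 1) u"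
proof -
  let ?X = "\<psi> ` cball 0 1 \<union> \<theta> ` cball 0 1"
  have sub: "cball 0 1 \<subseteq> ball (0::complex) r" using r by auto
  have comp: "compact (\<psi> ` cball 0 1)" "compact (\<theta> ` cball 0 1)"
    using compact_univalent_disc r \<psi> \<theta> by blast+
  have "\<psi> ` cball 0 1 \<inter> \<theta> ` cball 0 1 = {}" using disj sub by blast
  then show con: "connected (- ?X)"
    using comp connected_complement_univalent_disc \<psi> \<theta> r
    by (intro Janiszewski_connected) (auto intro: compact_imp_closed)
  define \<rho> where "\<rho> = (1 + r) / 2"
  have \<rho>: "1 < \<rho>" "\<rho> < r" using r by (auto simp: \<rho>_def)
  define C where "C = (\<lambda>f z. integral {0..1} (\<lambda>t. u (f (circlepath 0 \<rho> t)) * deriv f (circlepath 0 \<rho> t)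
      * (2 * pi * \<i> * \<rho> * exp (2 * of_real pi * \<i> * t)) / (f (circlepath 0 \<rho> t) - z)))"
  have C_eq: "C f z = i" if "((\<lambda>\<zeta>. u (f \<zeta>) * deriv f \<zeta> / (f \<zeta> - z)) has_contour_integral i) (circlepath 0 \<rho>)" for f z i
    using that by (simp add: has_contour_integral C_def vector_derivative_circlepath integral_unique algebra_simps)
  have approx: "entire_approximable ?X (C f)"
    if f: "f holomorphic_on ball 0 r" "inj_on f (ball 0 r)" "u holomorphic_on f ` ball 0 r"
      and av: "f ` sphere 0 \<rho> \<inter> ?X = {}" for f
    unfolding C_def
  proof (rule entire_approximable_Cauchy_kernel)
    have cp: "continuous_on {0..1} (circlepath 0 \<rho>)" 
      using path_circlepath unfolding path_def by blast
    have im: "circlepath 0 \<rho> ` {0..1} \<subseteq> sphere 0 \<rho>"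
      using path_image_circlepath[of 0 \<rho>] \<rho> unfolding path_image_def by auto
    then have im': "circlepath 0 \<rho> ` {0..1} \<subseteq> ball 0 r" using \<rho> by force
    show "continuous_on {0..1} (\<lambda>t. f (circlepath 0 \<rho> t))"
      by (rule continuous_on_compose2[OF holomorphic_on_imp_continuous_on[OF f(1)] cp im'])
    show "(\<lambda>t. f (circlepath 0 \<rho> t)) ` {0..1} \<inter> ?X = {}" using im av by blast
    have "(\<lambda>\<zeta>. u (f \<zeta>) * deriv f \<zeta>) holomorphic_on ball 0 r"
      using holomorphic_on_compose[OF f(1,3)] f(1) by (auto simp: o_def holomorphic_deriv intro!: holomorphic_intros)
    then have h: "continuous_on {0..1} (\<lambda>t. u (f (circlepath 0 \<rho> t)) * deriv f (circlepath 0 \<rho> t))"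
      by (rule continuous_on_compose2[OF holomorphic_on_imp_continuous_on cp im'])
    show "continuous_on {0..1} (\<lambda>t. u (f (circlepath 0 \<rho> t)) * deriv f (circlepath 0 \<rho> t)
      * (2 * pi * \<i> * \<rho> * exp (2 * of_real pi * \<i> * t)))"
      by (rule continuous_on_mult[OF h]) (intro continuous_intros)
  qed (use comp con in auto)
  have sph: "f ` sphere 0 \<rho> \<inter> f ` cball 0 1 = {}" if "inj_on f (ball 0 r)" for f :: "complex \<Rightarrow> complex"
    using \<rho> sub inj_onD[OF that] by fastforce
  have sphb: "sphere 0 \<rho> \<subseteq> ball (0::complex) r" using \<rho> by auto
  have "entire_approximable ?X (\<lambda>z. (1 / (2 * of_real pi * \<i>)) * (C \<psi> z + C \<theta> z))"
  proof (intro entire_approximable_mult entire_approximable_add approx)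
    show "\<psi> ` sphere 0 \<rho> \<inter> ?X = {}" using sph[OF \<psi>(2)] disj sub sphb by blast
    show "\<theta> ` sphere 0 \<rho> \<inter> ?X = {}" using sph[OF \<theta>(2)] disj sub sphb by blast
  qed (use comp u \<psi> \<theta> in \<open>auto intro: holomorphic_on_subset entire_approximable_entire\<close>)
  moreover have "(1 / (2 * of_real pi * \<i>)) * (C \<psi> z + C \<theta> z) = u z" if z: "z \<in> ?X" for z
  proof -
    note c1 = Cauchy_integral_univalent_disc[OF \<psi>, of \<rho> u] and c2 = Cauchy_integral_univalent_disc[OF \<theta>, of \<rho> u]
    have u1: "u holomorphic_on \<psi> ` ball 0 r" and u2: "u holomorphic_on \<theta> ` ball 0 r"
      using u by (auto intro: holomorphic_on_subset)
    from z have "C \<psi> z + C \<theta> z = 2 * of_real pi * \<i> * u z"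
    proof
      assume "z \<in> \<psi> ` cball 0 1"
      then obtain x where x: "cmod x \<le> 1" "z = \<psi> x" by auto
      then have "z \<in> \<psi> ` ball 0 r" using r by auto
      then have "z \<notin> \<theta> ` ball 0 r" using disj by blast
      then show ?thesis using C_eq[OF c1(1)] C_eq[OF c2(2)] x \<rho> u1 u2 by simp
    next
      assume "z \<in> \<theta> ` cball 0 1"
      then obtain x where x: "cmod x \<le> 1" "z = \<theta> x" by auto
      then have "z \<in> \<theta> ` ball 0 r" using r by auto
      then have "z \<notin> \<psi> ` ball 0 r" using disj by blast
      then show ?thesis using C_eq[OF c2(1)] C_eq[OF c1(2)] x \<rho> u1 u2 by simp
    qed
    then show ?thesis by simp
  qed
  ultimately show "entire_approximable ?X u"
    by (rule entire_approximable_cong[THEN iffD1, rotated])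
qed

section \<open>Entire functions resembling the indicator of an interval on a segment\<close>

text \<open>
Up to the substitution \<open>t = \<alpha> + (\<beta> - \<alpha>) u\<close>, the integrand is \<open>\<pi>\<close> times the Poisson kernel of the
upper half-plane for the point \<open>x + i \<delta>\<close>, so the integral is \<open>\<pi>\<close> times the harmonic measure of
\<open>[\<alpha>, \<beta>]\<close> seen from that point; divided by \<open>\<pi>\<close>, it tends to the indicator function as \<open>\<delta>\<close> tends to 0.
\<close>

lemma harmonic_measure_interval:
  fixes \<alpha> \<beta> x \<delta> :: real
  assumes "\<delta> > 0"
  shows "((\<lambda>u. (\<beta> - \<alpha>) * \<delta> / ((\<alpha> + (\<beta> - \<alpha>) * u - x)\<^sup>2 + \<delta>\<^sup>2)) has_integral
           arctan ((\<beta> - x) / \<delta>) - arctan ((\<alpha> - x) / \<delta>)) {0..1}"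
proof -
  let ?g = "\<lambda>u. (\<alpha> + (\<beta> - \<alpha>) * u - x) / \<delta>"
  have "((\<lambda>u. (\<beta> - \<alpha>) * \<delta> / ((\<alpha> + (\<beta> - \<alpha>) * u - x)\<^sup>2 + \<delta>\<^sup>2)) has_integral
           arctan (?g 1) - arctan (?g 0)) {0..1}"
  proof (rule fundamental_theorem_of_calculus)
    fix u :: real
    have g: "(?g has_real_derivative (\<beta> - \<alpha>) / \<delta>) (at u)"
      using assms by (auto intro!: derivative_eq_intros)
    have sq: "1 + (?g u)\<^sup>2 = ((\<alpha> + (\<beta> - \<alpha>) * u - x)\<^sup>2 + \<delta>\<^sup>2) / \<delta>\<^sup>2"
      using assms by (simp add: power_divide field_simps)
    have "((\<lambda>u. arctan (?g u)) has_real_derivative inverse (1 + (?g u)\<^sup>2) * ((\<beta> - \<alpha>) / \<delta>)) (at u)"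
      by (rule DERIV_chain2[OF DERIV_arctan g])
    moreover have "inverse (1 + (?g u)\<^sup>2) * ((\<beta> - \<alpha>) / \<delta>) =
        (\<beta> - \<alpha>) * \<delta> / ((\<alpha> + (\<beta> - \<alpha>) * u - x)\<^sup>2 + \<delta>\<^sup>2)"
    proof -
      have "(\<alpha> + (\<beta> - \<alpha>) * u - x)\<^sup>2 + \<delta>\<^sup>2 > 0" using assms by (simp add: add_nonneg_pos)
      then show ?thesis unfolding sq using assms by (simp add: power2_eq_square)
    qed
    ultimately show "((\<lambda>u. arctan (?g u)) has_vector_derivative
        (\<beta> - \<alpha>) * \<delta> / ((\<alpha> + (\<beta> - \<alpha>) * u - x)\<^sup>2 + \<delta>\<^sup>2)) (at u within {0..1})"
      by (simp add: has_real_derivative_iff_has_vector_derivative has_vector_derivative_at_within)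
  qed auto
  then show ?thesis by simp
qed

lemma harmonic_measure_tendsto:
  assumes \<delta>: "\<And>k. \<delta> k > 0" "\<delta> \<longlonglongrightarrow> (0::real)" and "x \<noteq> \<alpha>" "x \<noteq> \<beta>" "\<alpha> < \<beta>"
  shows "(\<lambda>k. (arctan ((\<beta> - x) / \<delta> k) - arctan ((\<alpha> - x) / \<delta> k)) / pi) \<longlonglongrightarrow> (if x \<in> {\<alpha>..\<beta>} then 1 else 0)"
proof -
  have inv: "filterlim (\<lambda>k. inverse (\<delta> k)) at_top sequentially"
    by (rule filterlim_inverse_at_top[OF \<delta>(2)], rule always_eventually) (use \<delta>(1) in blast)
  have lim: "(\<lambda>k. arctan (c / \<delta> k)) \<longlonglongrightarrow> sgn c * (pi/2)" if "c \<noteq> 0" for c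
  proof (cases "c > 0")
    case True
    have "filterlim (\<lambda>k. c * inverse (\<delta> k)) at_top sequentially"
      by (rule filterlim_tendsto_pos_mult_at_top[OF tendsto_const True inv])
    from filterlim_compose[OF tendsto_arctan_at_top this] show ?thesis
      using True by (simp add: divide_inverse[of c])
  next
    case False
    then have "c < 0" using that by simp
    have "filterlim (\<lambda>k. c * inverse (\<delta> k)) at_bot sequentially"
      by (rule filterlim_tendsto_neg_mult_at_bot[OF tendsto_const \<open>c < 0\<close> inv])
    from filterlim_compose[OF tendsto_arctan_at_bot this] show ?thesis
      using \<open>c < 0\<close> by (simp add: divide_inverse[of c])
  qed
  have "(\<lambda>k. (arctan ((\<beta> - x) / \<delta> k) - arctan ((\<alpha> - x) / \<delta> k)) / pi) \<longlonglongrightarrow>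
      (sgn (\<beta> - x) * (pi/2) - sgn (\<alpha> - x) * (pi/2)) / pi"
    by (intro tendsto_divide tendsto_diff tendsto_const lim) (use assms(3,4) in auto)
  moreover have "(sgn (\<beta> - x) * (pi/2) - sgn (\<alpha> - x) * (pi/2)) / pi = (if x \<in> {\<alpha>..\<beta>} then 1 else 0)"
    using assms(3-5) by (auto simp: sgn_if)
  ultimately show ?thesis by simp
qed

text \<open>
Identify the line through \<open>p\<close> and \<open>q\<close> with the real axis. The Poisson integral of \<open>[\<alpha>, \<beta>]\<close> at
height \<open>\<delta>\<close> extends holomorphically in \<open>x\<close>, as the difference of two Cauchy integrals over the
intervals parallel to \<open>[\<alpha>, \<beta>]\<close> at distance \<open>\<delta>\<close> on either side. For small \<open>\<delta>\<close> these intervals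
avoid \<open>X\<close> and the segment, so Runge's theorem applies. On the segment the values lie between 0 and
1 and converge to the indicator function; away from \<open>[\<alpha>, \<beta>]\<close> the two Cauchy integrals cancel up
to \<open>O(\<delta>)\<close>.
\<close>

lemma segment_bump:
  fixes p q :: complex and X :: "complex set"
  assumes X: "compact X" "connected (- (X \<union> closed_segment p q))"
    and seg: "closed_segment p q \<inter> X \<subseteq> {p, q}" and "p \<noteq> q"
    and \<alpha>\<beta>: "0 < \<alpha>" "\<alpha> < \<beta>" "\<beta> < 1"
  obtains s :: "nat \<Rightarrow> complex \<Rightarrow> complex" where
    "\<And>k. entire_approximable (X \<union> closed_segment p q) (s k)"
    "uniform_limit X s (\<lambda>z. 0) sequentially"
    "\<And>k t. t \<in> {0..1} \<Longrightarrow> cmod (s k (p + of_real t * (q - p))) \<le> 1"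
    "\<And>t. t \<in> {0..1} \<Longrightarrow> t \<noteq> \<alpha> \<Longrightarrow> t \<noteq> \<beta> \<Longrightarrow>
        (\<lambda>k. s k (p + of_real t * (q - p))) \<longlonglongrightarrow> (if t \<in> {\<alpha>..\<beta>} then 1 else 0)"
proof -
  define d where "d = q - p"
  have d: "d \<noteq> 0" using \<open>p \<noteq> q\<close> by (simp add: d_def)
  define \<gamma> where "\<gamma> = (\<lambda>w. p + w * d)"
  have \<gamma>_seg: "\<gamma> (of_real t) \<in> closed_segment p q" if "t \<in> {0..1}" for t
    using that unfolding closed_segment_def
    by (auto simp: \<gamma>_def d_def scaleR_conv_of_real algebra_simps intro!: exI[of _ t])
  have seg_\<gamma>: "\<exists>t\<in>{0..1}. z = \<gamma> (of_real t)" if "z \<in> closed_segment p q" for z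
    using that unfolding closed_segment_def
    by (auto simp: \<gamma>_def d_def scaleR_conv_of_real algebra_simps)
  have "compact ((\<lambda>t. \<gamma> (of_real t)) ` {\<alpha>..\<beta>})"
    by (intro compact_continuous_image) (auto simp: \<gamma>_def intro!: continuous_intros)
  moreover have "(\<lambda>t. \<gamma> (of_real t)) ` {\<alpha>..\<beta>} \<inter> X = {}"
  proof -
    have "\<gamma> (of_real t) \<notin> X" if "t \<in> {\<alpha>..\<beta>}" for t
    proof
      assume "\<gamma> (of_real t) \<in> X"
      moreover have "\<gamma> (of_real t) \<in> closed_segment p q" using \<gamma>_seg that \<alpha>\<beta> by auto
      ultimately have "\<gamma> (of_real t) = p \<or> \<gamma> (of_real t) = q" using seg by blast
      then show False
      proof
        assume "\<gamma> (of_real t) = p" then show False using that \<alpha>\<beta> d by (simp add: \<gamma>_def)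
      next
        assume "\<gamma> (of_real t) = q"
        then have "of_real t * d = 1 * d" by (simp add: \<gamma>_def d_def algebra_simps)
        then have "t = 1" using d by (metis mult_right_cancel of_real_eq_1_iff)
        then show False using that \<alpha>\<beta> by simp
      qed
    qed
    then show ?thesis by blast
  qed
  ultimately obtain e where e: "e > 0" "\<And>t z. t \<in> {\<alpha>..\<beta>} \<Longrightarrow> z \<in> X \<Longrightarrow> e \<le> dist (\<gamma> (of_real t)) z"
    using separate_compact_closed[OF _ compact_imp_closed[OF X(1)]] by (metis imageI)
  define \<eta> where "\<eta> = e / cmod d"
  have \<eta>: "\<eta> > 0" using e d by (simp add: \<eta>_def)
  define w where "w = (\<lambda>z. (z - p) / d)"
  have w\<gamma>: "w (\<gamma> t) = t" for t using d by (simp add: w_def \<gamma>_def)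
  have far: "\<eta> \<le> cmod (of_real t - w z)" if "t \<in> {\<alpha>..\<beta>}" "z \<in> X" for t z
  proof -
    have "of_real t - w z = (\<gamma> (of_real t) - z) / d" using d by (simp add: w_def \<gamma>_def field_simps)
    then show ?thesis using e(2)[OF that] d by (simp add: norm_divide \<eta>_def divide_right_mono dist_norm)
  qed
  define \<delta> where "\<delta> = (\<lambda>k. \<eta> / 2 / (real k + 1))"
  have \<delta>: "\<delta> k > 0" "\<delta> k \<le> \<eta>/2" for k
  proof -
    show "\<delta> k > 0" using \<eta> by (simp add: \<delta>_def)
    have "\<eta>/2 / (real k + 1) \<le> \<eta>/2 / 1" by (rule divide_left_mono) (use \<eta> in auto)
    then show "\<delta> k \<le> \<eta>/2" by (simp add: \<delta>_def)
  qed
  have \<delta>0: "\<delta> \<longlonglongrightarrow> 0"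
    unfolding \<delta>_def by real_asymp
  define \<tau> where "\<tau> = (\<lambda>u. \<alpha> + (\<beta> - \<alpha>) * u)"
  have \<tau>: "\<tau> u \<in> {\<alpha>..\<beta>}" if "u \<in> {0..1}" for u
  proof -
    have "0 \<le> (\<beta> - \<alpha>) * u" "(\<beta> - \<alpha>) * u \<le> (\<beta> - \<alpha>) * 1"
      using that \<alpha>\<beta> by (auto intro!: mult_left_mono)
    then show ?thesis by (simp add: \<tau>_def)
  qed
  define c where "c = (\<lambda>k \<sigma> u. \<gamma> (of_real (\<tau> u) + of_real (\<sigma> * \<delta> k) * \<i>))"
  have c_avoid: "c k \<sigma> u \<notin> X \<union> closed_segment p q" if "u \<in> {0..1}" "\<bar>\<sigma>\<bar> = 1" for k \<sigma> u
  proof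
    assume "c k \<sigma> u \<in> X \<union> closed_segment p q"
    then show False
    proof
      assume "c k \<sigma> u \<in> X"
      then have "\<eta> \<le> cmod (of_real (\<tau> u) - w (c k \<sigma> u))" using far \<tau> that by blast
      also have "\<dots> = \<delta> k" using that \<delta>[of k] by (simp add: c_def w\<gamma> norm_mult abs_mult)
      finally show False using \<delta>[of k] \<eta> by simp
    next
      assume "c k \<sigma> u \<in> closed_segment p q"
      then obtain t where "c k \<sigma> u = \<gamma> (of_real t)" using seg_\<gamma> by blast
      then have "of_real (\<tau> u) + of_real (\<sigma> * \<delta> k) * \<i> = of_real t" using w\<gamma> unfolding c_def by metis
      from arg_cong[OF this, of Im] show False using \<delta>(1)[of k] that(2) by auto
    qed
  qed
  define \<kappa> where "\<kappa> = (\<lambda>k z u. complex_of_real ((\<beta> - \<alpha>) * \<delta> k) / ((of_real (\<tau> u) - w z)\<^sup>2 + (of_real (\<delta> k))\<^sup>2))"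
  define s where "s = (\<lambda>k z. 1 / of_real pi * integral {0..1} (\<kappa> k z))"
  define W where "W = of_real (\<beta> - \<alpha>) * d / (2 * \<i>)"
  \<comment> \<open>Partial fractions in \<open>\<tau> u\<close>: the poles are \<open>w z + i \<delta>\<close> and \<open>w z - i \<delta>\<close>.\<close>
  have kernel: "\<kappa> k z u = W / (c k (-1) u - z) - W / (c k 1 u - z)"
    if "u \<in> {0..1}" "z \<in> X \<union> closed_segment p q" for k z u
  proof -
    let ?s = "of_real (\<tau> u) - w z" and ?d = "complex_of_real (\<delta> k)"
    have c1: "c k 1 u - z = d * (?s + ?d * \<i>)" and c2: "c k (-1) u - z = d * (?s - ?d * \<i>)"
      using d by (simp_all add: c_def \<gamma>_def w_def field_simps)
    have nz: "c k 1 u - z \<noteq> 0" "c k (-1) u - z \<noteq> 0" 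
      using c_avoid[of u 1 k] c_avoid[of u "-1" k] that by auto
    have prod: "(?s + ?d * \<i>) * (?s - ?d * \<i>) = ?s\<^sup>2 + ?d\<^sup>2"
      by (simp add: algebra_simps power2_eq_square)
    have nz': "?s + ?d * \<i> \<noteq> 0" "?s - ?d * \<i> \<noteq> 0" using nz unfolding c1 c2 by auto
    have W': "W = (of_real (\<beta> - \<alpha>) / (2 * \<i>)) * d" by (simp add: W_def)
    have cancel: "W / (d * y) = (of_real (\<beta> - \<alpha>) / (2 * \<i>)) * (1 / y)" for y
      unfolding W' using d by simp
    have "W / (c k (-1) u - z) - W / (c k 1 u - z) = of_real (\<beta> - \<alpha>) / (2 * \<i>) * (1 / (?s - ?d * \<i>) - 1 / (?s + ?d * \<i>))"
      unfolding c1 c2 cancel by (rule right_diff_distrib[symmetric])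
    also have "1 / (?s - ?d * \<i>) - 1 / (?s + ?d * \<i>) = ((?s + ?d * \<i>) - (?s - ?d * \<i>)) / ((?s + ?d * \<i>) * (?s - ?d * \<i>))"
      using nz' by (simp add: diff_frac_eq mult.commute)
    also have "(?s + ?d * \<i>) - (?s - ?d * \<i>) = 2 * ?d * \<i>" by simp
    finally have "W / (c k (-1) u - z) - W / (c k 1 u - z) =
        of_real (\<beta> - \<alpha>) / (2 * \<i>) * (2 * ?d * \<i> / (?s\<^sup>2 + ?d\<^sup>2))" unfolding prod .
    also have "\<dots> = of_real (\<beta> - \<alpha>) * ?d / (?s\<^sup>2 + ?d\<^sup>2)"
    proof -
      have "x / I * (y * I / D) = x * y / D" if "I \<noteq> 0" for x y D I :: complex using that by simp
      from this[of "2 * \<i>" "of_real (\<beta> - \<alpha>)" ?d] show ?thesis by (simp only: mult_ac) simp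
    qed
    finally show ?thesis unfolding \<kappa>_def by simp
  qed
  have c_cont: "continuous_on {0..1} (c k \<sigma>)" for k \<sigma>
  proof -
    have "continuous_on {0..1} (\<lambda>u::real. complex_of_real (\<alpha> + (\<beta> - \<alpha>) * u))"
      by (intro continuous_on_of_real continuous_on_add continuous_on_mult continuous_on_const continuous_on_id)
    then have "continuous_on {0..1} (\<lambda>u. p + (complex_of_real (\<alpha> + (\<beta> - \<alpha>) * u) + of_real (\<sigma> * \<delta> k) * \<i>) * d)"
      by (intro continuous_on_add continuous_on_mult continuous_on_const)
    moreover have "c k \<sigma> = (\<lambda>u. p + (complex_of_real (\<alpha> + (\<beta> - \<alpha>) * u) + of_real (\<sigma> * \<delta> k) * \<i>) * d)"
      unfolding c_def \<gamma>_def \<tau>_def by (rule refl)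
    ultimately show ?thesis by simp
  qed
  have ker_int: "(\<lambda>u. W / (c k \<sigma> u - z)) integrable_on {0..1}"
    if "\<bar>\<sigma>\<bar> = 1" "z \<in> X \<union> closed_segment p q" for k \<sigma> z
  proof -
    have "c k \<sigma> u - z \<noteq> 0" if "u \<in> {0..1}" for u
      using c_avoid[OF that \<open>\<bar>\<sigma>\<bar> = 1\<close>, of k] \<open>z \<in> _\<close> by auto
    then have "continuous_on {0..1} (\<lambda>u. W / (c k \<sigma> u - z))"
      by (intro continuous_on_divide continuous_on_diff continuous_on_const c_cont) blast
    then show ?thesis by (rule integrable_continuous_real)
  qed
  have \<kappa>_int: "integral {0..1} (\<kappa> k z) =
      integral {0..1} (\<lambda>u. W / (c k (-1) u - z)) - integral {0..1} (\<lambda>u. W / (c k 1 u - z))"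
    "\<kappa> k z integrable_on {0..1}" if z: "z \<in> X \<union> closed_segment p q" for k z
  proof -
    have "integral {0..1} (\<kappa> k z) = integral {0..1} (\<lambda>u. W / (c k (-1) u - z) - W / (c k 1 u - z))"
      by (rule integral_cong) (use kernel z in blast)
    also have "\<dots> = integral {0..1} (\<lambda>u. W / (c k (-1) u - z)) - integral {0..1} (\<lambda>u. W / (c k 1 u - z))"
      by (rule Henstock_Kurzweil_Integration.integral_diff) (use ker_int z in auto)
    finally show "integral {0..1} (\<kappa> k z) =
      integral {0..1} (\<lambda>u. W / (c k (-1) u - z)) - integral {0..1} (\<lambda>u. W / (c k 1 u - z))" .
    have "(\<lambda>u. W / (c k (-1) u - z) - W / (c k 1 u - z)) integrable_on {0..1}"
      by (rule integrable_diff) (use ker_int z in auto)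
    then show "\<kappa> k z integrable_on {0..1}"
      by (rule integrable_eq) (use kernel z in simp)
  qed
  show ?thesis
  proof
    fix k
    have cX: "compact (X \<union> closed_segment p q)" using X by (intro compact_Un) auto
    have ap: "entire_approximable (X \<union> closed_segment p q) (\<lambda>z. integral {0..1} (\<lambda>u. W / (c k \<sigma> u - z)))"
      if "\<bar>\<sigma>\<bar> = 1" for \<sigma>
      by (rule entire_approximable_Cauchy_kernel[OF cX X(2) c_cont _ continuous_on_const])
        (use c_avoid that in blast)
    have "entire_approximable (X \<union> closed_segment p q) (\<lambda>z. 1 / of_real pi * (integral {0..1} (\<lambda>u. W / (c k (-1) u - z))
        + (-1) * integral {0..1} (\<lambda>u. W / (c k 1 u - z))))"
      by (intro entire_approximable_mult entire_approximable_add ap cX)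
        (auto intro: entire_approximable_entire)
    then show "entire_approximable (X \<union> closed_segment p q) (s k)"
      by (rule entire_approximable_cong[THEN iffD1, rotated]) (simp add: s_def \<kappa>_int)
  next
    have bound: "cmod (s k z) \<le> 4 * \<delta> k / \<eta>\<^sup>2" if z: "z \<in> X" for k z
    proof -
      have "cmod (integral {0..1} (\<kappa> k z)) \<le> integral {0..1} (\<lambda>u::real. 4 * \<delta> k / \<eta>\<^sup>2)"
      proof (rule integral_norm_bound_integral)
        show "\<kappa> k z integrable_on {0..1}" using \<kappa>_int(2) z by blast
        show "cmod (\<kappa> k z u) \<le> 4 * \<delta> k / \<eta>\<^sup>2" if "u \<in> {0..1}" for u
        proof -
          let ?s = "of_real (\<tau> u) - w z" and ?d = "complex_of_real (\<delta> k)"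
          have s: "\<eta> \<le> cmod ?s" using far \<tau> that z by blast
          have "\<eta>/2 \<le> cmod (?s + ?d * \<i>)" "\<eta>/2 \<le> cmod (?s - ?d * \<i>)"
            using norm_diff_ineq[of ?s "?d * \<i>"] norm_triangle_ineq2[of ?s "?d * \<i>"] s \<delta>[of k]
            by (auto simp: norm_mult)
          then have "\<eta>/2 * (\<eta>/2) \<le> cmod (?s + ?d * \<i>) * cmod (?s - ?d * \<i>)"
            using \<eta> by (intro mult_mono) auto
          also have "\<dots> = cmod (?s\<^sup>2 + ?d\<^sup>2)"
            unfolding norm_mult[symmetric] by (simp add: algebra_simps power2_eq_square)
          finally have den: "\<eta>\<^sup>2/4 \<le> cmod (?s\<^sup>2 + ?d\<^sup>2)" by (simp add: power2_eq_square)
          have "cmod (\<kappa> k z u) = (\<beta> - \<alpha>) * \<delta> k / cmod (?s\<^sup>2 + ?d\<^sup>2)"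
            using \<alpha>\<beta> \<delta>(1)[of k] by (simp add: \<kappa>_def norm_divide norm_mult del: of_real_mult of_real_diff)
          also have "\<dots> \<le> 1 * \<delta> k / (\<eta>\<^sup>2/4)"
            by (intro frac_le mult_right_mono) (use den \<eta> \<alpha>\<beta> \<delta>(1)[of k] in auto)
          finally show ?thesis by (simp add: field_simps)
        qed
      qed auto
      then have "cmod (integral {0..1} (\<kappa> k z)) \<le> 4 * \<delta> k / \<eta>\<^sup>2" by simp
      moreover have "cmod (s k z) \<le> 1 * cmod (integral {0..1} (\<kappa> k z))"
        unfolding s_def norm_mult using pi_gt3 by (intro mult_right_mono) (auto simp: norm_divide)
      ultimately show ?thesis by simp
    qed
    have "(\<lambda>k. 4 * \<delta> k / \<eta>\<^sup>2) \<longlonglongrightarrow> 4 * 0 / \<eta>\<^sup>2" by (intro tendsto_intros \<delta>0) (use \<eta> in auto)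
    then have lim: "(\<lambda>k. 4 * \<delta> k / \<eta>\<^sup>2) \<longlonglongrightarrow> 0" by simp
    show "uniform_limit X s (\<lambda>z. 0) sequentially"
      unfolding uniform_limit_iff
    proof (intro allI impI)
      fix \<epsilon> :: real assume "\<epsilon> > 0"
      then have "eventually (\<lambda>k. 4 * \<delta> k / \<eta>\<^sup>2 < \<epsilon>) sequentially" using order_tendstoD(2)[OF lim] by blast
      then show "\<forall>\<^sub>F k in sequentially. \<forall>z\<in>X. dist (s k z) 0 < \<epsilon>"
      proof eventually_elim
        case (elim k)
        then show ?case using bound[of _ k] by (force simp: dist_norm)
      qed
    qed
  next
    have line: "s k (p + of_real t * (q - p)) = of_real ((arctan ((\<beta> - t) / \<delta> k) - arctan ((\<alpha> - t) / \<delta> k)) / pi)" for k t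
    proof -
      have "((\<lambda>u. complex_of_real ((\<beta> - \<alpha>) * \<delta> k / ((\<alpha> + (\<beta> - \<alpha>) * u - t)\<^sup>2 + (\<delta> k)\<^sup>2))) has_integral
           of_real (arctan ((\<beta> - t) / \<delta> k) - arctan ((\<alpha> - t) / \<delta> k))) {0..1}"
        using has_integral_linear[OF harmonic_measure_interval[OF \<delta>(1)[of k], of \<beta> \<alpha> t] bounded_linear_of_real[where 'a = complex]]
        by (simp add: o_def)
      moreover have "\<kappa> k (\<gamma> (of_real t)) = (\<lambda>u. complex_of_real ((\<beta> - \<alpha>) * \<delta> k / ((\<alpha> + (\<beta> - \<alpha>) * u - t)\<^sup>2 + (\<delta> k)\<^sup>2)))"
        by (simp add: \<kappa>_def w\<gamma> \<tau>_def)
      ultimately have "integral {0..1} (\<kappa> k (\<gamma> (of_real t))) = of_real (arctan ((\<beta> - t) / \<delta> k) - arctan ((\<alpha> - t) / \<delta> k))"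
        by (simp add: integral_unique)
      then show ?thesis by (simp add: s_def \<gamma>_def d_def)
    qed
    fix k :: nat and t :: real
    show "cmod (s k (p + of_real t * (q - p))) \<le> 1"
    proof -
      have "\<bar>arctan ((\<beta> - t) / \<delta> k) - arctan ((\<alpha> - t) / \<delta> k)\<bar> \<le> pi"
        using arctan_bounded[of "(\<beta> - t) / \<delta> k"] arctan_bounded[of "(\<alpha> - t) / \<delta> k"] by (simp add: abs_le_iff)
      then show ?thesis unfolding line norm_of_real by simp
    qed
    assume "t \<noteq> \<alpha>" "t \<noteq> \<beta>"
    then have "(\<lambda>k. complex_of_real ((arctan ((\<beta> - t) / \<delta> k) - arctan ((\<alpha> - t) / \<delta> k)) / pi)) \<longlonglongrightarrow>
        of_real (if t \<in> {\<alpha>..\<beta>} then 1 else 0)"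
      by (intro tendsto_of_real harmonic_measure_tendsto \<delta> \<delta>0) (use \<alpha>\<beta> in auto)
    then show "(\<lambda>k. s k (p + of_real t * (q - p))) \<longlonglongrightarrow> (if t \<in> {\<alpha>..\<beta>} then 1 else 0)"
      unfolding line if_distrib[of complex_of_real] of_real_1 of_real_0 .
  qed
qed

section \<open>Approximation with a prescribed integral along a segment\<close>

lemma interval_with_nonzero_integral:
  fixes m :: "real \<Rightarrow> complex"
  assumes m: "continuous_on {0..1} m" "m (1/2) \<noteq> 0"
  obtains \<alpha> \<beta> where "0 < \<alpha>" "\<alpha> < \<beta>" "\<beta> < 1" "integral {\<alpha>..\<beta>} m \<noteq> 0"
proof -
  define \<mu> where "\<mu> = cmod (m (1/2))"
  have \<mu>: "\<mu> > 0" using m by (simp add: \<mu>_def)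
  obtain e where e: "e > 0" "\<And>t. t \<in> {0..1} \<Longrightarrow> dist t (1/2) < e \<Longrightarrow> dist (m t) (m (1/2)) < \<mu>/2"
    using m(1)[unfolded continuous_on_iff, rule_format, of "1/2" "\<mu>/2"] \<mu> by auto
  define h where "h = min (e/2) (1/4)"
  have h: "0 < h" "h < e" "h \<le> 1/4" using e by (auto simp: h_def)
  define \<alpha> where "\<alpha> = 1/2 - h" 
  define \<beta> where "\<beta> = 1/2 + h" 
  have ab: "0 < \<alpha>" "\<alpha> < \<beta>" "\<beta> < 1" using h by (auto simp: \<alpha>_def \<beta>_def)
  have c: "continuous_on {\<alpha>..\<beta>} m" by (rule continuous_on_subset[OF m(1)]) (use ab in auto)
  have "cmod (integral {\<alpha>..\<beta>} (\<lambda>t. m t - m (1/2))) \<le> \<mu>/2 * (\<beta> - \<alpha>)"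
  proof (rule integral_bound)
    show "continuous_on {\<alpha>..\<beta>} (\<lambda>t. m t - m (1/2))" by (intro continuous_intros c)
    show "cmod (m t - m (1/2)) \<le> \<mu>/2" if "t \<in> {\<alpha>..\<beta>}" for t
    proof -
      have "dist t (1/2) < e" using that h by (auto simp: \<alpha>_def \<beta>_def dist_real_def abs_if)
      moreover have "t \<in> {0..1}" using that ab by auto
      ultimately show ?thesis using e(2) by (auto simp: dist_norm intro: less_imp_le)
    qed
  qed (use ab in auto)
  moreover have "integral {\<alpha>..\<beta>} (\<lambda>t. m t - m (1/2)) = integral {\<alpha>..\<beta>} m - (\<beta> - \<alpha>) *\<^sub>R m (1/2)"
    using ab by (subst Henstock_Kurzweil_Integration.integral_diff) (auto intro!: integrable_continuous_real c)
  moreover have "cmod ((\<beta> - \<alpha>) *\<^sub>R m (1/2)) = (\<beta> - \<alpha>) * \<mu>" using ab by (simp add: \<mu>_def)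
  moreover have "\<mu>/2 * (\<beta> - \<alpha>) < (\<beta> - \<alpha>) * \<mu>" using ab \<mu> by simp
  ultimately have "integral {\<alpha>..\<beta>} m \<noteq> 0" by (auto simp: norm_minus_commute)
  then show ?thesis using that ab by blast
qed

text \<open>
A Mergelyan-type statement for \<open>X\<close> with a segment attached, reduced to the one number that
matters. Start from an entire \<open>S0\<close> close to \<open>S\<close> on \<open>X\<close>, let \<open>m\<close> be the integrand it produces along
the segment, and pick an interval \<open>[\<alpha>, \<beta>]\<close> with \<open>A = integral of m over [\<alpha>, \<beta>] \<noteq> 0\<close>. Adding
\<open>\<sigma>/R\<close> times the indicator of that interval to \<open>S0\<close> multiplies \<open>m\<close> there by \<open>exp \<sigma>\<close>, and so
changes the integral from \<open>B + A\<close> to \<open>B + exp \<sigma> * A\<close>, which takes every value except \<open>B\<close>. The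
indicator is replaced by the functions of \<open>segment_bump\<close> and \<open>1/R\<close> by an entire function; dominated
convergence controls the integral.
\<close>

lemma runge_with_segment_integral:
  fixes p q c :: complex and X :: "complex set"
  assumes X: "compact X" "connected (- (X \<union> closed_segment p q))"
    and seg: "closed_segment p q \<inter> X \<subseteq> {p, q}" and "p \<noteq> q"
    and S: "entire_approximable X S"
    and T: "T holomorphic_on UNIV" and R: "R holomorphic_on UNIV"
    and Rnz: "\<And>z. z \<in> closed_segment p q \<Longrightarrow> R z \<noteq> 0"
    and Rinv: "entire_approximable (closed_segment p q) (\<lambda>z. 1 / R z)"
    and "\<epsilon> > 0"
  obtains S' where "S' holomorphic_on UNIV" "\<And>z. z \<in> X \<Longrightarrow> cmod (S' z - S z) < \<epsilon>"
    "cmod (contour_integral (linepath p q) (\<lambda>z. exp (T z + R z * S' z) / R z) - c) < \<epsilon>"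
proof -
  let ?\<gamma> = "linepath p q"
  have \<gamma>_eq: "?\<gamma> t = p + of_real t * (q - p)" for t
    by (simp add: linepath_def scaleR_conv_of_real algebra_simps)
  have \<gamma>_seg: "?\<gamma> t \<in> closed_segment p q" if "t \<in> {0..1}" for t
    using that linepath_in_path by blast
  have cont: "continuous_on {0..1} (\<lambda>t. f (?\<gamma> t))" if "f holomorphic_on UNIV" for f
    using holomorphic_on_imp_continuous_on[OF that]
    by (rule continuous_on_compose2[OF _ continuous_on_linepath]) simp
  have ci: "contour_integral ?\<gamma> f = integral {0..1} (\<lambda>t. f (?\<gamma> t) * (q - p))" for f
    by (simp add: contour_integral_integral)
  obtain S0 where S0: "S0 holomorphic_on UNIV" "\<And>z. z \<in> X \<Longrightarrow> cmod (S0 z - S z) < \<epsilon>/2"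
    using entire_approximableD[OF S, of "\<epsilon>/2"] \<open>\<epsilon> > 0\<close> by auto
  define m where "m = (\<lambda>t. exp (T (?\<gamma> t) + R (?\<gamma> t) * S0 (?\<gamma> t)) / R (?\<gamma> t) * (q - p))"
  have m: "continuous_on {0..1} m"
    unfolding m_def by (intro continuous_intros cont[OF T] cont[OF R] cont[OF S0(1)]) (use Rnz \<gamma>_seg in auto)
  have "m (1/2) \<noteq> 0" using Rnz \<gamma>_seg[of "1/2"] \<open>p \<noteq> q\<close> by (simp add: m_def)
  then obtain \<alpha> \<beta> where ab: "0 < \<alpha>" "\<alpha> < \<beta>" "\<beta> < 1" and A: "integral {\<alpha>..\<beta>} m \<noteq> 0"
    using interval_with_nonzero_integral[OF m] by blast
  define A where "A = integral {\<alpha>..\<beta>} m"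
  define B where "B = integral {0..1} m - A"
  have m_int: "m integrable_on {0..1}" using m by (rule integrable_continuous_real)
  have sub: "{\<alpha>..\<beta>} \<subseteq> {0..1}" using ab by auto
  \<comment> \<open>The value \<open>B\<close> is not attained by \<open>B + exp \<sigma> * A\<close>; a nearby one is.\<close>
  define c' where "c' = (if c = B then c + of_real (\<epsilon>/4) else c)"
  have c': "cmod (c' - c) \<le> \<epsilon>/4" "c' \<noteq> B" using \<open>\<epsilon> > 0\<close> by (auto simp: c'_def)
  define \<sigma> where "\<sigma> = Ln ((c' - B) / A)"
  have \<sigma>: "exp \<sigma> * A = c' - B" using c' A by (simp add: \<sigma>_def A_def)
  obtain M where M: "M > 0" "\<And>t. t \<in> {0..1} \<Longrightarrow> cmod (m t) \<le> M"
    using compact_imp_bounded[OF compact_continuous_image[OF m compact_Icc]] unfolding bounded_pos by auto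
  \<comment> \<open>\<open>V\<close> below approximates \<open>\<sigma>/R\<close> on the segment so well that \<open>exp (R V)\<close> is close to \<open>exp \<sigma>\<close> there.\<close>
  obtain \<tau> where \<tau>: "\<tau> > 0" "\<And>y. cmod (y - \<sigma>) < \<tau> \<Longrightarrow> cmod (exp y - exp \<sigma>) < \<epsilon> / (4 * M)"
  proof -
    have "isCont exp \<sigma>" by (intro continuous_intros)
    then have "\<exists>d>0. \<forall>y. dist y \<sigma> < d \<longrightarrow> dist (exp y) (exp \<sigma>) < \<epsilon> / (4 * M)"
      unfolding continuous_at_eps_delta using M \<open>\<epsilon> > 0\<close> by simp
    then show ?thesis using that by (auto simp: dist_norm)
  qed
  have cseg: "compact (closed_segment p q)" by simp
  obtain CR where CR: "CR > 0" "\<And>z. z \<in> closed_segment p q \<Longrightarrow> cmod (R z) \<le> CR"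
    using entire_approximable_bounded[OF entire_approximable_entire[OF R] cseg] by blast
  have "entire_approximable (closed_segment p q) (\<lambda>z. \<sigma> * (1 / R z))"
    by (intro entire_approximable_mult Rinv) (auto intro: entire_approximable_entire)
  then obtain V where V: "V holomorphic_on UNIV"
      "\<And>z. z \<in> closed_segment p q \<Longrightarrow> cmod (V z - \<sigma> * (1 / R z)) < \<tau> / CR"
    using entire_approximableD[of _ _ "\<tau> / CR"] \<tau> CR by (metis divide_pos_pos)
  have RV: "cmod (R z * V z - \<sigma>) < \<tau>" if z: "z \<in> closed_segment p q" for z
  proof -
    have "R z * V z - \<sigma> = R z * (V z - \<sigma> * (1 / R z))" using Rnz[OF z] by (simp add: field_simps)
    also have "cmod \<dots> \<le> CR * cmod (V z - \<sigma> * (1 / R z))"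
      unfolding norm_mult using CR(2)[OF z] by (intro mult_right_mono) auto
    also have "\<dots> < CR * (\<tau> / CR)" using V(2)[OF z] CR by (intro mult_strict_left_mono)
    finally show ?thesis using CR by simp
  qed
  obtain s where s: "\<And>k. entire_approximable (X \<union> closed_segment p q) (s k)"
    "uniform_limit X s (\<lambda>z. 0) sequentially"
    "\<And>k t. t \<in> {0..1} \<Longrightarrow> cmod (s k (?\<gamma> t)) \<le> 1"
    "\<And>t. t \<in> {0..1} \<Longrightarrow> t \<noteq> \<alpha> \<Longrightarrow> t \<noteq> \<beta> \<Longrightarrow>
        (\<lambda>k. s k (?\<gamma> t)) \<longlonglongrightarrow> (if t \<in> {\<alpha>..\<beta>} then 1 else 0)"
    using segment_bump[OF X seg \<open>p \<noteq> q\<close> ab] unfolding \<gamma>_eq by metis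
  have cX: "compact (X \<union> closed_segment p q)" using X cseg by blast
  have "\<exists>w. w holomorphic_on UNIV \<and> (\<forall>z \<in> X \<union> closed_segment p q. cmod (w z - V z * s k z) < 1 / (real k + 1))" for k
    using entire_approximableD[OF entire_approximable_mult[OF entire_approximable_entire[OF V(1)] s(1) cX], of "1 / (real k + 1)" k]
    by (metis of_nat_0_le_iff zero_less_divide_1_iff add_nonneg_pos zero_less_one)
  then obtain w where w: "\<And>k. w k holomorphic_on UNIV"
      "\<And>k z. z \<in> X \<union> closed_segment p q \<Longrightarrow> cmod (w k z - V z * s k z) < 1 / (real k + 1)" by metis
  have lim0: "(\<lambda>k. 1 / (real k + 1)) \<longlonglongrightarrow> 0" by real_asymp
  obtain CV where CV: "CV > 0" "\<And>z. z \<in> X \<union> closed_segment p q \<Longrightarrow> cmod (V z) \<le> CV"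
    using entire_approximable_bounded[OF entire_approximable_entire[OF V(1)] cX] by blast
  define f where "f = (\<lambda>k t. exp (R (?\<gamma> t) * w k (?\<gamma> t)) * m t)"
  define g where "g = (\<lambda>t. if t \<in> {\<alpha>..\<beta>} then (exp (R (?\<gamma> t) * V (?\<gamma> t)) - 1) * m t else 0)"
  have f_cont: "continuous_on {0..1} (f k)" for k
    unfolding f_def by (intro continuous_intros cont[OF R] cont[OF w(1)] m)
  have f_lim: "(\<lambda>k. f k t) \<longlonglongrightarrow> m t + g t" if t: "t \<in> {0..1} - {\<alpha>, \<beta>}" for t
  proof -
    let ?\<iota> = "if t \<in> {\<alpha>..\<beta>} then 1 else (0::complex)"
    have "(\<lambda>k. w k (?\<gamma> t) - V (?\<gamma> t) * s k (?\<gamma> t)) \<longlonglongrightarrow> 0"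
      by (rule tendsto_0_le[OF lim0, of _ 1]) (use w(2) \<gamma>_seg t in \<open>auto intro!: always_eventually less_imp_le\<close>)
    moreover have "(\<lambda>k. V (?\<gamma> t) * s k (?\<gamma> t)) \<longlonglongrightarrow> V (?\<gamma> t) * ?\<iota>"
      by (intro tendsto_intros s) (use t in auto)
    ultimately have "(\<lambda>k. w k (?\<gamma> t) - V (?\<gamma> t) * s k (?\<gamma> t) + V (?\<gamma> t) * s k (?\<gamma> t)) \<longlonglongrightarrow> 0 + V (?\<gamma> t) * ?\<iota>"
      by (rule tendsto_add)
    then have "(\<lambda>k. w k (?\<gamma> t)) \<longlonglongrightarrow> V (?\<gamma> t) * ?\<iota>" by simp
    then have "(\<lambda>k. f k t) \<longlonglongrightarrow> exp (R (?\<gamma> t) * (V (?\<gamma> t) * ?\<iota>)) * m t"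
      unfolding f_def by (intro tendsto_intros)
    moreover have "exp (R (?\<gamma> t) * (V (?\<gamma> t) * ?\<iota>)) * m t = m t + g t"
      by (simp add: g_def algebra_simps)
    ultimately show ?thesis by simp
  qed
  have f_bound: "cmod (f k t) \<le> exp (CR * (CV + 1)) * M" if t: "t \<in> {0..1}" for k t
  proof -
    have z: "?\<gamma> t \<in> X \<union> closed_segment p q" using \<gamma>_seg[OF t] by blast
    have "1 / (real k + 1) \<le> 1" by simp
    then have "cmod (w k (?\<gamma> t) - V (?\<gamma> t) * s k (?\<gamma> t)) \<le> 1" using w(2)[OF z, of k] by linarith
    moreover have "cmod (V (?\<gamma> t) * s k (?\<gamma> t)) \<le> CV * 1"
      unfolding norm_mult using CV(2)[OF z] s(3)[OF t] CV(1) by (intro mult_mono) auto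
    ultimately have "cmod (w k (?\<gamma> t)) \<le> CV + 1"
      using norm_triangle_sub[of "w k (?\<gamma> t)" "V (?\<gamma> t) * s k (?\<gamma> t)"] by linarith
    then have "cmod (R (?\<gamma> t) * w k (?\<gamma> t)) \<le> CR * (CV + 1)"
      unfolding norm_mult using CR \<gamma>_seg[OF t] by (intro mult_mono) auto
    then have "cmod (exp (R (?\<gamma> t) * w k (?\<gamma> t))) \<le> exp (CR * (CV + 1))"
      by (meson exp_le_cancel_iff norm_exp order_trans)
    then show ?thesis unfolding f_def norm_mult using M(2)[OF t] by (intro mult_mono) auto
  qed
  have spike: "integral ({0..1} - {\<alpha>, \<beta>}) h = integral {0..1} h" for h :: "real \<Rightarrow> complex"
    by (rule integral_subset_negligible) (auto intro: negligible_subset[of "{\<alpha>, \<beta>}"])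
  have spike_int: "h integrable_on ({0..1} - {\<alpha>, \<beta>})" if "h integrable_on {0..1}" for h :: "real \<Rightarrow> 'b::banach"
    by (rule integrable_spike_set[OF that]) (auto intro: negligible_subset[of "{\<alpha>, \<beta>}"])
  have "(\<lambda>k. integral ({0..1} - {\<alpha>, \<beta>}) (f k)) \<longlonglongrightarrow> integral ({0..1} - {\<alpha>, \<beta>}) (\<lambda>t. m t + g t)"
  proof (rule dominated_convergence(2))
    show "f k integrable_on {0..1} - {\<alpha>, \<beta>}" for k by (intro spike_int integrable_continuous_real f_cont)
    show "(\<lambda>t. exp (CR * (CV + 1)) * M) integrable_on {0..1} - {\<alpha>, \<beta>}"
      by (intro spike_int integrable_continuous_real continuous_intros)
  qed (use f_bound f_lim in auto)
  then have conv: "(\<lambda>k. integral {0..1} (f k)) \<longlonglongrightarrow> integral {0..1} (\<lambda>t. m t + g t)"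
    unfolding spike .
  have EV: "(\<lambda>t. exp (R (?\<gamma> t) * V (?\<gamma> t)) * m t) integrable_on {\<alpha>..\<beta>}"
    by (rule integrable_continuous_real, rule continuous_on_subset[OF _ sub])
      (intro continuous_intros cont[OF R] cont[OF V(1)] m)
  have m_ab: "m integrable_on {\<alpha>..\<beta>}"
    by (rule integrable_continuous_real) (rule continuous_on_subset[OF m sub])
  have g_has: "(g has_integral (integral {\<alpha>..\<beta>} (\<lambda>t. exp (R (?\<gamma> t) * V (?\<gamma> t)) * m t) - A)) {0..1}"
  proof -
    have "((\<lambda>t. exp (R (?\<gamma> t) * V (?\<gamma> t)) * m t - m t) has_integral
        (integral {\<alpha>..\<beta>} (\<lambda>t. exp (R (?\<gamma> t) * V (?\<gamma> t)) * m t) - A)) {\<alpha>..\<beta>}"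
      unfolding A_def by (intro has_integral_diff integrable_integral EV m_ab)
    then have "((\<lambda>t. if t \<in> {\<alpha>..\<beta>} then exp (R (?\<gamma> t) * V (?\<gamma> t)) * m t - m t else 0) has_integral
        (integral {\<alpha>..\<beta>} (\<lambda>t. exp (R (?\<gamma> t) * V (?\<gamma> t)) * m t) - A)) {0..1}"
      by (rule iffD2[OF has_integral_restrict[OF sub]])
    then show ?thesis by (simp add: g_def left_diff_distrib cong: if_cong)
  qed
  define L where "L = integral {0..1} (\<lambda>t. m t + g t)"
  have "L = B + integral {\<alpha>..\<beta>} (\<lambda>t. exp (R (?\<gamma> t) * V (?\<gamma> t)) * m t)"
    unfolding L_def B_def
    using has_integral_add[OF integrable_integral[OF m_int] g_has] by (simp add: integral_unique)
  also have "integral {\<alpha>..\<beta>} (\<lambda>t. exp (R (?\<gamma> t) * V (?\<gamma> t)) * m t) =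
      integral {\<alpha>..\<beta>} (\<lambda>t. (exp (R (?\<gamma> t) * V (?\<gamma> t)) - exp \<sigma>) * m t) + exp \<sigma> * A"
  proof -
    have "((\<lambda>t. exp (R (?\<gamma> t) * V (?\<gamma> t)) * m t - exp \<sigma> * m t) has_integral
       integral {\<alpha>..\<beta>} (\<lambda>t. exp (R (?\<gamma> t) * V (?\<gamma> t)) * m t) - exp \<sigma> * A) {\<alpha>..\<beta>}"
      unfolding A_def by (intro has_integral_diff has_integral_mult_right integrable_integral EV m_ab)
    then show ?thesis by (simp add: left_diff_distrib integral_unique)
  qed
  finally have "L - c' = integral {\<alpha>..\<beta>} (\<lambda>t. (exp (R (?\<gamma> t) * V (?\<gamma> t)) - exp \<sigma>) * m t)"
    using \<sigma> by (simp add: algebra_simps)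
  also have "cmod \<dots> \<le> \<epsilon> / 4 * (\<beta> - \<alpha>)"
  proof (rule integral_bound)
    show "continuous_on {\<alpha>..\<beta>} (\<lambda>t. (exp (R (?\<gamma> t) * V (?\<gamma> t)) - exp \<sigma>) * m t)"
      by (rule continuous_on_subset[OF _ sub]) (intro continuous_intros cont[OF R] cont[OF V(1)] m)
    fix t assume "t \<in> {\<alpha>..\<beta>}"
    then have t: "t \<in> {0..1}" using sub by blast
    have "cmod ((exp (R (?\<gamma> t) * V (?\<gamma> t)) - exp \<sigma>) * m t) \<le> \<epsilon> / (4 * M) * M"
      unfolding norm_mult using \<tau>(2)[OF RV[OF \<gamma>_seg[OF t]]] M(2)[OF t] M(1) \<open>\<epsilon> > 0\<close>
      by (intro mult_mono) auto
    then show "cmod ((exp (R (?\<gamma> t) * V (?\<gamma> t)) - exp \<sigma>) * m t) \<le> \<epsilon> / 4" using M by simp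
  qed (use ab in auto)
  also have "\<dots> \<le> \<epsilon>/4 * 1" using ab \<open>\<epsilon> > 0\<close> by (intro mult_left_mono) auto
  finally have Lc: "cmod (L - c') \<le> \<epsilon>/4" by simp
  have "eventually (\<lambda>k. dist (integral {0..1} (f k)) L < \<epsilon>/4) sequentially"
    using conv \<open>\<epsilon> > 0\<close> unfolding L_def tendsto_iff by (meson divide_pos_pos zero_less_numeral)
  moreover have "eventually (\<lambda>k. \<forall>z\<in>X. dist (s k z) 0 < \<epsilon> / (4 * CV)) sequentially"
    using s(2) \<open>\<epsilon> > 0\<close> CV unfolding uniform_limit_iff by simp
  moreover have "eventually (\<lambda>k. 1 / (real k + 1) < \<epsilon>/4) sequentially"
    using order_tendstoD(2)[OF lim0, of "\<epsilon>/4"] \<open>\<epsilon> > 0\<close> by simp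
  ultimately have "eventually (\<lambda>k. dist (integral {0..1} (f k)) L < \<epsilon>/4 \<and>
      (\<forall>z\<in>X. dist (s k z) 0 < \<epsilon> / (4 * CV)) \<and> 1 / (real k + 1) < \<epsilon>/4) sequentially"
    by eventually_elim blast
  then obtain k where k: "dist (integral {0..1} (f k)) L < \<epsilon>/4"
      "\<And>z. z \<in> X \<Longrightarrow> cmod (s k z) < \<epsilon> / (4 * CV)" "1 / (real k + 1) < \<epsilon>/4"
    by (auto simp: eventually_sequentially dist_norm)
  show ?thesis
  proof
    show "(\<lambda>z. S0 z + w k z) holomorphic_on UNIV" by (intro holomorphic_intros S0 w)
    show "cmod (S0 z + w k z - S z) < \<epsilon>" if z: "z \<in> X" for z
    proof -
      have "cmod (V z * s k z) \<le> CV * (\<epsilon> / (4 * CV))"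
        unfolding norm_mult using CV k(2)[OF z] z by (intro mult_mono) (auto intro: less_imp_le)
      then have "cmod (V z * s k z) \<le> \<epsilon>/4" using CV by simp
      moreover have "cmod (w k z - V z * s k z) < \<epsilon>/4" using w(2)[of z k] z k(3) by simp
      ultimately have "cmod (w k z) < \<epsilon>/2"
        using norm_triangle_sub[of "w k z" "V z * s k z"] by linarith
      then show ?thesis using norm_triangle_ineq[of "S0 z - S z" "w k z"] S0(2)[OF z]
        by (simp add: algebra_simps)
    qed
    have "(\<lambda>t. exp (T (?\<gamma> t) + R (?\<gamma> t) * (S0 (?\<gamma> t) + w k (?\<gamma> t))) / R (?\<gamma> t) * (q - p)) = f k"
      by (rule ext) (simp add: f_def m_def exp_add[symmetric] algebra_simps)
    then have "contour_integral ?\<gamma> (\<lambda>z. exp (T z + R z * (S0 z + w k z)) / R z) = integral {0..1} (f k)"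
      unfolding ci by simp
    moreover have "cmod (integral {0..1} (f k) - c) < \<epsilon>"
    proof -
      have "integral {0..1} (f k) - c = (integral {0..1} (f k) - L) + ((L - c') + (c' - c))" by simp
      also have "cmod \<dots> \<le> cmod (integral {0..1} (f k) - L) + (cmod (L - c') + cmod (c' - c))"
        by (meson add_left_mono norm_triangle_ineq order_trans)
      also have "\<dots> < \<epsilon>" using k(1) Lc c'(1) \<open>\<epsilon> > 0\<close> by (simp add: dist_norm)
      finally show ?thesis .
    qed
    ultimately show "cmod (contour_integral ?\<gamma> (\<lambda>z. exp (T z + R z * (S0 z + w k z)) / R z) - c) < \<epsilon>" by simp
  qed
qed

section \<open>Division, principal parts and nearest points\<close>

lemma holomorphic_divided_difference:
  assumes "S holomorphic_on W" "open W"
  obtains S1 where "S1 holomorphic_on W" "\<And>z. z \<in> W \<Longrightarrow> S z = S a + (z - a) * S1 z"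
proof
  show "(\<lambda>z. if z = a then deriv S a else (S z - S a) / (z - a)) holomorphic_on W"
    by (rule pole_lemma_open) (use assms in auto)
qed simp

text \<open>
Hermite interpolation at the points of \<open>Z\<close>, to first order, in the form of a division with
remainder: two divided differences at each point.
\<close>

lemma holomorphic_division:
  assumes "Q holomorphic_on W" "open W" "finite Z"
  obtains T S where "T holomorphic_on UNIV" "S holomorphic_on W"
    "\<And>z. z \<in> W \<Longrightarrow> Q z = T z + (\<Prod>a\<in>Z. z - a)\<^sup>2 * S z"
  using assms(3)
proof (induction Z arbitrary: thesis rule: finite_induct)
  case empty
  show ?case by (rule empty[of "\<lambda>z. 0" Q]) (use assms in auto)
next
  case (insert a Z)
  obtain T S where TS: "T holomorphic_on UNIV" "S holomorphic_on W"
    "\<And>z. z \<in> W \<Longrightarrow> Q z = T z + (\<Prod>a\<in>Z. z - a)\<^sup>2 * S z" using insert.IH by blast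
  obtain S1 where S1: "S1 holomorphic_on W" "\<And>z. z \<in> W \<Longrightarrow> S z = S a + (z - a) * S1 z"
    using holomorphic_divided_difference[OF TS(2) assms(2)] by blast
  obtain S2 where S2: "S2 holomorphic_on W" "\<And>z. z \<in> W \<Longrightarrow> S1 z = S1 a + (z - a) * S2 z"
    using holomorphic_divided_difference[OF S1(1) assms(2)] by blast
  show ?case
  proof (rule insert.prems)
    show "(\<lambda>z. T z + (\<Prod>a\<in>Z. z - a)\<^sup>2 * (S a + (z - a) * S1 a)) holomorphic_on UNIV"
      by (intro holomorphic_intros TS)
    show "Q z = T z + (\<Prod>a\<in>Z. z - a)\<^sup>2 * (S a + (z - a) * S1 a) + (\<Prod>a\<in>insert a Z. z - a)\<^sup>2 * S2 z"
      if "z \<in> W" for z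
      using TS(3)[OF that] S1(2)[OF that] S2(2)[OF that] insert.hyps
      by (simp add: power_mult_distrib power2_eq_square algebra_simps)
  qed fact
qed

lemma poles_isolated:
  assumes "F \<in> mero_lu W" "open W" "z \<in> W"
  obtains d where "d > 0" "\<And>w. w \<in> ball z d \<Longrightarrow> w \<noteq> z \<Longrightarrow> F w \<noteq> None"
proof -
  have lu: "locally_univalent_at F z" using assms mero_lu_imp_locally_univalent_at by blast
  show ?thesis
  proof (cases "F z = None")
    case True
    then show ?thesis using locally_univalent_at_pole[OF lu] that by (metis option.distinct(1))
  next
    case False
    then show ?thesis using locally_univalent_at_finite[OF lu] that by (metis option.distinct(1))
  qed
qed

lemma finite_poles_compact:
  assumes "F \<in> mero_lu W" "open W" "compact K" "K \<subseteq> W"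
  shows "finite {z \<in> K. F z = None}"
proof (rule ccontr)
  assume "infinite {z \<in> K. F z = None}"
  then obtain x where x: "x \<in> K" "x islimpt {z \<in> K. F z = None}"
    using Heine_Borel_imp_Bolzano_Weierstrass[OF \<open>compact K\<close>] by (metis (no_types, lifting) mem_Collect_eq subsetI)
  obtain d where d: "d > 0" "\<And>w. w \<in> ball x d \<Longrightarrow> w \<noteq> x \<Longrightarrow> F w \<noteq> None"
    using poles_isolated[OF assms(1,2)] x assms by blast
  then show False using x(2) unfolding islimpt_approachable by (metis (mono_tags, lifting) dist_commute mem_Collect_eq mem_ball)
qed

text \<open>
Subtracting \<open>b a / (z - a)\<close> at every pole leaves removable singularities.
\<close>

lemma principal_parts:
  assumes F: "F \<in> mero_lu W" and "open W" and Z: "Z = {z \<in> W. F z = None}" "finite Z"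
  obtains b h where "\<And>a. a \<in> Z \<Longrightarrow> b a \<noteq> 0" "h holomorphic_on W"
    "\<And>z. z \<in> W - Z \<Longrightarrow> F z = Some ((\<Sum>a\<in>Z. b a / (z - a)) + h z)"
    "\<And>z. z \<in> W - Z \<Longrightarrow> deriv h z - (\<Sum>a\<in>Z. b a / (z - a)\<^sup>2) \<noteq> 0"
proof -
  have lu: "locally_univalent_at F z" if "z \<in> W" for z
    using mero_lu_imp_locally_univalent_at assms that by blast
  have "\<exists>r b m. r > 0 \<and> b \<noteq> 0 \<and> m holomorphic_on ball a r \<and>
      (\<forall>w\<in>ball a r. w \<noteq> a \<longrightarrow> F w = Some (b / (w - a) + m w))" if "a \<in> Z" for a
    using locally_univalent_at_pole[OF lu, of a] that Z by (metis (mono_tags, lifting) mem_Collect_eq)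
  then obtain r b m where rbm: "\<And>a. a \<in> Z \<Longrightarrow> r a > 0" "\<And>a. a \<in> Z \<Longrightarrow> b a \<noteq> 0"
      "\<And>a. a \<in> Z \<Longrightarrow> m a holomorphic_on ball a (r a)"
      "\<And>a w. a \<in> Z \<Longrightarrow> w \<in> ball a (r a) \<Longrightarrow> w \<noteq> a \<Longrightarrow> F w = Some (b a / (w - a) + m a w)"
    by metis
  define h where "h = (\<lambda>z. if z \<in> Z then m z z - (\<Sum>a\<in>Z - {z}. b a / (z - a))
      else the (F z) - (\<Sum>a\<in>Z. b a / (z - a)))"
  have rat: "(\<lambda>z. \<Sum>a\<in>A. b a / (z - a)) holomorphic_on B" if "A \<inter> B = {}" for A B
    using that by (intro holomorphic_intros) auto
  have oWZ: "open (W - Z)" using \<open>open W\<close> Z finite_imp_closed by blast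
  have "h field_differentiable at z" if z: "z \<in> W" for z
  proof (cases "z \<in> Z")
    case True
    obtain d where d: "d > 0" "ball z d \<subseteq> W - (Z - {z})"
    proof -
      have "open (W - (Z - {z}))" using \<open>open W\<close> Z finite_imp_closed by (metis finite_Diff open_Diff)
      then show ?thesis using that z openE by (metis DiffI Diff_iff singletonI)
    qed
    define e where "e = min d (r z)"
    have e: "e > 0" "ball z e \<subseteq> W - (Z - {z})" "ball z e \<subseteq> ball z (r z)"
      using d rbm(1)[OF True] by (auto simp: e_def)
    have "(\<lambda>w. m z w - (\<Sum>a\<in>Z - {z}. b a / (w - a))) holomorphic_on ball z e"
      using rbm(3)[OF True] e by (intro holomorphic_on_diff rat) (auto intro: holomorphic_on_subset)
    then have "h holomorphic_on ball z e"
    proof (rule holomorphic_transform)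
      fix w assume w: "w \<in> ball z e"
      show "m z w - (\<Sum>a\<in>Z - {z}. b a / (w - a)) = h w"
      proof (cases "w = z")
        case False
        then have "w \<notin> Z" using w e by blast
        moreover have "the (F w) = b z / (w - z) + m z w" using rbm(4)[OF True, of w] w e False by auto
        moreover have "(\<Sum>a\<in>Z. b a / (w - a)) = b z / (w - z) + (\<Sum>a\<in>Z - {z}. b a / (w - a))"
          using True Z by (simp add: sum.remove)
        ultimately show ?thesis by (simp add: h_def)
      qed (simp add: h_def True)
    qed
    then show ?thesis using e(1) by (auto intro: holomorphic_on_imp_differentiable_at)
  next
    case False
    then have "F z \<noteq> None" using z by (auto simp: Z(1))
    obtain r h1 where h1: "r > 0" "h1 holomorphic_on ball z r" "\<And>w. w \<in> ball z r \<Longrightarrow> F w = Some (h1 w)"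
      using locally_univalent_at_finite[OF lu[OF z] \<open>F z \<noteq> None\<close>] by metis
    have sub: "ball z r \<inter> Z = {}"
    proof -
      have "F w \<noteq> None" if "w \<in> ball z r" for w using h1(3)[OF that] by simp
      then show ?thesis using Z by blast
    qed
    have "(\<lambda>w. h1 w - (\<Sum>a\<in>Z. b a / (w - a))) holomorphic_on ball z r"
      by (intro holomorphic_on_diff rat h1) (use sub in blast)
    then have "h holomorphic_on ball z r"
      by (rule holomorphic_transform) (use sub h1 in \<open>auto simp: h_def\<close>)
    then show ?thesis using h1(1) by (auto intro: holomorphic_on_imp_differentiable_at)
  qed
  then have h: "h holomorphic_on W"
    using \<open>open W\<close> by (simp add: holomorphic_on_def field_differentiable_at_within)
  have Feq: "F z = Some ((\<Sum>a\<in>Z. b a / (z - a)) + h z)" if "z \<in> W - Z" for z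
    using that Z by (auto simp: h_def)
  have "deriv h z - (\<Sum>a\<in>Z. b a / (z - a)\<^sup>2) \<noteq> 0" if z: "z \<in> W - Z" for z
  proof -
    have "F z \<noteq> None" using z by (auto simp: Z(1))
    obtain r h1 where h1: "r > 0" "h1 holomorphic_on ball z r" "deriv h1 z \<noteq> 0"
        "\<And>w. w \<in> ball z r \<Longrightarrow> F w = Some (h1 w)"
      using locally_univalent_at_finite[OF lu \<open>F z \<noteq> None\<close>] z by (metis DiffD1)
    have d1: "(h1 has_field_derivative deriv h1 z) (at z)" using h1 by (simp add: holomorphic_derivI)
    have d2: "((\<lambda>w. (\<Sum>a\<in>Z. b a / (w - a)) + h w) has_field_derivative
        (\<Sum>a\<in>Z. - b a / (z - a)\<^sup>2) + deriv h z) (at z)"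
    proof (intro derivative_intros)
      show "(h has_field_derivative deriv h z) (at z)" using h z \<open>open W\<close> by (simp add: holomorphic_derivI)
      fix a assume "a \<in> Z"
      then have "z - a \<noteq> 0" using z by auto
      then show "((\<lambda>w. b a / (w - a)) has_field_derivative - b a / (z - a)\<^sup>2) (at z)"
        by (auto intro!: derivative_eq_intros simp: power2_eq_square)
    qed
    have ev: "eventually (\<lambda>w. (\<Sum>a\<in>Z. b a / (w - a)) + h w = h1 w) (nhds z)"
    proof -
      have "eventually (\<lambda>w. w \<in> ball z r \<inter> (W - Z)) (nhds z)"
        using h1(1) z oWZ by (intro eventually_nhds_in_open) auto
      then show ?thesis by eventually_elim (use Feq h1(4) in force)
    qed
    have "deriv h1 z = (\<Sum>a\<in>Z. - b a / (z - a)\<^sup>2) + deriv h z"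
      by (rule DERIV_unique[OF d1]) (use d2 DERIV_cong_ev[OF refl ev refl] in blast)
    then show ?thesis using h1(3) by (simp add: sum_negf)
  qed
  then show ?thesis using that[of b h] rbm(2) h Feq by blast
qed

lemma mero_lu_from_principal_parts:
  assumes "open W" "finite Z" "\<And>a. a \<in> Z \<Longrightarrow> b a \<noteq> 0" and h: "h holomorphic_on W"
    and nz: "\<And>z. z \<in> W - Z \<Longrightarrow> deriv h z - (\<Sum>a\<in>Z. b a / (z - a)\<^sup>2) \<noteq> 0"
  shows "(\<lambda>z\<in>W. if z \<in> Z then None else Some ((\<Sum>a\<in>Z. b a / (z - a)) + h z)) \<in> mero_lu W" (is "?F \<in> _")
proof (rule mero_lu_if_locally_univalent_at)
  have rat: "(\<lambda>z. \<Sum>a\<in>A. b a / (z - a)) holomorphic_on B" if "A \<inter> B = {}" for A B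
    using that by (intro holomorphic_intros) auto
  have oWZ: "open (W - Z)" using assms finite_imp_closed by blast
  fix z assume z: "z \<in> W"
  show "locally_univalent_at ?F z"
  proof (cases "z \<in> Z")
    case True
    have "open (W - (Z - {z}))" using assms finite_imp_closed by (metis finite_Diff open_Diff)
    then obtain e where e: "e > 0" "ball z e \<subseteq> W - (Z - {z})" 
      using z openE by (metis DiffI Diff_iff singletonI)
    show ?thesis
    proof (rule locally_univalent_at_polar[OF e(1) assms(3)[OF True]])
      show "(\<lambda>w. (\<Sum>a\<in>Z - {z}. b a / (w - a)) + h w) holomorphic_on ball z e"
        using e h by (intro holomorphic_on_add rat) (auto intro: holomorphic_on_subset)
      show "?F z = None" using z True by simp
      fix w assume w: "w \<in> ball z e" "w \<noteq> z"
      have "(\<Sum>a\<in>Z. b a / (w - a)) = b z / (w - z) + (\<Sum>a\<in>Z - {z}. b a / (w - a))"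
        using True assms by (simp add: sum.remove)
      moreover have "w \<in> W - Z" using w e by blast
      ultimately show "?F w = Some (b z / (w - z) + ((\<Sum>a\<in>Z - {z}. b a / (w - a)) + h w))" by simp
    qed
  next
    case False
    then obtain e where e: "e > 0" "ball z e \<subseteq> W - Z" using oWZ z openE by (metis DiffI)
    let ?f = "\<lambda>w. (\<Sum>a\<in>Z. b a / (w - a)) + h w"
    have f: "?f holomorphic_on ball z e"
      using e h by (intro holomorphic_on_add rat) (auto intro: holomorphic_on_subset)
    have "(?f has_field_derivative (\<Sum>a\<in>Z. - b a / (z - a)\<^sup>2) + deriv h z) (at z)"
    proof (intro derivative_intros)
      show "(h has_field_derivative deriv h z) (at z)" using h z \<open>open W\<close> by (simp add: holomorphic_derivI)
      fix a assume "a \<in> Z"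
      then have "z - a \<noteq> 0" using False by auto
      then show "((\<lambda>w. b a / (w - a)) has_field_derivative - b a / (z - a)\<^sup>2) (at z)"
        by (auto intro!: derivative_eq_intros simp: power2_eq_square)
    qed
    then have "deriv ?f z \<noteq> 0" using nz[of z] z False by (simp add: DERIV_imp_deriv sum_negf)
    moreover have "\<forall>w\<in>ball z e. ?F w = Some (?f w)" using e by auto
    ultimately show ?thesis unfolding locally_univalent_at_def using e(1) f by blast
  qed
qed (use assms in auto)

text \<open>
The logarithm exists on the disc and is transported by the inverse of \<open>\<psi>\<close>.
\<close>

lemma holomorphic_log_univalent_disc:
  assumes \<psi>: "\<psi> holomorphic_on ball 0 r" "inj_on \<psi> (ball 0 r)"
    and H: "H holomorphic_on \<psi> ` ball 0 r" "\<And>z. z \<in> \<psi> ` ball 0 r \<Longrightarrow> H z \<noteq> 0"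
  obtains Q where "Q holomorphic_on \<psi> ` ball 0 r" "\<And>z. z \<in> \<psi> ` ball 0 r \<Longrightarrow> exp (Q z) = H z"
proof -
  obtain g where g: "g holomorphic_on \<psi> ` ball 0 r" "\<And>x. x \<in> ball 0 r \<Longrightarrow> g (\<psi> x) = x"
    using holomorphic_has_inverse[OF \<psi>(1) open_ball \<psi>(2)] by metis
  have "(H \<circ> \<psi>) holomorphic_on ball 0 r" using holomorphic_on_compose[OF \<psi>(1) H(1)] .
  then obtain l where l: "l holomorphic_on ball 0 r" "\<And>x. x \<in> ball 0 r \<Longrightarrow> (H \<circ> \<psi>) x = exp (l x)"
    using contractible_imp_holomorphic_log[of "H \<circ> \<psi>" "ball 0 r"] H(2) convex_imp_contractible[OF convex_ball]
    by (metis comp_apply imageI)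
  have "(l \<circ> g) holomorphic_on \<psi> ` ball 0 r"
    by (rule holomorphic_on_compose_gen[OF g(1) l(1)]) (use g(2) in auto)
  moreover have "exp ((l \<circ> g) z) = H z" if "z \<in> \<psi> ` ball 0 r" for z
    using that g(2) l(2) by (metis comp_apply imageE)
  ultimately show ?thesis using that by blast
qed

text \<open>
Choose \<open>p\<close> and \<open>q\<close> at minimal distance. Any other point of the sets on the segment, and likewise an
interior point as an end, would give a shorter connection.
\<close>

lemma nearest_segment:
  fixes K L :: "complex set"
  assumes "compact K" "compact L" "K \<inter> L = {}" "K \<noteq> {}" "L \<noteq> {}"
  obtains p q where "p \<in> K - interior K" "q \<in> L - interior L"
    "closed_segment p q \<inter> K = {p}" "closed_segment p q \<inter> L = {q}"
proof -
  obtain p q where pq: "p \<in> K" "q \<in> L" "dist p q = setdist K L"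
    using setdist_compact_closed[OF assms(1) compact_imp_closed[OF assms(2)] assms(4,5)] by blast
  have ne: "p \<noteq> q" using pq assms by blast
  have min: "dist p q \<le> dist x y" if "x \<in> K" "y \<in> L" for x y
    unfolding pq(3) using that by (rule setdist_le_dist)
  have K: "x = p" if "x \<in> closed_segment p q" "x \<in> K" for x
  proof -
    have "dist p q = dist p x + dist x q" using that(1) by (simp add: between between_mem_segment[symmetric])
    then show ?thesis using min[OF that(2) pq(2)] by simp
  qed
  have L: "x = q" if "x \<in> closed_segment p q" "x \<in> L" for x
  proof -
    have "dist p q = dist p x + dist x q" using that(1) by (simp add: between between_mem_segment[symmetric])
    then show ?thesis using min[OF pq(1) that(2)] by simp
  qed
  have near: "\<exists>x\<in>closed_segment a b. x \<in> S \<and> x \<noteq> a" if "a \<in> interior S" "a \<noteq> b" for a b :: complex and S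
  proof -
    obtain e where e: "e > 0" "ball a e \<subseteq> S" using \<open>a \<in> interior S\<close> mem_interior by blast
    define t where "t = min 1 (e / (2 * cmod (b - a)))"
    have nz: "cmod (b - a) > 0" using that by simp
    then have t: "0 < t" "t \<le> 1" "t * cmod (b - a) < e"
    proof -
      show "0 < t" "t \<le> 1" using e nz by (auto simp: t_def)
      have "t * cmod (b - a) \<le> e / (2 * cmod (b - a)) * cmod (b - a)"
        by (rule mult_right_mono) (auto simp: t_def)
      also have "\<dots> = e/2" using nz by simp
      finally show "t * cmod (b - a) < e" using e by simp
    qed
    have "a + t *\<^sub>R (b - a) \<in> closed_segment a b"
      unfolding closed_segment_def using t by (auto simp: algebra_simps intro!: exI[of _ t])
    moreover have "a + t *\<^sub>R (b - a) \<in> S" using t e by (auto intro!: subsetD[OF e(2)] simp: dist_norm)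
    moreover have "a + t *\<^sub>R (b - a) \<noteq> a" using t that by simp
    ultimately show ?thesis by blast
  qed
  have "p \<notin> interior K" using near[of p K q] K ne by blast
  moreover have "q \<notin> interior L" using near[of q L p] L ne by (metis closed_segment_commute)
  ultimately show ?thesis using that[of p q] pq K L by auto
qed

section \<open>A Runge theorem for locally univalent functions\<close>

text \<open>
\<open>H\<close> is \<open>P^2\<close> times the derivative of \<open>\<Sum> b a / (z - a) + h\<close>, with the denominators cleared, so that it
makes sense at the poles, too; there only one summand survives.
\<close>

lemma zero_free_numerator:
  fixes Z W b h
  defines "H \<equiv> \<lambda>z. (\<Prod>a\<in>Z. z - a)\<^sup>2 * deriv h z - (\<Sum>a\<in>Z. b a * (\<Prod>c\<in>Z - {a}. z - c)\<^sup>2)"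
  assumes "open W" "finite Z" "\<And>a. a \<in> Z \<Longrightarrow> b a \<noteq> 0" and h: "h holomorphic_on W"
    and nz: "\<And>z. z \<in> W - Z \<Longrightarrow> deriv h z - (\<Sum>a\<in>Z. b a / (z - a)\<^sup>2) \<noteq> 0"
  shows "H holomorphic_on W"
    and "z \<notin> Z \<Longrightarrow> H z = (\<Prod>a\<in>Z. z - a)\<^sup>2 * (deriv h z - (\<Sum>a\<in>Z. b a / (z - a)\<^sup>2))"
    and "z \<in> W \<Longrightarrow> H z \<noteq> 0"
proof -
  show "H holomorphic_on W"
    unfolding H_def using h \<open>open W\<close> by (intro holomorphic_intros holomorphic_deriv)
  show eq: "H z = (\<Prod>a\<in>Z. z - a)\<^sup>2 * (deriv h z - (\<Sum>a\<in>Z. b a / (z - a)\<^sup>2))" if "z \<notin> Z" for z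
  proof -
    have "b a * (\<Prod>c\<in>Z - {a}. z - c)\<^sup>2 = (\<Prod>a\<in>Z. z - a)\<^sup>2 * (b a / (z - a)\<^sup>2)" if "a \<in> Z" for a
    proof -
      have "(\<Prod>a\<in>Z. z - a) = (z - a) * (\<Prod>c\<in>Z - {a}. z - c)" 
        using that \<open>finite Z\<close> by (rule prod.remove[rotated])
      moreover have "z - a \<noteq> 0" using \<open>z \<notin> Z\<close> that by auto
      ultimately show ?thesis by (simp add: power_mult_distrib)
    qed
    then show ?thesis
      unfolding H_def right_diff_distrib sum_distrib_left by (intro arg_cong2[where f = minus] sum.cong) auto
  qed
  show "H z \<noteq> 0" if z: "z \<in> W"
  proof (cases "z \<in> Z")
    case False
    then have "(\<Prod>a\<in>Z. z - a) \<noteq> 0" using \<open>finite Z\<close> by auto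
    then show ?thesis using eq[OF False] nz[of z] z False by simp
  next
    case True
    have "(\<Prod>a\<in>Z. z - a) = 0" using True \<open>finite Z\<close> by auto
    moreover have "(\<Sum>a\<in>Z. b a * (\<Prod>c\<in>Z - {a}. z - c)\<^sup>2) = b z * (\<Prod>c\<in>Z - {z}. z - c)\<^sup>2 + (\<Sum>a\<in>Z - {z}. b a * (\<Prod>c\<in>Z - {a}. z - c)\<^sup>2)"
      using True \<open>finite Z\<close> by (simp add: sum.remove)
    moreover have "(\<Sum>a\<in>Z - {z}. b a * (\<Prod>c\<in>Z - {a}. z - c)\<^sup>2) = 0"
      using True \<open>finite Z\<close> by (intro sum.neutral) auto
    moreover have "(\<Prod>c\<in>Z - {z}. z - c) \<noteq> 0" using \<open>finite Z\<close> by auto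
    ultimately show ?thesis using assms(4)[OF True] by (simp add: H_def)
  qed
qed

lemma exp_quotient:
  obtains E :: "complex \<Rightarrow> complex" where "E holomorphic_on UNIV" "\<And>u. exp u = 1 + u * E u"
proof
  let ?E = "\<lambda>u. if u = 0 then deriv exp 0 else (exp u - exp 0) / (u - (0::complex))"
  show "?E holomorphic_on UNIV" by (rule pole_lemma_open) (auto intro!: holomorphic_intros)
  show "exp u = 1 + u * ?E u" for u by simp
qed

text \<open>
Mean value inequality on the convex parameter disc.
\<close>

lemma small_on_univalent_disc:
  assumes \<psi>: "\<psi> holomorphic_on ball 0 r" "r > 1" and e: "e holomorphic_on \<psi> ` ball 0 r" "open (\<psi> ` ball 0 r)"
    and M: "\<And>x. x \<in> cball 0 1 \<Longrightarrow> cmod (deriv \<psi> x) \<le> M"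
    and D: "\<And>z. z \<in> \<psi> ` cball 0 1 \<Longrightarrow> cmod (deriv e z) \<le> D" and "M \<ge> 0" "D \<ge> 0"
    and p: "p \<in> \<psi> ` cball 0 1" and z: "z \<in> \<psi> ` cball 0 1"
  shows "cmod (e z - e p) \<le> 2 * M * D"
proof -
  have sub: "cball 0 1 \<subseteq> ball (0::complex) r" using \<psi> by auto
  obtain x y where xy: "x \<in> cball 0 1" "y \<in> cball 0 1" "z = \<psi> x" "p = \<psi> y" using p z by blast
  have "cmod ((e \<circ> \<psi>) x - (e \<circ> \<psi>) y) \<le> (D * M) * cmod (x - y)"
  proof (rule field_differentiable_bound[where S = "cball 0 1"])
    fix w :: complex assume w: "w \<in> cball 0 1"
    have "(\<psi> has_field_derivative deriv \<psi> w) (at w)"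
      using \<psi> w sub by (intro holomorphic_derivI) auto
    moreover have "(e has_field_derivative deriv e (\<psi> w)) (at (\<psi> w))"
      using e w sub by (intro holomorphic_derivI[of e "\<psi> ` ball 0 r"]) auto
    ultimately have "((e \<circ> \<psi>) has_field_derivative deriv e (\<psi> w) * deriv \<psi> w) (at w)"
      by (metis DERIV_chain)
    then show "((e \<circ> \<psi>) has_field_derivative deriv e (\<psi> w) * deriv \<psi> w) (at w within cball 0 1)"
      by (rule has_field_derivative_at_within)
    show "cmod (deriv e (\<psi> w) * deriv \<psi> w) \<le> D * M"
      unfolding norm_mult using M[OF w] D[of "\<psi> w"] w \<open>D \<ge> 0\<close> by (intro mult_mono) auto
  qed (use xy in auto)
  also have "\<dots> \<le> (D * M) * 2"
    using xy norm_triangle_ineq4[of x y] \<open>D \<ge> 0\<close> \<open>M \<ge> 0\<close> by (intro mult_left_mono) auto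
  finally show ?thesis by (simp add: xy mult_ac)
qed

lemma holomorphic_on_disjoint_glue:
  assumes "open A" "open B" "A \<inter> B = {}" "f holomorphic_on A" "g holomorphic_on B"
  shows "(\<lambda>z. if z \<in> A then f z else g z) holomorphic_on A \<union> B"
proof (rule holomorphic_on_Un)
  show "(\<lambda>z. if z \<in> A then f z else g z) holomorphic_on A"
    by (rule holomorphic_transform[OF assms(4)]) simp
  show "(\<lambda>z. if z \<in> A then f z else g z) holomorphic_on B"
    by (rule holomorphic_transform[OF assms(5)]) (use assms(3) in auto)
qed (use assms in auto)

text \<open>
The ends of the segment lie on the boundaries of the discs, hence off the poles, which will be in
the interiors. Each set in the chain disc, segment, disc meets the union of the preceding ones in a
single point, so Janiszewski's theorem shows that the chain does not separate the plane.
\<close>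

lemma segment_between_discs:
  assumes r: "r > 1"
    and \<psi>: "\<psi> holomorphic_on ball 0 r" "inj_on \<psi> (ball 0 r)"
    and \<theta>: "\<theta> holomorphic_on ball 0 r" "inj_on \<theta> (ball 0 r)"
    and disj: "\<psi> ` ball 0 r \<inter> \<theta> ` ball 0 r = {}"
  obtains p q where "p \<in> \<psi> ` cball 0 1 - \<psi> ` ball 0 1" "q \<in> \<theta> ` cball 0 1 - \<theta> ` ball 0 1" "p \<noteq> q"
    "closed_segment p q \<inter> (\<psi> ` cball 0 1 \<union> \<theta> ` cball 0 1) = {p, q}"
    "connected (- (\<psi> ` cball 0 1 \<union> \<theta> ` cball 0 1 \<union> closed_segment p q))"
    "connected (- closed_segment p q)"
proof -
  let ?K = "\<psi> ` cball 0 1" and ?L = "\<theta> ` cball 0 1"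
  have sub: "cball 0 1 \<subseteq> ball (0::complex) r" using r by auto
  have comp: "compact ?K" "compact ?L" using compact_univalent_disc r \<psi> \<theta> by blast+
  have dis: "?K \<inter> ?L = {}" using disj sub by blast
  obtain p q where pq: "p \<in> ?K - interior ?K" "q \<in> ?L - interior ?L"
    "closed_segment p q \<inter> ?K = {p}" "closed_segment p q \<inter> ?L = {q}"
    using nearest_segment[OF comp dis] by auto
  have op: "f ` ball 0 1 \<subseteq> interior (f ` cball 0 1)"
    if "f holomorphic_on ball 0 r" "inj_on f (ball 0 r)" for f :: "complex \<Rightarrow> complex"
  proof (rule interior_maximal)
    have "ball 0 1 \<subseteq> ball (0::complex) r" using r by auto
    then show "open (f ` ball 0 1)"
      using that by (intro open_mapping_thm3) (auto intro: holomorphic_on_subset inj_on_subset)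
  qed auto
  have seg: "compact (closed_segment p q)" "connected (- closed_segment p q)"
  proof -
    show "connected (- closed_segment p q)"
      by (rule connected_complement_homeomorphic_convex_compact[OF homeomorphic_refl]) auto
  qed simp
  have ne: "p \<noteq> q" using pq dis by blast
  have c1: "connected (- (?K \<union> closed_segment p q))"
  proof (rule Janiszewski_connected)
    show "connected (?K \<inter> closed_segment p q)" using pq(3) by (simp add: Int_commute)
  qed (use comp seg connected_complement_univalent_disc[OF \<psi> r] in auto)
  have "connected (- (?L \<union> (?K \<union> closed_segment p q)))"
  proof (rule Janiszewski_connected)
    have "?L \<inter> (?K \<union> closed_segment p q) = {q}" using dis pq(4) by blast
    then show "connected (?L \<inter> (?K \<union> closed_segment p q))" by simp
    show "closed (?K \<union> closed_segment p q)" using comp seg by (auto intro: compact_imp_closed)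
  qed (use comp c1 connected_complement_univalent_disc[OF \<theta> r] in auto)
  moreover have "?L \<union> (?K \<union> closed_segment p q) = ?K \<union> ?L \<union> closed_segment p q" by blast
  moreover have "closed_segment p q \<inter> (?K \<union> ?L) = {p, q}" using pq by blast
  moreover have "p \<in> ?K - \<psi> ` ball 0 1" "q \<in> ?L - \<theta> ` ball 0 1"
    using pq(1,2) op[OF \<psi>] op[OF \<theta>] by blast+
  ultimately show ?thesis using that[of p q] ne seg(2) by simp
qed

text \<open>
The Runge theorem under the normalisation that all poles lie well inside the two discs. Write
\<open>R = P^2\<close> and \<open>R F' = H = exp Q\<close>, \<open>Q = T + R S\<close>, and let \<open>S'\<close> be an entire approximation of \<open>S\<close>,
\<open>E = S' - S\<close>. With the entire function \<open>\<Phi>(u) = (exp u - 1)/u\<close>,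
\<open>exp (T + R S') / R = exp Q / R + exp Q * E * \<Phi> (R E)\<close>,
so the derivatives of the new and the old function differ by a holomorphic function of the size of
\<open>E\<close>. The primitive is normalised to be correct at the end \<open>p\<close> of the segment in the first disc; the
prescribed integral along the segment makes it nearly correct at the end \<open>q\<close> in the second one.
\<close>

lemma lu_runge_finitely_many_poles:
  assumes r: "r > 1"
    and \<psi>: "\<psi> holomorphic_on ball 0 r" "inj_on \<psi> (ball 0 r)"
    and \<theta>: "\<theta> holomorphic_on ball 0 r" "inj_on \<theta> (ball 0 r)"
    and disj: "\<psi> ` ball 0 r \<inter> \<theta> ` ball 0 r = {}"
    and F: "F \<in> mero_lu (\<psi> ` ball 0 r \<union> \<theta> ` ball 0 r)"
    and fin: "finite {z \<in> \<psi> ` ball 0 r \<union> \<theta> ` ball 0 r. F z = None}"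
    and inner: "{z \<in> \<psi> ` ball 0 r \<union> \<theta> ` ball 0 r. F z = None} \<subseteq> \<psi> ` ball 0 1 \<union> \<theta> ` ball 0 1"
    and "\<epsilon> > 0"
  obtains G e where "G \<in> mero_lu UNIV" "e holomorphic_on \<psi> ` ball 0 r \<union> \<theta> ` ball 0 r"
    "\<And>z. z \<in> \<psi> ` ball 0 r \<union> \<theta> ` ball 0 r \<Longrightarrow> G z = map_option (\<lambda>u. u + e z) (F z)"
    "\<And>z. z \<in> \<psi> ` cball 0 1 \<union> \<theta> ` cball 0 1 \<Longrightarrow> cmod (e z) < \<epsilon>"
proof -
  define W1 W2 where "W1 = \<psi> ` ball 0 r" "W2 = \<theta> ` ball 0 r"
  define W where "W = W1 \<union> W2"
  let ?K = "\<psi> ` cball 0 1" and ?L = "\<theta> ` cball 0 1"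
  define X where "X = ?K \<union> ?L"
  have sub: "cball 0 1 \<subseteq> ball (0::complex) r" using r by auto
  have oW: "open W1" "open W2" "open W"
    using open_mapping_thm3[OF \<psi>(1) open_ball \<psi>(2)] open_mapping_thm3[OF \<theta>(1) open_ball \<theta>(2)]
    by (auto simp: W1_W2_def W_def)
  have XW: "X \<subseteq> W" using sub by (auto simp: X_def W_def W1_W2_def)
  have comp: "compact ?K" "compact ?L" using compact_univalent_disc r \<psi> \<theta> by blast+
  then have cX: "compact X" by (auto simp: X_def)
  define Z where "Z = {z \<in> W. F z = None}"
  have Z: "finite Z" "Z \<subseteq> \<psi> ` ball 0 1 \<union> \<theta> ` ball 0 1"
    using fin inner by (auto simp: Z_def W_def W1_W2_def)
  have FW: "F \<in> mero_lu W" using F by (simp add: W_def W1_W2_def)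
  obtain b h where b: "\<And>a. a \<in> Z \<Longrightarrow> b a \<noteq> 0" and h: "h holomorphic_on W"
    and Feq: "\<And>z. z \<in> W - Z \<Longrightarrow> F z = Some ((\<Sum>a\<in>Z. b a / (z - a)) + h z)"
    and nz: "\<And>z. z \<in> W - Z \<Longrightarrow> deriv h z - (\<Sum>a\<in>Z. b a / (z - a)\<^sup>2) \<noteq> 0"
    by (rule principal_parts[OF FW oW(3) Z_def Z(1)]) blast
  define R where "R = (\<lambda>z. (\<Prod>a\<in>Z. z - a)\<^sup>2)"
  have R: "R holomorphic_on A" for A unfolding R_def by (intro holomorphic_intros)
  have Rnz: "R z \<noteq> 0" if "z \<notin> Z" for z using that Z(1) by (auto simp: R_def)
  define \<Sigma> where "\<Sigma> = (\<lambda>z. \<Sum>a\<in>Z. b a / (z - a)\<^sup>2)"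
  have \<Sigma>: "\<Sigma> holomorphic_on A" if "A \<inter> Z = {}" for A
    unfolding \<Sigma>_def using that by (intro holomorphic_intros) auto
  define H where "H = (\<lambda>z. R z * deriv h z - (\<Sum>a\<in>Z. b a * (\<Prod>c\<in>Z - {a}. z - c)\<^sup>2))"
  note H_props = zero_free_numerator[OF oW(3) Z(1) b h nz]
  have H: "H holomorphic_on W" "\<And>z. z \<notin> Z \<Longrightarrow> H z = R z * (deriv h z - \<Sigma> z)" "\<And>z. z \<in> W \<Longrightarrow> H z \<noteq> 0"
    using H_props unfolding H_def R_def \<Sigma>_def by auto
  obtain Q1 where Q1: "Q1 holomorphic_on W1" "\<And>z. z \<in> W1 \<Longrightarrow> exp (Q1 z) = H z"
    unfolding W1_W2_def
  proof (rule holomorphic_log_univalent_disc[OF \<psi>])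
    show "H holomorphic_on \<psi> ` ball 0 r" using H(1) by (rule holomorphic_on_subset) (auto simp: W_def W1_W2_def)
    show "H z \<noteq> 0" if "z \<in> \<psi> ` ball 0 r" for z using H(3)[of z] that by (simp add: W_def W1_W2_def)
  qed blast
  obtain Q2 where Q2: "Q2 holomorphic_on W2" "\<And>z. z \<in> W2 \<Longrightarrow> exp (Q2 z) = H z"
    unfolding W1_W2_def
  proof (rule holomorphic_log_univalent_disc[OF \<theta>])
    show "H holomorphic_on \<theta> ` ball 0 r" using H(1) by (rule holomorphic_on_subset) (auto simp: W_def W1_W2_def)
    show "H z \<noteq> 0" if "z \<in> \<theta> ` ball 0 r" for z using H(3)[of z] that by (simp add: W_def W1_W2_def)
  qed blast
  define Q where "Q = (\<lambda>z. if z \<in> W1 then Q1 z else Q2 z)"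
  have Q: "Q holomorphic_on W" "\<And>z. z \<in> W \<Longrightarrow> exp (Q z) = H z"
    unfolding Q_def W_def using holomorphic_on_disjoint_glue[OF oW(1,2) _ Q1(1) Q2(1)] disj Q1(2) Q2(2)
    by (auto simp: W1_W2_def)
  obtain T S where T: "T holomorphic_on UNIV" and S: "S holomorphic_on W"
    and QTS: "\<And>z. z \<in> W \<Longrightarrow> Q z = T z + R z * S z"
    unfolding R_def by (rule holomorphic_division[OF Q(1) oW(3) Z(1)]) blast
  obtain \<Phi> where \<Phi>: "\<Phi> holomorphic_on UNIV" "\<And>u::complex. exp u = 1 + u * \<Phi> u" by (rule exp_quotient) blast
  obtain p q where p: "p \<in> ?K - \<psi> ` ball 0 1" and q: "q \<in> ?L - \<theta> ` ball 0 1" and "p \<noteq> q"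
    and seg: "closed_segment p q \<inter> X = {p, q}" "connected (- (X \<union> closed_segment p q))" "connected (- closed_segment p q)"
    unfolding X_def by (rule segment_between_discs[OF r \<psi> \<theta> disj]) blast
  have pqZ: "p \<notin> Z" "q \<notin> Z" "p \<in> X" "q \<in> X"
  proof -
    have "ball 0 1 \<subseteq> ball (0::complex) r" using r by auto
    then have "p \<notin> \<theta> ` ball 0 1" "q \<notin> \<psi> ` ball 0 1" using p q disj sub by blast+
    then show "p \<notin> Z" "q \<notin> Z" using p q Z(2) by blast+
  qed (use p q in \<open>auto simp: X_def\<close>)
  have ZX: "Z \<subseteq> X" using Z(2) ball_subset_cball[of "0::complex" 1] unfolding X_def by blast
  have segZ: "closed_segment p q \<inter> Z = {}"
  proof (rule ccontr)
    assume "closed_segment p q \<inter> Z \<noteq> {}"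
    then obtain x where "x \<in> closed_segment p q \<inter> X" "x \<in> Z" using ZX by blast
    then show False unfolding seg(1) using pqZ by auto
  qed
  have Rinv: "entire_approximable (closed_segment p q) (\<lambda>z. 1 / R z)"
  proof -
    have *: "entire_approximable (closed_segment p q) (\<lambda>z. \<Prod>a\<in>A. 1 / (z - a))" if "A \<subseteq> Z" for A
      using finite_subset[OF that Z(1)] that
    proof (induction A rule: finite_induct)
      case (insert a A)
      then have "entire_approximable (closed_segment p q) (\<lambda>z. (1 / (z - a)) * (\<Prod>a\<in>A. 1 / (z - a)))"
        using segZ by (intro entire_approximable_mult entire_approximable_pole seg) auto
      then show ?case using insert by simp
    qed (auto intro: entire_approximable_entire)
    have "entire_approximable (closed_segment p q) (\<lambda>z. (\<Prod>a\<in>Z. 1 / (z - a)) ^ 2)"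
      by (rule entire_approximable_power) (use * in auto)
    then show ?thesis by (simp add: R_def prod_dividef power_one_over)
  qed
  obtain BQ where BQ: "BQ > 0" "\<And>z. z \<in> X \<Longrightarrow> cmod (exp (Q z)) \<le> BQ"
  proof -
    have "continuous_on X (\<lambda>z. exp (Q z))"
      using Q(1) XW by (intro continuous_intros holomorphic_on_imp_continuous_on) (rule holomorphic_on_subset)
    then have "bounded ((\<lambda>z. exp (Q z)) ` X)" using cX by (metis compact_continuous_image compact_imp_bounded)
    then show ?thesis using that unfolding bounded_pos by auto
  qed
  obtain BR where BR: "BR > 0" "\<And>z. z \<in> X \<Longrightarrow> cmod (R z) \<le> BR"
    using entire_approximable_bounded[OF entire_approximable_entire[OF R] cX] by blast
  obtain B\<Phi> where B\<Phi>: "B\<Phi> > 0" "\<And>u. u \<in> cball 0 BR \<Longrightarrow> cmod (\<Phi> u) \<le> B\<Phi>"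
    using entire_approximable_bounded[OF entire_approximable_entire[OF \<Phi>(1)] compact_cball] by blast
  have dbound: "\<exists>M>0. \<forall>x\<in>cball 0 1. cmod (deriv f x) \<le> M" if "f holomorphic_on ball 0 r" for f
  proof -
    have "deriv f holomorphic_on ball 0 r" using that by (simp add: holomorphic_deriv)
    then have "continuous_on (cball 0 1) (deriv f)"
      using sub holomorphic_on_imp_continuous_on holomorphic_on_subset by blast
    then have "bounded (deriv f ` cball 0 1)" by (metis compact_cball compact_continuous_image compact_imp_bounded)
    then show ?thesis unfolding bounded_pos by auto
  qed
  obtain M1 where M1: "M1 > 0" "\<forall>x\<in>cball 0 1. cmod (deriv \<psi> x) \<le> M1" using dbound[OF \<psi>(1)] by blast
  obtain M2 where M2: "M2 > 0" "\<forall>x\<in>cball 0 1. cmod (deriv \<theta> x) \<le> M2" using dbound[OF \<theta>(1)] by blast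
  define C where "C = 2 * (M1 + M2) * (BQ * B\<Phi>)"
  have C: "C > 0" using M1 M2 BQ B\<Phi> by (simp add: C_def)
  \<comment> \<open>The discrepancy at \<open>q\<close> contributes \<open>\<eta>\<close>, the derivative contributes \<open>C * \<eta>\<close>.\<close>
  define \<eta> where "\<eta> = min 1 (\<epsilon> / (C + 1))"
  have \<eta>: "\<eta> > 0" "\<eta> \<le> 1" "(C + 1) * \<eta> \<le> \<epsilon>"
  proof -
    show "\<eta> > 0" "\<eta> \<le> 1" using \<open>\<epsilon> > 0\<close> C by (auto simp: \<eta>_def)
    have "(C + 1) * \<eta> \<le> (C + 1) * (\<epsilon> / (C + 1))" using C by (intro mult_left_mono) (auto simp: \<eta>_def)
    then show "(C + 1) * \<eta> \<le> \<epsilon>" using C by simp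
  qed
  have SX: "entire_approximable X S"
    using runge_two_discs(2)[OF r \<psi> \<theta> disj, of S] S by (simp add: X_def W_def W1_W2_def)
  \<comment> \<open>The increment from \<open>p\<close> to \<open>q\<close> that the original function asks for.\<close>
  define c where "c = h q - h p - contour_integral (linepath p q) \<Sigma>"
  obtain S' where S': "S' holomorphic_on UNIV" "\<And>z. z \<in> X \<Longrightarrow> cmod (S' z - S z) < \<eta>"
    and int: "cmod (contour_integral (linepath p q) (\<lambda>z. exp (T z + R z * S' z) / R z) - c) < \<eta>"
  proof (rule runge_with_segment_integral[OF cX seg(2) _ \<open>p \<noteq> q\<close> SX T R _ Rinv \<eta>(1)])
    show "closed_segment p q \<inter> X \<subseteq> {p, q}" using seg(1) by simp
    show "R z \<noteq> 0" if "z \<in> closed_segment p q" for z using Rnz that segZ by blast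
  qed blast
  define E where "E = (\<lambda>z. S' z - S z)"
  define D where "D = (\<lambda>z. exp (Q z) * E z * \<Phi> (R z * E z))"
  have E: "E holomorphic_on W" unfolding E_def using S' S by (intro holomorphic_intros) (auto intro: holomorphic_on_subset)
  have "(\<lambda>z. \<Phi> (R z * E z)) holomorphic_on W"
    using holomorphic_on_compose_gen[of "\<lambda>z. R z * E z" W \<Phi> UNIV] \<Phi>(1) R E
    by (auto simp: o_def intro!: holomorphic_intros)
  then have D: "D holomorphic_on W" unfolding D_def using Q E by (intro holomorphic_intros)
  define \<Lambda> where "\<Lambda> = (\<lambda>z. exp (T z + R z * S' z) / R z)"
  have \<Lambda>: "\<Lambda> holomorphic_on A" if "A \<inter> Z = {}" for A
    unfolding \<Lambda>_def using T S' R Rnz that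
    by (intro holomorphic_intros) (auto intro: holomorphic_on_subset)
  have \<Lambda>_W: "\<Lambda> z + \<Sigma> z = deriv h z + D z" if z: "z \<in> W" "z \<notin> Z" for z
  proof -
    have "T z + R z * S' z = Q z + R z * E z" using QTS[OF z(1)] by (simp add: E_def algebra_simps)
    then have "exp (T z + R z * S' z) = exp (Q z) * (1 + R z * E z * \<Phi> (R z * E z))"
      by (simp only: exp_add[of "Q z"] \<Phi>(2)[of "R z * E z"])
    also have "\<dots> = R z * (deriv h z - \<Sigma> z + D z)"
      using Q(2)[OF z(1)] H(2)[OF z(2)] by (simp add: D_def algebra_simps)
    finally show ?thesis using Rnz[OF z(2)] by (simp add: \<Lambda>_def)
  qed
  \<comment> \<open>The first formula is holomorphic on \<open>W\<close>, the second one off \<open>Z\<close>, and they agree on the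
      overlap; together they define an entire function.\<close>
  define g' where "g' = (\<lambda>z. if z \<in> W then deriv h z + D z else \<Lambda> z + \<Sigma> z)"
  have g'_off: "g' z = \<Lambda> z + \<Sigma> z" if "z \<notin> Z" for z using \<Lambda>_W that by (simp add: g'_def)
  have "g' holomorphic_on W \<union> (- Z)"
  proof (rule holomorphic_on_Un)
    have "(\<lambda>z. deriv h z + D z) holomorphic_on W"
      using h D oW(3) by (intro holomorphic_intros holomorphic_deriv)
    then show "g' holomorphic_on W" by (rule holomorphic_transform) (simp add: g'_def)
    have "(\<lambda>z. \<Lambda> z + \<Sigma> z) holomorphic_on - Z" by (intro holomorphic_intros \<Lambda> \<Sigma>) auto
    then show "g' holomorphic_on - Z" by (rule holomorphic_transform) (simp add: g'_off)
  qed (use oW Z(1) finite_imp_closed in auto)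
  moreover have "W \<union> - Z = UNIV" by (auto simp: Z_def)
  ultimately have "g' holomorphic_on UNIV" by simp
  then obtain g0 where g0: "\<And>z. (g0 has_field_derivative g' z) (at z)"
    using holomorphic_convex_primitive'[of UNIV g'] by auto
  define g where "g = (\<lambda>z. g0 z - g0 p + h p)"
  have g: "(g has_field_derivative g' z) (at z)" for z
    unfolding g_def using g0[of z] by (auto intro!: derivative_eq_intros)
  then have g_hol: "g holomorphic_on UNIV" 
    by (auto simp: holomorphic_on_def field_differentiable_def)
  have dg: "deriv g z = g' z" for z using g by (rule DERIV_imp_deriv)
  define e where "e = (\<lambda>z. g z - h z)"
  have e: "e holomorphic_on W" unfolding e_def using g_hol h by (intro holomorphic_intros) (auto intro: holomorphic_on_subset)
  have de: "deriv e z = D z" if "z \<in> W" for z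
  proof -
    have "(h has_field_derivative deriv h z) (at z)" using h oW(3) that by (simp add: holomorphic_derivI)
    then have "(e has_field_derivative g' z - deriv h z) (at z)"
      unfolding e_def using g[of z] by (auto intro!: derivative_eq_intros)
    then show ?thesis using that by (simp add: DERIV_imp_deriv g'_def)
  qed
  have Dsmall: "cmod (deriv e z) \<le> BQ * B\<Phi> * \<eta>" if z: "z \<in> X" for z
  proof -
    have Ez: "cmod (E z) \<le> \<eta>" using S'(2)[OF z] by (simp add: E_def)
    have "cmod (R z * E z) \<le> BR * 1"
      unfolding norm_mult using BR Ez \<eta>(2) z by (intro mult_mono) auto
    then have "cmod (\<Phi> (R z * E z)) \<le> B\<Phi>" by (intro B\<Phi>(2)) simp
    then have "cmod (D z) \<le> BQ * \<eta> * B\<Phi>"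
      unfolding D_def norm_mult using BQ z Ez \<eta>(1) by (intro mult_mono) auto
    then show ?thesis using de[of z] XW z by (auto simp: mult_ac)
  qed
  have "cmod (e q) < \<eta>"
  proof -
    have segW: "closed_segment p q \<subseteq> - Z" using segZ by blast
    have i: "(g' has_contour_integral (g q - g p)) (linepath p q)"
      using contour_integral_primitive[of UNIV g g' "linepath p q"] g by (simp add: has_field_derivative_at_within)
    have i1: "\<Lambda> contour_integrable_on linepath p q" "\<Sigma> contour_integrable_on linepath p q"
      using \<Lambda>[of "- Z"] \<Sigma>[of "- Z"] segW
      by (auto intro!: contour_integrable_continuous_linepath intro: continuous_on_subset holomorphic_on_imp_continuous_on)
    have "((\<lambda>z. \<Lambda> z + \<Sigma> z) has_contour_integral (g q - g p)) (linepath p q)"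
      using i by (rule has_contour_integral_eq) (use g'_off segW in auto)
    then have "g q - g p = contour_integral (linepath p q) \<Lambda> + contour_integral (linepath p q) \<Sigma>"
      using i1 by (metis contour_integral_add contour_integral_unique)
    then have "e q = contour_integral (linepath p q) \<Lambda> - c" by (simp add: e_def c_def g_def)
    then show ?thesis using int by (simp add: \<Lambda>_def)
  qed
  have ep: "e p = 0" by (simp add: e_def g_def)
  have esmall: "cmod (e z) < \<epsilon>" if "z \<in> X" for z
  proof -
    have pos: "BQ * B\<Phi> * \<eta> \<ge> 0" using BQ B\<Phi> \<eta> by simp
    have "cmod (e z) < C * \<eta> + \<eta>"
      using that unfolding X_def
    proof
      assume z: "z \<in> ?K"
      have "cmod (e z - e p) \<le> 2 * M1 * (BQ * B\<Phi> * \<eta>)"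
        by (rule small_on_univalent_disc[OF \<psi>(1) r, of e])
          (use e oW M1 Dsmall p z pos in \<open>auto simp: W_def W1_W2_def X_def intro: holomorphic_on_subset\<close>)
      also have "\<dots> \<le> C * \<eta>" unfolding C_def using M1 M2 BQ B\<Phi> \<eta> by (simp add: algebra_simps)
      finally show ?thesis using ep \<eta> by simp
    next
      assume z: "z \<in> ?L"
      have "cmod (e z - e q) \<le> 2 * M2 * (BQ * B\<Phi> * \<eta>)"
        by (rule small_on_univalent_disc[OF \<theta>(1) r, of e])
          (use e oW M2 Dsmall q z pos in \<open>auto simp: W_def W1_W2_def X_def intro: holomorphic_on_subset\<close>)
      also have "\<dots> \<le> C * \<eta>" unfolding C_def using M1 M2 BQ B\<Phi> \<eta> by (simp add: algebra_simps)
      finally show ?thesis using norm_triangle_sub[of "e z" "e q"] \<open>cmod (e q) < \<eta>\<close> by linarith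
    qed
    then show ?thesis using \<eta>(3) by (simp add: distrib_right)
  qed
  define G where "G = (\<lambda>z\<in>UNIV. if z \<in> Z then None else Some ((\<Sum>a\<in>Z. b a / (z - a)) + g z))"
  have "G \<in> mero_lu UNIV"
    unfolding G_def
  proof (rule mero_lu_from_principal_parts)
    fix z assume "z \<in> UNIV - Z"
    then have "deriv g z - \<Sigma> z = \<Lambda> z" using g'_off[of z] by (simp add: dg)
    moreover have "\<Lambda> z \<noteq> 0" using Rnz[of z] \<open>z \<in> UNIV - Z\<close> by (simp add: \<Lambda>_def)
    ultimately show "deriv g z - (\<Sum>a\<in>Z. b a / (z - a)\<^sup>2) \<noteq> 0" by (simp add: \<Sigma>_def)
  qed (use Z b g_hol in auto)
  moreover have "G z = map_option (\<lambda>u. u + e z) (F z)" if "z \<in> W" for z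
  proof (cases "z \<in> Z")
    case True then show ?thesis by (simp add: G_def Z_def)
  next
    case False then show ?thesis using Feq[of z] that by (simp add: G_def e_def)
  qed
  ultimately show ?thesis using that[of G e] e esmall unfolding W_def W1_W2_def X_def by blast
qed

lemma scaled_ball_image:
  assumes "c > 0"
  shows "(\<lambda>x. complex_of_real c * x) ` ball 0 s = ball 0 (c * s)"
    and "(\<lambda>x. complex_of_real c * x) ` cball 0 s = cball 0 (c * s)"
proof -
  have *: "x = complex_of_real c * (x / of_real c)" "cmod (x / of_real c) = cmod x / c" for x :: complex
    using assms by (auto simp: norm_divide)
  show "(\<lambda>x. complex_of_real c * x) ` ball 0 s = ball 0 (c * s)"
  proof (intro equalityI subsetI)
    fix x :: complex assume "x \<in> ball 0 (c * s)"
    then have "cmod x / c < s" using assms by (simp add: field_simps)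
    then have "x / of_real c \<in> ball 0 s" by (simp add: *(2))
    then show "x \<in> (\<lambda>x. complex_of_real c * x) ` ball 0 s" using *(1) by blast
  qed (use assms in \<open>auto simp: norm_mult\<close>)
  show "(\<lambda>x. complex_of_real c * x) ` cball 0 s = cball 0 (c * s)"
  proof (intro equalityI subsetI)
    fix x :: complex assume "x \<in> cball 0 (c * s)"
    then have "cmod x / c \<le> s" using assms by (simp add: field_simps)
    then have "x / of_real c \<in> cball 0 s" by (simp add: *(2))
    then show "x \<in> (\<lambda>x. complex_of_real c * x) ` cball 0 s" using *(1) by blast
  qed (use assms in \<open>auto simp: norm_mult\<close>)
qed

text \<open>
There are finitely many poles on a slightly larger compact set, hence a slightly larger radius for
which no pole lies outside the closed unit disc; rescaling reduces the claim to the case of poles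
well inside.
\<close>

theorem lu_runge_two_discs:
  assumes r: "r > 1"
    and \<psi>: "\<psi> holomorphic_on ball 0 r" "inj_on \<psi> (ball 0 r)"
    and \<theta>: "\<theta> holomorphic_on ball 0 r" "inj_on \<theta> (ball 0 r)"
    and disj: "\<psi> ` ball 0 r \<inter> \<theta> ` ball 0 r = {}"
    and F: "F \<in> mero_lu (\<psi> ` ball 0 r \<union> \<theta> ` ball 0 r)"
    and "\<epsilon> > 0"
  obtains G e \<rho> where "G \<in> mero_lu UNIV" "1 < \<rho>" "\<rho> \<le> r" "e holomorphic_on \<psi> ` ball 0 \<rho> \<union> \<theta> ` ball 0 \<rho>"
    "\<And>z. z \<in> \<psi> ` ball 0 \<rho> \<union> \<theta> ` ball 0 \<rho> \<Longrightarrow> G z = map_option (\<lambda>u. u + e z) (F z)"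
    "\<And>z. z \<in> \<psi> ` cball 0 1 \<union> \<theta> ` cball 0 1 \<Longrightarrow> cmod (e z) < \<epsilon>"
proof -
  define r' where "r' = (1 + r) / 2"
  have r': "1 < r'" "r' < r" using r by (auto simp: r'_def)
  have sub: "cball 0 r' \<subseteq> ball (0::complex) r" using r' by auto
  have op: "open (f ` ball 0 s)" if "f holomorphic_on ball 0 r" "inj_on f (ball 0 r)" "s \<le> r"
    for f :: "complex \<Rightarrow> complex" and s
  proof (rule open_mapping_thm3)
    have "ball 0 s \<subseteq> ball (0::complex) r" using that by auto
    then show "f holomorphic_on ball 0 s" "inj_on f (ball 0 s)"
      using that by (auto intro: holomorphic_on_subset inj_on_subset)
  qed auto
  let ?W = "\<psi> ` ball 0 r \<union> \<theta> ` ball 0 r"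
  have oW: "open ?W" using op[OF \<psi>] op[OF \<theta>] by auto
  have fin: "finite {x \<in> cball 0 r'. F (f x) = None}"
    if f: "f holomorphic_on ball 0 r" "inj_on f (ball 0 r)" "f ` ball 0 r \<subseteq> ?W" for f
  proof -
    have "continuous_on (cball 0 r') f"
      using f(1) sub holomorphic_on_imp_continuous_on continuous_on_subset by blast
    then have "compact (f ` cball 0 r')" by (rule compact_continuous_image) simp
    moreover have "f ` cball 0 r' \<subseteq> ?W" using sub f(3) by blast
    ultimately have "finite {z \<in> f ` cball 0 r'. F z = None}" using finite_poles_compact[OF F oW] by blast
    then have "finite (f ` {x \<in> cball 0 r'. F (f x) = None})" by (rule rev_finite_subset) auto
    then show ?thesis
      by (rule finite_imageD) (rule inj_on_subset[OF f(2)], use sub in auto)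
  qed
  define A where "A = {x \<in> cball 0 r'. F (\<psi> x) = None} \<union> {x \<in> cball 0 r'. F (\<theta> x) = None}"
  have A: "finite A" unfolding A_def using fin[OF \<psi>] fin[OF \<theta>] by simp
  \<comment> \<open>\<open>\<rho>\<close> will be the smallest modulus beyond 1 at which a pole occurs, or the outer radius.\<close>
  define M where "M = insert r' (cmod ` A \<inter> {1<..})"
  have M: "finite M" "M \<noteq> {}" using A by (auto simp: M_def)
  define \<rho> where "\<rho> = Min M"
  have "\<rho> \<in> M" using M by (simp add: \<rho>_def)
  moreover have "\<rho> \<le> r'" unfolding \<rho>_def by (rule Min_le) (use M in \<open>auto simp: M_def\<close>)
  ultimately have \<rho>: "1 < \<rho>" "\<rho> \<le> r'" using r' by (auto simp: M_def)
  have gap: "cmod x \<le> 1" if "x \<in> A" "cmod x < \<rho>" for x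
  proof (rule ccontr)
    assume "\<not> cmod x \<le> 1"
    then have "\<rho> \<le> cmod x" unfolding \<rho>_def by (intro Min_le) (use M that in \<open>auto simp: M_def\<close>)
    then show False using that by simp
  qed
  define \<rho>0 where "\<rho>0 = (1 + \<rho>) / 2"
  have \<rho>0: "1 < \<rho>0" "\<rho>0 < \<rho>" using \<rho> by (auto simp: \<rho>0_def)
  have big: "\<rho> / \<rho>0 > 1" using \<rho>0 by simp
  define sc where "sc = (\<lambda>x. complex_of_real \<rho>0 * x)"
  have sc: "sc ` ball 0 (\<rho> / \<rho>0) = ball 0 \<rho>" "sc ` ball 0 1 = ball 0 \<rho>0" "sc ` cball 0 1 = cball 0 \<rho>0"
    using scaled_ball_image[of \<rho>0] \<rho>0 by (auto simp: sc_def)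
  have bsub: "ball 0 \<rho> \<subseteq> ball (0::complex) r" using \<rho> r' by auto
  have im: "(f \<circ> sc) ` ball 0 (\<rho> / \<rho>0) = f ` ball 0 \<rho>" "(f \<circ> sc) ` ball 0 1 = f ` ball 0 \<rho>0"
      "(f \<circ> sc) ` cball 0 1 = f ` cball 0 \<rho>0" for f :: "complex \<Rightarrow> complex"
    unfolding image_comp[symmetric] sc by (rule refl)+
  have hol: "(f \<circ> sc) holomorphic_on ball 0 (\<rho> / \<rho>0)" "inj_on (f \<circ> sc) (ball 0 (\<rho> / \<rho>0))"
    if f: "f holomorphic_on ball 0 r" "inj_on f (ball 0 r)" for f
  proof -
    have "sc holomorphic_on ball 0 (\<rho> / \<rho>0)" unfolding sc_def by (intro holomorphic_intros)
    then show "(f \<circ> sc) holomorphic_on ball 0 (\<rho> / \<rho>0)"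
      by (rule holomorphic_on_compose_gen[OF _ f(1)]) (use sc(1) bsub in auto)
    have "inj_on sc B" for B using \<rho>0 by (auto simp: inj_on_def sc_def)
    then show "inj_on (f \<circ> sc) (ball 0 (\<rho> / \<rho>0))"
      by (rule comp_inj_on) (use f(2) bsub sc(1) in \<open>auto intro: inj_on_subset\<close>)
  qed
  let ?V = "\<psi> ` ball 0 \<rho> \<union> \<theta> ` ball 0 \<rho>"
  have oV: "open ?V" using op[OF \<psi>, of \<rho>] op[OF \<theta>, of \<rho>] \<rho> r' by auto
  have VW: "?V \<subseteq> ?W" using bsub by blast
  have FV: "restrict F ?V \<in> mero_lu ?V" by (rule mero_lu_restrict[OF F VW oV oW])
  have poles: "{z \<in> ?V. restrict F ?V z = None} \<subseteq> \<psi> ` (A \<inter> ball 0 \<rho>) \<union> \<theta> ` (A \<inter> ball 0 \<rho>)"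
    using \<rho>(2) by (auto simp: A_def)
  have inner: "A \<inter> ball 0 \<rho> \<subseteq> ball 0 \<rho>0" using gap \<rho>0 by force
  obtain G e where Ge: "G \<in> mero_lu UNIV" "e holomorphic_on ?V"
    "\<And>z. z \<in> ?V \<Longrightarrow> G z = map_option (\<lambda>u. u + e z) (restrict F ?V z)"
    "\<And>z. z \<in> \<psi> ` cball 0 \<rho>0 \<union> \<theta> ` cball 0 \<rho>0 \<Longrightarrow> cmod (e z) < \<epsilon>"
  proof (rule lu_runge_finitely_many_poles[OF big hol[OF \<psi>] hol[OF \<theta>] _ _ _ _ \<open>\<epsilon> > 0\<close>, where F = "restrict F ?V", unfolded im])
    show "\<psi> ` ball 0 \<rho> \<inter> \<theta> ` ball 0 \<rho> = {}" using disj bsub by blast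
    show "finite {z \<in> ?V. restrict F ?V z = None}"
      by (rule finite_subset[OF poles]) (use A in auto)
    show "{z \<in> ?V. restrict F ?V z = None} \<subseteq> \<psi> ` ball 0 \<rho>0 \<union> \<theta> ` ball 0 \<rho>0"
      using poles inner by blast
  qed (use FV in blast)+
  have "cball 0 1 \<subseteq> cball (0::complex) \<rho>0" using \<rho>0 by auto
  then have "cmod (e z) < \<epsilon>" if "z \<in> \<psi> ` cball 0 1 \<union> \<theta> ` cball 0 1" for z
    using that by (intro Ge(4)) blast
  moreover have "\<rho> \<le> r" using \<rho> r' by simp
  ultimately show ?thesis using that[of G \<rho> e] Ge \<rho> by simp
qed

section \<open>The chordal metric\<close>

text \<open>
Stereographic projection onto the sphere of diameter 1 that rests on the origin, with infinity
placed at the origin; the chordal distance is the euclidean distance of the images.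
\<close>

definition stereo :: "complex option \<Rightarrow> complex \<times> real" where
  "stereo x = (case x of None \<Rightarrow> (0, 0)
     | Some z \<Rightarrow> (z / of_real (1 + (cmod z)\<^sup>2), 1 / (1 + (cmod z)\<^sup>2)))"

lemma chordal_eq_dist: "chordal x y = dist (stereo x) (stereo y)"
proof -
  have pos: "1 + (cmod z)\<^sup>2 > 0" for z by (simp add: add_pos_nonneg)
  have nrm: "(norm (stereo (Some z)))\<^sup>2 = 1 / (1 + (cmod z)\<^sup>2)" for z
  proof -
    have "(norm (stereo (Some z)))\<^sup>2 = ((cmod z)\<^sup>2 + 1) / (1 + (cmod z)\<^sup>2)\<^sup>2"
      using pos[of z] by (simp add: stereo_def norm_Pair norm_divide power_divide add_divide_distrib del: of_real_add)
    then show ?thesis using pos[of z] by (simp add: power2_eq_square add.commute)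
  qed
  have nrm': "norm (stereo (Some z)) = 1 / sqrt (1 + (cmod z)\<^sup>2)" for z
    using nrm[of z] by (metis norm_ge_zero real_sqrt_divide real_sqrt_one real_sqrt_unique)
  have stN: "stereo None = 0" by (simp add: stereo_def zero_prod_def)
  have two: "(dist (stereo (Some z)) (stereo (Some w)))\<^sup>2 = (cmod (z - w))\<^sup>2 / ((1 + (cmod z)\<^sup>2) * (1 + (cmod w)\<^sup>2))" for z w
  proof -
    define A B where "A = 1 + (cmod z)\<^sup>2" "B = 1 + (cmod w)\<^sup>2"
    have AB: "A > 0" "B > 0" using pos by (auto simp: A_B_def)
    have A': "A = 1 + (Re z)\<^sup>2 + (Im z)\<^sup>2" and B': "B = 1 + (Re w)\<^sup>2 + (Im w)\<^sup>2"
      by (auto simp: A_B_def cmod_power2)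
    have "z / of_real A - w / of_real B = (of_real B * z - of_real A * w) / of_real (A * B)"
      using AB by (simp add: field_simps)
    then have 1: "(cmod (z / of_real A - w / of_real B))\<^sup>2 = (cmod (of_real B * z - of_real A * w))\<^sup>2 / (A * B)\<^sup>2"
      using AB by (simp add: norm_divide power_divide norm_mult)
    have 2: "(1 / A - 1 / B)\<^sup>2 = (B - A)\<^sup>2 / (A * B)\<^sup>2"
      using AB by (simp add: diff_frac_eq power_divide)
    have 3: "(cmod (of_real B * z - of_real A * w))\<^sup>2 + (B - A)\<^sup>2 = A * B * (cmod (z - w))\<^sup>2"
      unfolding cmod_power2 by (simp add: A' B') algebra
    have "(dist (stereo (Some z)) (stereo (Some w)))\<^sup>2 = (cmod (z / of_real A - w / of_real B))\<^sup>2 + (1 / A - 1 / B)\<^sup>2"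
    proof -
      have "stereo (Some z) = (z / of_real A, 1 / A)" "stereo (Some w) = (w / of_real B, 1 / B)"
        unfolding A_B_def by (simp_all add: stereo_def)
      then have "(dist (stereo (Some z)) (stereo (Some w)))\<^sup>2 =
          (dist (z / of_real A) (w / of_real B))\<^sup>2 + (dist (1 / A) (1 / B))\<^sup>2"
        by (simp only: dist_Pair_Pair) simp
      then show ?thesis unfolding dist_norm real_norm_def power2_abs .
    qed
    also have "\<dots> = (A * B * (cmod (z - w))\<^sup>2) / (A * B)\<^sup>2"
      unfolding 1 2 3[symmetric] by (simp add: add_divide_distrib)
    finally show ?thesis using AB by (simp add: A_B_def power2_eq_square)
  qed
  have two': "dist (stereo (Some z)) (stereo (Some w)) = cmod (z - w) / (sqrt (1 + (cmod z)\<^sup>2) * sqrt (1 + (cmod w)\<^sup>2))" for z w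
  proof -
    have "dist (stereo (Some z)) (stereo (Some w)) = sqrt ((cmod (z - w))\<^sup>2 / ((1 + (cmod z)\<^sup>2) * (1 + (cmod w)\<^sup>2)))"
      using two[of z w] by (metis real_sqrt_unique zero_le_dist)
    then show ?thesis by (simp add: real_sqrt_divide real_sqrt_mult)
  qed
  show ?thesis
    by (cases x; cases y) (simp_all add: two' stN nrm' dist_norm[of 0] dist_norm[of _ 0])
qed

lemma chordal_triangle: "chordal x z \<le> chordal x y + chordal y z"
  unfolding chordal_eq_dist by (rule dist_triangle)

lemma chordal_commute: "chordal x y = chordal y x"
  unfolding chordal_eq_dist by (rule dist_commute)

lemma chordal_Some_le: "chordal (Some z) (Some w) \<le> cmod (z - w)"
proof -
  have "1 * 1 \<le> sqrt (1 + (cmod z)\<^sup>2) * sqrt (1 + (cmod w)\<^sup>2)" by (intro mult_mono) auto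
  then have "cmod (z - w) / (sqrt (1 + (cmod z)\<^sup>2) * sqrt (1 + (cmod w)\<^sup>2)) \<le> cmod (z - w) / 1"
    by (intro frac_le) auto
  then show ?thesis by simp
qed

lemma chordal_add_le: "chordal x (map_option (\<lambda>u. u + c) x) \<le> cmod c"
proof (cases x)
  case (Some u)
  then show ?thesis using chordal_Some_le[of u "u + c"] by simp
qed simp

text \<open>
This formula is continuous in \<open>u\<close> across \<open>u = 0\<close>, which is what continuity at the poles needs.
\<close>

lemma stereo_recip: "stereo (recip u) = (cnj u / of_real (1 + (cmod u)\<^sup>2), (cmod u)\<^sup>2 / (1 + (cmod u)\<^sup>2))"
proof (cases "u = 0")
  case False
  then have pos: "(cmod u)\<^sup>2 > 0" by simp
  have c: "cnj u = of_real ((cmod u)\<^sup>2) / u" using False unfolding complex_norm_square by simp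
  have d: "1 + (cmod (1 / u))\<^sup>2 = (1 + (cmod u)\<^sup>2) / (cmod u)\<^sup>2"
    using pos False by (simp add: norm_divide power_divide field_simps)
  have "stereo (recip u) = ((1 / u) / of_real (1 + (cmod (1 / u))\<^sup>2), 1 / (1 + (cmod (1 / u))\<^sup>2))"
    using False by (simp add: stereo_def recip_def)
  also have "\<dots> = ((of_real ((cmod u)\<^sup>2) / u) / of_real (1 + (cmod u)\<^sup>2), (cmod u)\<^sup>2 / (1 + (cmod u)\<^sup>2))"
    unfolding d by simp
  finally show ?thesis unfolding c .
qed (simp add: stereo_def recip_def)

lemma continuous_on_stereo_mero_lu:
  assumes "F \<in> mero_lu W" "open W"
  shows "continuous_on W (\<lambda>z. stereo (F z))"
proof (rule continuous_at_imp_continuous_on, rule ballI)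
  fix z assume "z \<in> W"
  then obtain r h where r: "r > 0" and h: "h holomorphic_on ball z r"
    and alt: "(\<forall>w\<in>ball z r. F w = Some (h w)) \<or> (\<forall>w\<in>ball z r. F w = recip (h w))"
    using mero_lu_imp_locally_univalent_at[OF assms(2,1)] unfolding locally_univalent_at_def by metis
  have c: "continuous_on (ball z r) h" using h by (rule holomorphic_on_imp_continuous_on)
  have pos: "1 + (cmod w)\<^sup>2 \<noteq> 0" "complex_of_real (1 + (cmod w)\<^sup>2) \<noteq> 0" for w
  proof -
    have "1 + (cmod w)\<^sup>2 > 0" by (simp add: add_pos_nonneg)
    then show "1 + (cmod w)\<^sup>2 \<noteq> 0" "complex_of_real (1 + (cmod w)\<^sup>2) \<noteq> 0"
      by (simp_all only: of_real_eq_0_iff)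
  qed
  from alt have "continuous_on (ball z r) (\<lambda>w. stereo (F w))"
  proof
    assume "\<forall>w\<in>ball z r. F w = Some (h w)"
    then have "\<And>w. w \<in> ball z r \<Longrightarrow> stereo (F w) = (h w / of_real (1 + (cmod (h w))\<^sup>2), 1 / (1 + (cmod (h w))\<^sup>2))"
      by (simp add: stereo_def)
    moreover have "continuous_on (ball z r) (\<lambda>w. (h w / of_real (1 + (cmod (h w))\<^sup>2), 1 / (1 + (cmod (h w))\<^sup>2)))"
      by (intro continuous_on_Pair continuous_on_divide continuous_on_of_real continuous_on_add continuous_on_power
          continuous_on_norm continuous_on_const c) (use pos in blast)+
    ultimately show ?thesis by (metis (no_types, lifting) continuous_on_cong)
  next
    assume "\<forall>w\<in>ball z r. F w = recip (h w)"
    then have "\<And>w. w \<in> ball z r \<Longrightarrow> stereo (F w) = (cnj (h w) / of_real (1 + (cmod (h w))\<^sup>2), (cmod (h w))\<^sup>2 / (1 + (cmod (h w))\<^sup>2))"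
      by (simp add: stereo_recip)
    moreover have "continuous_on (ball z r) (\<lambda>w. (cnj (h w) / of_real (1 + (cmod (h w))\<^sup>2), (cmod (h w))\<^sup>2 / (1 + (cmod (h w))\<^sup>2)))"
      by (intro continuous_on_Pair continuous_on_divide continuous_on_of_real continuous_on_add continuous_on_power
          continuous_on_norm continuous_on_const continuous_on_cnj c) (use pos in blast)+
    ultimately show ?thesis by (metis (no_types, lifting) continuous_on_cong)
  qed
  then show "isCont (\<lambda>z. stereo (F z)) z" using r by (simp add: continuous_on_eq_continuous_at)
qed

section \<open>A Baire argument for locally univalent functions\<close>

text \<open>
Away from the poles the derivative is continuous and nonzero; in the chart at infinity it is
\<open>-h'/h^2\<close>, which is bounded away from 0 because \<open>h\<close> is bounded and \<open>h'\<close> is not small.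
\<close>

lemma deriv_lower_bound_at:
  assumes "locally_univalent_at F z"
  obtains d m where "d > 0" "m > 0"
    "\<And>w. w \<in> ball z d \<Longrightarrow> F w \<noteq> None \<Longrightarrow> m \<le> cmod (deriv (\<lambda>w. the (F w)) w)"
proof -
  obtain r h where r: "r > 0" and h: "h holomorphic_on ball z r" "deriv h z \<noteq> 0"
    and alt: "(\<forall>w\<in>ball z r. F w = Some (h w)) \<or> (\<forall>w\<in>ball z r. F w = recip (h w))"
    using assms unfolding locally_univalent_at_def by blast
  define \<mu> where "\<mu> = cmod (deriv h z) / 2"
  have \<mu>: "\<mu> > 0" using h by (simp add: \<mu>_def)
  have ic: "isCont g z" if "g holomorphic_on ball z r" for g
    using holomorphic_on_imp_continuous_on[OF that] r by (simp add: continuous_on_eq_continuous_at)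
  have "isCont (\<lambda>w. cmod (deriv h w)) z" "isCont (\<lambda>w. cmod (h w)) z"
    using ic[OF h(1)] ic[OF holomorphic_deriv[OF h(1)]] by (auto intro!: continuous_intros)
  then have lims: "((\<lambda>w. cmod (deriv h w)) \<longlongrightarrow> cmod (deriv h z)) (nhds z)" "((\<lambda>w. cmod (h w)) \<longlongrightarrow> cmod (h z)) (nhds z)"
    using tendsto_at_iff_tendsto_nhds[of "\<lambda>w. cmod (deriv h w)" z] tendsto_at_iff_tendsto_nhds[of "\<lambda>w. cmod (h w)" z]
    by (simp_all add: isCont_def)
  have "\<forall>\<^sub>F w in nhds z. \<mu> < cmod (deriv h w)" by (rule order_tendstoD(1)[OF lims(1)]) (use \<mu> in \<open>simp add: \<mu>_def\<close>)
  moreover have "\<forall>\<^sub>F w in nhds z. cmod (h w) < cmod (h z) + 1" by (rule order_tendstoD(2)[OF lims(2)]) simp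
  ultimately have "\<forall>\<^sub>F w in nhds z. \<mu> < cmod (deriv h w) \<and> cmod (h w) < cmod (h z) + 1"
    by eventually_elim blast
  then obtain d where d: "0 < d" "d \<le> r" "\<forall>w\<in>ball z d. \<mu> < cmod (deriv h w) \<and> cmod (h w) < cmod (h z) + 1"
    using r by (rule eventually_in_small_ball)
  have dr: "w \<in> ball z r" if "w \<in> ball z d" for w using that d by auto
  define B where "B = cmod (h z) + 1"
  have B: "B \<ge> 1" by (simp add: B_def)
  show ?thesis
  proof (rule that[OF d(1)])
    show "\<mu> / B\<^sup>2 > 0" using \<mu> B by simp
    fix w assume w: "w \<in> ball z d" "F w \<noteq> None"
    have dw: "\<mu> < cmod (deriv h w)" "cmod (h w) < B" using d(3) w by (auto simp: B_def)
    from alt show "\<mu> / B\<^sup>2 \<le> cmod (deriv (\<lambda>w. the (F w)) w)"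
    proof
      assume eq: "\<forall>w\<in>ball z r. F w = Some (h w)"
      have "deriv (\<lambda>w. the (F w)) w = deriv h w"
      proof (rule deriv_cong_ev)
        show "\<forall>\<^sub>F x in nhds w. the (F x) = h x"
          using eventually_nhds_in_open[OF open_ball dr[OF w(1)]] by eventually_elim (use eq in simp)
      qed simp
      moreover have "\<mu> / B\<^sup>2 \<le> \<mu> / 1" using \<mu> B by (intro divide_left_mono) auto
      ultimately show ?thesis using dw by simp
    next
      assume eq: "\<forall>w\<in>ball z r. F w = recip (h w)"
      then have hw: "h w \<noteq> 0" using w dr by (auto simp: recip_def split: if_splits)
      have hd: "(h has_field_derivative deriv h w) (at w)"
        using h dr[OF w(1)] by (intro holomorphic_derivI) auto
      have "deriv (\<lambda>w. the (F w)) w = deriv (\<lambda>w. 1 / h w) w"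
      proof (rule deriv_cong_ev)
        have "isCont h w" using hd by (rule DERIV_isCont)
        then have "\<forall>\<^sub>F x in nhds w. h x \<noteq> 0"
          using hw by (simp add: isCont_def tendsto_at_iff_tendsto_nhds tendsto_imp_eventually_ne)
        then show "\<forall>\<^sub>F x in nhds w. the (F x) = 1 / h x"
          using eventually_nhds_in_open[OF open_ball dr[OF w(1)]]
          by eventually_elim (use eq in \<open>simp add: recip_def\<close>)
      qed simp
      also have "\<dots> = - deriv h w / (h w)\<^sup>2"
        by (rule DERIV_imp_deriv) (use hd hw in \<open>auto intro!: derivative_eq_intros simp: power2_eq_square\<close>)
      finally have "cmod (deriv (\<lambda>w. the (F w)) w) = cmod (deriv h w) / (cmod (h w))\<^sup>2"
        by (simp add: norm_divide norm_power)
      moreover have "\<mu> / B\<^sup>2 \<le> cmod (deriv h w) / (cmod (h w))\<^sup>2"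
        using dw hw \<mu> B by (intro frac_le power_mono) auto
      ultimately show ?thesis by simp
    qed
  qed
qed

lemma deriv_lower_bound:
  assumes F: "F \<in> mero_lu W" and "open W" "compact K" "K \<subseteq> W"
  obtains m where "m > 0" "\<And>w. w \<in> K \<Longrightarrow> F w \<noteq> None \<Longrightarrow> m \<le> cmod (deriv (\<lambda>w. the (F w)) w)"
proof -
  have "\<exists>d m. d > 0 \<and> m > 0 \<and> (\<forall>w\<in>ball z d. F w \<noteq> None \<longrightarrow> m \<le> cmod (deriv (\<lambda>w. the (F w)) w))"
    if "z \<in> K" for z
    using deriv_lower_bound_at[OF mero_lu_imp_locally_univalent_at[OF \<open>open W\<close> F]] that assms(4)
    by (metis subsetD)
  then obtain d m where dm: "\<And>z. z \<in> K \<Longrightarrow> d z > 0" "\<And>z. z \<in> K \<Longrightarrow> m z > 0"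
      "\<And>z w. z \<in> K \<Longrightarrow> w \<in> ball z (d z) \<Longrightarrow> F w \<noteq> None \<Longrightarrow> m z \<le> cmod (deriv (\<lambda>w. the (F w)) w)"
    by metis
  obtain C where C: "C \<subseteq> K" "finite C" "K \<subseteq> (\<Union>c\<in>C. ball c (d c))"
    by (rule compactE_image[OF \<open>compact K\<close>, of K "\<lambda>z. ball z (d z)"]) (use dm(1) in auto)
  define \<mu> where "\<mu> = Min (insert 1 (m ` C))"
  show ?thesis
  proof
    show "\<mu> > 0" unfolding \<mu>_def using C dm(2) by (subst Min_gr_iff) auto
    fix w assume w: "w \<in> K" "F w \<noteq> None"
    then obtain c where c: "c \<in> C" "w \<in> ball c (d c)" using C by blast
    have "\<mu> \<le> m c" unfolding \<mu>_def using C c by (intro Min_le) auto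
    then show "\<mu> \<le> cmod (deriv (\<lambda>w. the (F w)) w)" using dm(3)[of c w] c w C by fastforce
  qed
qed

text \<open>
Near a point of \<open>\<Omega>\<close>, for all large \<open>j\<close>, the limit is \<open>f_j + E_j\<close> with \<open>E_j = \<Sum>n. e_(j+n)\<close>
holomorphic and \<open>|E_j| \<le> 2 \<epsilon>_j\<close>. Poles and residues are inherited from \<open>f_j\<close>. At a point \<open>z\<close> that
is not a pole, Cauchy's inequality on a disc of radius \<open>r\<close> gives \<open>|E_j' z| \<le> 2 \<epsilon>_j / r\<close>, which is
less than \<open>(j + 1) \<epsilon>_j \<le> |f_j' z|\<close> once \<open>j + 1 > 2 / r\<close>; hence the derivative of the limit does not
vanish. The factor \<open>j + 1\<close> is there because \<open>r\<close> depends on the point.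
\<close>

lemma mero_lu_limit:
  fixes f :: "nat \<Rightarrow> complex \<Rightarrow> complex option" and e :: "nat \<Rightarrow> complex \<Rightarrow> complex"
  assumes "open \<Omega>" and f: "\<And>k. f k \<in> mero_lu \<Omega>"
    and K: "\<And>k. K k \<subseteq> \<Omega>" "\<And>k. K k \<subseteq> K (Suc k)" "\<Omega> \<subseteq> (\<Union>k. interior (K k))"
    and e: "\<And>k. e k holomorphic_on interior (K k)"
    and step: "\<And>k z. z \<in> K k \<Longrightarrow> f (Suc k) z = map_option (\<lambda>u. u + e k z) (f k z)"
    and small: "\<And>k z. z \<in> K k \<Longrightarrow> cmod (e k z) \<le> \<epsilon> k"
    and \<epsilon>: "\<And>k. \<epsilon> k > 0" "\<And>k. \<epsilon> (Suc k) \<le> \<epsilon> k / 2"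
    and steep: "\<And>k z. z \<in> K k \<Longrightarrow> f k z \<noteq> None \<Longrightarrow> (real k + 1) * \<epsilon> k \<le> cmod (deriv (\<lambda>w. the (f k w)) z)"
  obtains F where "F \<in> mero_lu \<Omega>" "\<And>k z. z \<in> K k \<Longrightarrow> chordal (f k z) (F z) \<le> 2 * \<epsilon> k"
proof -
  have mono: "K k \<subseteq> K (k + n)" for k n
    by (induction n) (use K(2) in auto)
  have \<epsilon>_geo: "\<epsilon> (k + n) \<le> \<epsilon> k * (1/2) ^ n" for k n
  proof (induction n)
    case (Suc n)
    have "\<epsilon> (k + Suc n) \<le> \<epsilon> (k + n) / 2" using \<epsilon>(2)[of "k + n"] by simp
    also have "\<dots> \<le> \<epsilon> k * (1/2) ^ n / 2" using Suc by simp
    finally show ?case by simp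
  qed simp
  have bd: "cmod (e (k + n) z) \<le> \<epsilon> k * (1/2) ^ n" if "z \<in> K k" for k n z
    using small[of z "k + n"] mono[of k n] that \<epsilon>_geo[of k n] by fastforce
  have geo: "(\<lambda>n. \<epsilon> k * (1/2) ^ n) sums (2 * \<epsilon> k)" for k
    using sums_mult[OF geometric_sums[of "1/2::real"], of "\<epsilon> k"] by (simp add: mult.commute)
  define E where "E = (\<lambda>k z. \<Sum>n. e (k + n) z)"
  have summ: "summable (\<lambda>n. e (k + n) z)" "cmod (E k z) \<le> 2 * \<epsilon> k" if z: "z \<in> K k" for k z
  proof -
    have s: "summable (\<lambda>n. cmod (e (k + n) z))"
      by (rule summable_comparison_test'[OF sums_summable[OF geo], of 0]) (use bd[OF z] in auto)
    then show "summable (\<lambda>n. e (k + n) z)" by (rule summable_norm_cancel)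
    have "cmod (E k z) \<le> (\<Sum>n. cmod (e (k + n) z))" unfolding E_def by (rule summable_norm[OF s])
    also have "\<dots> \<le> (\<Sum>n. \<epsilon> k * (1/2) ^ n)"
      by (rule suminf_le[OF _ s sums_summable[OF geo]]) (use bd[OF z] in auto)
    also have "\<dots> = 2 * \<epsilon> k" using geo by (rule sums_unique[symmetric])
    finally show "cmod (E k z) \<le> 2 * \<epsilon> k" .
  qed
  have E_Suc: "E k z = e k z + E (Suc k) z" if "z \<in> K k" for k z
    using suminf_split_head[OF summ(1)[OF that]] by (simp add: E_def)
  have E_hol: "E k holomorphic_on interior (K k)" for k
  proof (rule holomorphic_uniform_sequence)
    have "e (k + i) holomorphic_on interior (K k)" for i
      using e[of "k + i"] interior_mono[OF mono] by (rule holomorphic_on_subset)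
    then show "(\<lambda>z. \<Sum>i<n. e (k + i) z) holomorphic_on interior (K k)" for n
      by (intro holomorphic_intros)
    fix x assume "x \<in> interior (K k)"
    then obtain d where d: "d > 0" "cball x d \<subseteq> interior (K k)"
      using open_contains_cball[of "interior (K k)"] by auto
    have "uniform_limit (K k) (\<lambda>n z. \<Sum>i<n. e (k + i) z) (\<lambda>z. \<Sum>i. e (k + i) z) sequentially"
      by (rule Weierstrass_m_test[OF bd sums_summable[OF geo]])
    then have "uniform_limit (cball x d) (\<lambda>n z. \<Sum>i<n. e (k + i) z) (E k) sequentially"
      unfolding E_def using d interior_subset by (blast intro: uniform_limit_on_subset)
    then show "\<exists>d>0. cball x d \<subseteq> interior (K k) \<and> uniform_limit (cball x d) (\<lambda>n z. \<Sum>i<n. e (k + i) z) (E k) sequentially"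
      using d by blast
  qed simp
  have compat: "map_option (\<lambda>u. u + E k z) (f k z) = map_option (\<lambda>u. u + E (k + n) z) (f (k + n) z)"
    if "z \<in> K k" for k n z
  proof (induction n)
    case (Suc n)
    have z: "z \<in> K (k + n)" using that mono by blast
    show ?case using Suc step[OF z] E_Suc[OF z] by (simp add: option.map_comp o_def add.assoc)
  qed simp
  have cover: "\<exists>k. z \<in> interior (K k)" if "z \<in> \<Omega>" for z using that K(3) by blast
  \<comment> \<open>By \<open>compat\<close> every \<open>k\<close> with \<open>z \<in> K k\<close> yields the same value.\<close>
  define F where "F = (\<lambda>z\<in>\<Omega>. let k = (LEAST k. z \<in> K k) in map_option (\<lambda>u. u + E k z) (f k z))"
  have F_eq: "F z = map_option (\<lambda>u. u + E k z) (f k z)" if "z \<in> K k" for k z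
  proof -
    define l where "l = (LEAST k. z \<in> K k)"
    have "z \<in> K l" unfolding l_def using that by (rule LeastI)
    moreover have "l \<le> k" unfolding l_def using that by (rule Least_le)
    ultimately have "map_option (\<lambda>u. u + E l z) (f l z) = map_option (\<lambda>u. u + E k z) (f k z)"
      using compat[of z l "k - l"] by simp
    moreover have "z \<in> \<Omega>" using that K(1) by blast
    ultimately show ?thesis by (simp add: F_def Let_def l_def)
  qed
  have "F \<in> mero_lu \<Omega>"
  proof (rule mero_lu_if_locally_univalent_at)
    fix z assume z: "z \<in> \<Omega>"
    obtain k where k: "z \<in> interior (K k)" using cover z by blast
    obtain r where r: "r > 0" "cball z r \<subseteq> interior (K k)"
      using k open_contains_cball[of "interior (K k)"] by auto
    have lu: "locally_univalent_at (f j) z" for j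
      using f z \<open>open \<Omega>\<close> mero_lu_imp_locally_univalent_at by blast
    have rK: "cball z r \<subseteq> interior (K (k + n))" "cball z r \<subseteq> K (k + n)" for n
      using r(2) mono[of k n] interior_mono interior_subset by blast+
    have zK: "z \<in> K (k + n)" for n using rK(2) r(1) by (meson centre_in_cball less_imp_le subsetD)
    show "locally_univalent_at F z"
    proof (cases "F z = None")
      case True
      then have "f k z = None" using F_eq[of z k] zK[of 0] by simp
      obtain s b m where s: "s > 0" "b \<noteq> 0" "m holomorphic_on ball z s"
          "\<And>w. w \<in> ball z s \<Longrightarrow> w \<noteq> z \<Longrightarrow> f k w = Some (b / (w - z) + m w)"
        using locally_univalent_at_pole[OF lu \<open>f k z = None\<close>] by metis
      define t where "t = min r s"
      have t: "t > 0" "ball z t \<subseteq> cball z r" "ball z t \<subseteq> ball z s" using r s by (auto simp: t_def)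
      show ?thesis
      proof (rule locally_univalent_at_polar[where r = t and b = b and m = "\<lambda>w. m w + E k w"])
        have "E k holomorphic_on ball z t" using E_hol[of k] t(2) r(2) by (blast intro: holomorphic_on_subset)
        then show "(\<lambda>w. m w + E k w) holomorphic_on ball z t"
          using s(3) t(3) by (intro holomorphic_on_add) (blast intro: holomorphic_on_subset)
        show "F w = Some (b / (w - z) + (m w + E k w))" if w: "w \<in> ball z t" "w \<noteq> z" for w
        proof -
          have "w \<in> K k" using w(1) t(2) rK(2)[of 0] by auto
          then show ?thesis using F_eq[of w k] s(4)[of w] w t(3) by auto
        qed
      qed (use t(1) s(2) True in blast)+
    next
      case False
      obtain n :: nat where n: "2 / r < real n" using reals_Archimedean2 by blast
      define j where "j = k + n"
      have j: "2 / r < real j + 1" using n by (simp add: j_def)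
      have zj: "z \<in> K j" "cball z r \<subseteq> interior (K j)" "cball z r \<subseteq> K j"
        using zK rK by (auto simp: j_def)
      have "f j z \<noteq> None" using False F_eq[OF zj(1)] by auto
      then obtain s h where s: "s > 0" "h holomorphic_on ball z s"
          "\<And>w. w \<in> ball z s \<Longrightarrow> f j w = Some (h w)"
        using locally_univalent_at_finite[OF lu, of j] by metis
      define t where "t = min r s"
      have t: "t > 0" "ball z t \<subseteq> cball z r" "ball z t \<subseteq> ball z s" using r s by (auto simp: t_def)
      have Eh: "E j holomorphic_on ball z t" using E_hol[of j] t(2) zj(2) by (blast intro: holomorphic_on_subset)
      have hh: "h holomorphic_on ball z t" using s(2) t(3) by (blast intro: holomorphic_on_subset)
      have Feq: "F w = Some (h w + E j w)" if w: "w \<in> ball z t" for w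
      proof -
        have "w \<in> K j" using w t(2) zj(3) by auto
        then show ?thesis using F_eq[of w j] s(3)[of w] w t(3) by auto
      qed
      have "(h has_field_derivative deriv h z) (at z)" "(E j has_field_derivative deriv (E j) z) (at z)"
        using hh Eh t(1) by (auto intro!: holomorphic_derivI)
      then have "((\<lambda>w. h w + E j w) has_field_derivative deriv h z + deriv (E j) z) (at z)"
        by (rule DERIV_add)
      then have dsum: "deriv (\<lambda>w. h w + E j w) z = deriv h z + deriv (E j) z" by (rule DERIV_imp_deriv)
      have "deriv (\<lambda>w. the (f j w)) z = deriv h z"
      proof (rule deriv_cong_ev)
        show "\<forall>\<^sub>F x in nhds z. the (f j x) = h x"
          using eventually_nhds_in_open[OF open_ball centre_in_ball[THEN iffD2, OF s(1)]]
          by eventually_elim (use s(3) in simp)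
      qed simp
      then have low: "(real j + 1) * \<epsilon> j \<le> cmod (deriv h z)"
        using steep[OF zj(1) \<open>f j z \<noteq> None\<close>] by simp
      have "cmod ((deriv ^^ 1) (E j) z) \<le> fact 1 * (2 * \<epsilon> j) / r ^ 1"
      proof (rule Cauchy_inequality)
        have "E j holomorphic_on cball z r" using E_hol[of j] zj(2) by (blast intro: holomorphic_on_subset)
        then show "E j holomorphic_on ball z r" "continuous_on (cball z r) (E j)"
          by (auto intro: holomorphic_on_imp_continuous_on holomorphic_on_subset)
        show "cmod (E j x) \<le> 2 * \<epsilon> j" if "cmod (z - x) = r" for x
        proof (rule summ(2))
          have "x \<in> cball z r" using that by (simp add: dist_norm)
          then show "x \<in> K j" using zj(3) by blast
        qed
      qed (use r in auto)
      then have "cmod (deriv (E j) z) \<le> (2 / r) * \<epsilon> j" by simp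
      also have "\<dots> < (real j + 1) * \<epsilon> j" using j \<epsilon>(1)[of j] by (rule mult_strict_right_mono)
      finally have "cmod (deriv (E j) z) < cmod (deriv h z)" using low by linarith
      then have "deriv h z + deriv (E j) z \<noteq> 0" by (metis add_eq_0_iff less_irrefl norm_minus_cancel)
      then show ?thesis
        unfolding locally_univalent_at_def using t(1) Feq hh Eh dsum
        by (intro exI[of _ t] conjI exI[of _ "\<lambda>w. h w + E j w"]) (auto intro!: holomorphic_intros)
    qed
  qed (use \<open>open \<Omega>\<close> in \<open>auto simp: F_def\<close>)
  moreover have "chordal (f k z) (F z) \<le> 2 * \<epsilon> k" if "z \<in> K k" for k z
    using chordal_add_le[of "f k z" "E k z"] summ(2)[OF that] F_eq[OF that] by simp
  ultimately show ?thesis using that by blast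
qed

text \<open>
Density in a form stronger than the topology provides: the approximating function differs from the
given one by a small holomorphic function near \<open>K\<close>, also at the poles.
\<close>

definition additively_dense :: "complex set \<Rightarrow> (complex \<Rightarrow> complex option) set \<Rightarrow> bool" where
  "additively_dense \<Omega> U \<longleftrightarrow>
     (\<forall>f\<in>mero_lu \<Omega>. \<forall>K \<epsilon>. compact K \<longrightarrow> K \<subseteq> \<Omega> \<longrightarrow> \<epsilon> > 0 \<longrightarrow>
        (\<exists>G\<in>U. \<exists>e W. open W \<and> K \<subseteq> W \<and> e holomorphic_on W \<and>
           (\<forall>z\<in>W. G z = map_option (\<lambda>u. u + e z) (f z)) \<and> (\<forall>z\<in>K. cmod (e z) < \<epsilon>)))"

text \<open>
The nested construction of the Baire category theorem. A stage \<open>(g, K, \<delta>)\<close> consists of the current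
function, the compact set on which it will be kept and the permitted perturbation; \<open>P\<close> makes the
stage fit for \<open>mero_lu_limit\<close>, and \<open>R\<close> says that every function within \<open>2 \<delta>'\<close> of the next stage on
\<open>K'\<close> belongs to the open set of index \<open>k\<close>.
\<close>

proposition baire_mero_lu:
  assumes "open \<Omega>" and op: "\<And>j. mero_lu_open \<Omega> (U j)" and dense: "\<And>j. additively_dense \<Omega> (U j)"
    and f: "f \<in> mero_lu \<Omega>" and L: "compact L" "L \<subseteq> \<Omega>" and "\<epsilon> > 0"
  obtains G where "G \<in> mero_lu \<Omega>" "\<And>j::nat. G \<in> U j" "\<And>z. z \<in> L \<Longrightarrow> chordal (f z) (G z) < \<epsilon>"
proof -
  obtain C where C: "\<And>n. compact (C n)" "\<And>n. C n \<subseteq> \<Omega>" "\<And>n. C n \<subseteq> interior (C (Suc n))" "\<Union> (range C) = \<Omega>"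
    using open_Union_compact_subsets[OF \<open>open \<Omega>\<close>] by metis
  define P where "P = (\<lambda>k (g, K, \<delta>). g \<in> mero_lu \<Omega> \<and> compact K \<and> K \<subseteq> \<Omega> \<and> C k \<subseteq> K \<and> \<delta> > 0 \<and>
      (\<forall>z\<in>K. g z \<noteq> None \<longrightarrow> (real k + 1) * \<delta> \<le> cmod (deriv (\<lambda>w. the (g w)) z)) \<and>
      (k = 0 \<longrightarrow> g = f \<and> L \<subseteq> K \<and> 2 * \<delta> < \<epsilon>))"
  define R where "R = (\<lambda>k (g, K, \<delta>) (g', K', \<delta>'). K \<subseteq> K' \<and> \<delta>' \<le> \<delta> / 2 \<and>
      (\<exists>e W. open W \<and> K \<subseteq> W \<and> e holomorphic_on W \<and>
           (\<forall>z\<in>W. g' z = map_option (\<lambda>u. u + e z) (g z)) \<and> (\<forall>z\<in>K. cmod (e z) < \<delta>)) \<and>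
      (\<forall>G\<in>mero_lu \<Omega>. (\<forall>z\<in>K'. chordal (g' z) (G z) \<le> 2 * \<delta>') \<longrightarrow> G \<in> U k))"
  have "\<exists>s. \<forall>n. P n (s n) \<and> R n (s n) (s (Suc n))"
  proof (rule dependent_nat_choice)
    have K0: "compact (L \<union> C 0)" "L \<union> C 0 \<subseteq> \<Omega>" using L C by auto
    obtain m where m: "m > 0" "\<And>w. w \<in> L \<union> C 0 \<Longrightarrow> f w \<noteq> None \<Longrightarrow> m \<le> cmod (deriv (\<lambda>w. the (f w)) w)"
      using deriv_lower_bound[OF f \<open>open \<Omega>\<close> K0] by blast
    have "P 0 (f, L \<union> C 0, min m (\<epsilon> / 3))"
      unfolding P_def using f K0 m \<open>\<epsilon> > 0\<close> by (auto intro: min.coboundedI1)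
    then show "\<exists>x. P 0 x" by blast
  next
    fix x n assume Px: "P n x"
    obtain g K \<delta> where x: "x = (g, K, \<delta>)" by (cases x)
    have g: "g \<in> mero_lu \<Omega>" "compact K" "K \<subseteq> \<Omega>" "\<delta> > 0" using Px unfolding x P_def by auto
    obtain G e W where G: "G \<in> U n" "open W" "K \<subseteq> W" "e holomorphic_on W"
        "\<forall>z\<in>W. G z = map_option (\<lambda>u. u + e z) (g z)" "\<forall>z\<in>K. cmod (e z) < \<delta>"
      using dense[of n, unfolded additively_dense_def, rule_format, OF g] by blast
    have GM: "G \<in> mero_lu \<Omega>" using G(1) op unfolding mero_lu_open_def by blast
    obtain K1 \<epsilon>1 where K1: "compact K1" "K1 \<subseteq> \<Omega>" "\<epsilon>1 > 0"
        "\<And>H. H \<in> mero_lu \<Omega> \<Longrightarrow> (\<forall>z\<in>K1. chordal (G z) (H z) < \<epsilon>1) \<Longrightarrow> H \<in> U n"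
      using op[of n] G(1) unfolding mero_lu_open_def by metis
    define K' where "K' = K \<union> K1 \<union> C (Suc n)"
    have K': "compact K'" "K' \<subseteq> \<Omega>" using g K1 C by (auto simp: K'_def)
    obtain m where m: "m > 0" "\<And>w. w \<in> K' \<Longrightarrow> G w \<noteq> None \<Longrightarrow> m \<le> cmod (deriv (\<lambda>w. the (G w)) w)"
      using deriv_lower_bound[OF GM \<open>open \<Omega>\<close> K'] by blast
    \<comment> \<open>Halving gives summability, \<open>\<epsilon>1 / 3\<close> keeps the limit in the open set, and the last bound
        keeps the derivative of the limit away from 0.\<close>
    define \<delta>' where "\<delta>' = min (\<delta> / 2) (min (\<epsilon>1 / 3) (m / (real (Suc n) + 1)))"
    have \<delta>': "\<delta>' > 0" "\<delta>' \<le> \<delta> / 2" "\<delta>' \<le> \<epsilon>1 / 3" "\<delta>' \<le> m / (real (Suc n) + 1)"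
      unfolding \<delta>'_def by (use g(4) K1(3) m(1) in simp, rule min.cobounded1,
          rule min.coboundedI2[OF min.cobounded1], rule min.coboundedI2[OF min.cobounded2])
    have "(real (Suc n) + 1) * \<delta>' \<le> m" using \<delta>'(4) by (simp add: field_simps)
    then have "P (Suc n) (G, K', \<delta>')"
      unfolding P_def using GM K' \<delta>'(1) m(2) by (auto simp: K'_def intro: order_trans)
    moreover have "R n x (G, K', \<delta>')"
      unfolding R_def x prod.case
    proof (intro conjI ballI impI)
      fix H assume H: "H \<in> mero_lu \<Omega>" "\<forall>z\<in>K'. chordal (G z) (H z) \<le> 2 * \<delta>'"
      show "H \<in> U n"
      proof (rule K1(4)[OF H(1)], rule ballI)
        fix z assume "z \<in> K1"
        then have "chordal (G z) (H z) \<le> 2 * \<delta>'" using H(2) by (simp add: K'_def)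
        then show "chordal (G z) (H z) < \<epsilon>1" using \<delta>'(3) K1(3) by linarith
      qed
    qed (use \<delta>'(2) G in \<open>auto simp: K'_def\<close>)
    ultimately show "\<exists>y. P (Suc n) y \<and> R n x y" by blast
  qed
  then obtain s where s: "\<And>n. P n (s n)" "\<And>n. R n (s n) (s (Suc n))" by blast
  define g where "g = (\<lambda>n. fst (s n))"
  define K where "K = (\<lambda>n. fst (snd (s n)))"
  define \<delta> where "\<delta> = (\<lambda>n. snd (snd (s n)))"
  have s_eq: "s n = (g n, K n, \<delta> n)" for n by (simp add: g_def K_def \<delta>_def)
  have P: "g n \<in> mero_lu \<Omega>" "compact (K n)" "K n \<subseteq> \<Omega>" "C n \<subseteq> K n" "\<delta> n > 0"
      "\<And>z. z \<in> K n \<Longrightarrow> g n z \<noteq> None \<Longrightarrow> (real n + 1) * \<delta> n \<le> cmod (deriv (\<lambda>w. the (g n w)) z)" for n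
    using s(1)[of n] unfolding s_eq P_def by auto
  have P0: "g 0 = f" "L \<subseteq> K 0" "2 * \<delta> 0 < \<epsilon>" using s(1)[of 0] unfolding s_eq P_def by auto
  have R: "K n \<subseteq> K (Suc n)" "\<delta> (Suc n) \<le> \<delta> n / 2"
      "\<exists>e W. open W \<and> K n \<subseteq> W \<and> e holomorphic_on W \<and>
           (\<forall>z\<in>W. g (Suc n) z = map_option (\<lambda>u. u + e z) (g n z)) \<and> (\<forall>z\<in>K n. cmod (e z) < \<delta> n)"
      "\<And>G. G \<in> mero_lu \<Omega> \<Longrightarrow> (\<forall>z\<in>K (Suc n). chordal (g (Suc n) z) (G z) \<le> 2 * \<delta> (Suc n)) \<Longrightarrow> G \<in> U n" for n
    using s(2)[of n] unfolding s_eq R_def by auto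
  obtain e W where eW: "\<And>n. open (W n)" "\<And>n. K n \<subseteq> W n" "\<And>n. e n holomorphic_on W n"
      "\<And>n z. z \<in> W n \<Longrightarrow> g (Suc n) z = map_option (\<lambda>u. u + e n z) (g n z)"
      "\<And>n z. z \<in> K n \<Longrightarrow> cmod (e n z) < \<delta> n"
    using R(3) by metis
  obtain F where F: "F \<in> mero_lu \<Omega>" "\<And>k z. z \<in> K k \<Longrightarrow> chordal (g k z) (F z) \<le> 2 * \<delta> k"
  proof (rule mero_lu_limit[of \<Omega> g K e \<delta>])
    show "e k holomorphic_on interior (K k)" for k
      using eW(2,3) interior_subset by (blast intro: holomorphic_on_subset)
    show "\<Omega> \<subseteq> (\<Union>k. interior (K k))"
    proof
      fix z assume "z \<in> \<Omega>"
      then obtain n where "z \<in> C n" using C(4) by blast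
      then have "z \<in> interior (K (Suc n))" using C(3) P(4) interior_mono by blast
      then show "z \<in> (\<Union>k. interior (K k))" by blast
    qed
    show "g (Suc k) z = map_option (\<lambda>u. u + e k z) (g k z)" if "z \<in> K k" for k z
      using eW(4)[of z k] eW(2)[of k] that by blast
    show "cmod (e k z) \<le> \<delta> k" if "z \<in> K k" for k z using eW(5)[OF that] by simp
    show "(real k + 1) * \<delta> k \<le> cmod (deriv (\<lambda>w. the (g k w)) z)" if "z \<in> K k" "g k z \<noteq> None" for k z
      using P(6)[OF that] .
  qed (use \<open>open \<Omega>\<close> P(1,3,5) R(1,2) in blast)+
  have "F \<in> U j" for j by (rule R(4)[OF F(1)]) (use F(2) in blast)
  moreover have "chordal (f z) (F z) < \<epsilon>" if "z \<in> L" for z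
    using F(2)[of z 0] P0 that by force
  ultimately show ?thesis using that F(1) by blast
qed

section \<open>A countable base of the topology\<close>

text \<open>
A test \<open>(T, m)\<close> demands that \<open>g\<close> map every disc \<open>cball a \<rho>\<close> into the chordal ball of radius
\<open>1 / (m + 1)\<close> about \<open>c\<close>, for all \<open>(a, \<rho>, c) \<in> T\<close>. The uniform margin \<open>\<delta>\<close> makes the condition open
by definition.
\<close>

definition passes_test ::
    "(complex \<times> real \<times> complex option) set \<times> nat \<Rightarrow> (complex \<Rightarrow> complex option) \<Rightarrow> bool" where
  "passes_test \<tau> g \<longleftrightarrow> (\<exists>\<delta>>0. \<forall>(a, \<rho>, c)\<in>fst \<tau>. \<forall>z\<in>cball a \<rho>. chordal c (g z) \<le> 1 / (real (snd \<tau>) + 1) - \<delta>)"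

definition test_region :: "(complex \<times> real \<times> complex option) set \<times> nat \<Rightarrow> complex set" where
  "test_region \<tau> = (\<Union>(a, \<rho>, c)\<in>fst \<tau>. cball a \<rho>)"

lemma passes_testI:
  assumes "\<delta> > 0" "\<And>a \<rho> c z. (a, \<rho>, c) \<in> fst \<tau> \<Longrightarrow> z \<in> cball a \<rho> \<Longrightarrow>
      chordal c (g z) \<le> 1 / (real (snd \<tau>) + 1) - \<delta>"
  shows "passes_test \<tau> g"
  unfolding passes_test_def
proof (intro exI[of _ \<delta>] conjI ballI)
  fix t assume "t \<in> fst \<tau>"
  then show "case t of (a, \<rho>, c) \<Rightarrow> \<forall>z\<in>cball a \<rho>. chordal c (g z) \<le> 1 / (real (snd \<tau>) + 1) - \<delta>"
    using assms(2) by (cases t) blast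
qed fact

lemma passes_testE:
  assumes "passes_test \<tau> g"
  obtains \<delta> where "\<delta> > 0" "\<And>a \<rho> c z. (a, \<rho>, c) \<in> fst \<tau> \<Longrightarrow> z \<in> cball a \<rho> \<Longrightarrow>
      chordal c (g z) \<le> 1 / (real (snd \<tau>) + 1) - \<delta>"
proof -
  obtain \<delta> where \<delta>: "\<delta> > 0" "\<forall>(a, \<rho>, c)\<in>fst \<tau>. \<forall>z\<in>cball a \<rho>. chordal c (g z) \<le> 1 / (real (snd \<tau>) + 1) - \<delta>"
    using assms unfolding passes_test_def by blast
  show ?thesis
  proof (rule that[OF \<delta>(1)])
    fix a \<rho> c z assume "(a, \<rho>, c) \<in> fst \<tau>" "z \<in> cball a \<rho>"
    then show "chordal c (g z) \<le> 1 / (real (snd \<tau>) + 1) - \<delta>" using \<delta>(2) by blast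
  qed
qed

lemma passes_test_stable:
  assumes "passes_test \<tau> g"
  obtains \<delta> where "\<delta> > 0" "\<And>h. (\<And>z. z \<in> test_region \<tau> \<Longrightarrow> chordal (g z) (h z) < \<delta>) \<Longrightarrow> passes_test \<tau> h"
proof -
  obtain \<delta> where \<delta>: "\<delta> > 0" "\<And>a \<rho> c z. (a, \<rho>, c) \<in> fst \<tau> \<Longrightarrow> z \<in> cball a \<rho> \<Longrightarrow>
      chordal c (g z) \<le> 1 / (real (snd \<tau>) + 1) - \<delta>"
    using passes_testE[OF assms] by blast
  show ?thesis
  proof (rule that[of "\<delta>/2"])
    fix h assume h: "\<And>z. z \<in> test_region \<tau> \<Longrightarrow> chordal (g z) (h z) < \<delta>/2"
    have "chordal c (h z) \<le> 1 / (real (snd \<tau>) + 1) - \<delta>/2" if "(a, \<rho>, c) \<in> fst \<tau>" "z \<in> cball a \<rho>" for a \<rho> c z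
    proof -
      have "z \<in> test_region \<tau>" using that unfolding test_region_def by fast
      then show ?thesis using chordal_triangle[of c "h z" "g z"] \<delta>(2)[OF that] h[of z] by linarith
    qed
    then show "passes_test \<tau> h" using \<delta>(1) by (intro passes_testI[of "\<delta>/2"]) simp
  qed (use \<delta> in simp)
qed

definition tests_with :: "complex set \<Rightarrow> complex set \<Rightarrow> ((complex \<times> real \<times> complex option) set \<times> nat) set" where
  "tests_with D \<Omega> = {T. T \<subseteq> D \<times> \<rat> \<times> insert None (Some ` D) \<and> finite T \<and> (\<forall>(a, \<rho>, c)\<in>T. cball a \<rho> \<subseteq> \<Omega>)} \<times> UNIV"

lemma countable_tests_with:
  assumes "countable D"
  shows "countable (tests_with D \<Omega>)"
proof -
  have "countable (D \<times> \<rat> \<times> insert None (Some ` D))"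
    using assms by (intro countable_SIGMA countable_insert countable_image countable_rat) auto
  then have "countable {T. finite T \<and> T \<subseteq> D \<times> \<rat> \<times> insert None (Some ` D)}"
    by (rule countable_Collect_finite_subset)
  then have "countable {T. T \<subseteq> D \<times> \<rat> \<times> insert None (Some ` D) \<and> finite T \<and> (\<forall>(a, \<rho>, c)\<in>T. cball a \<rho> \<subseteq> \<Omega>)}"
    by (rule countable_subset[rotated]) blast
  then show ?thesis unfolding tests_with_def by (intro countable_SIGMA) auto
qed

lemma test_region_props:
  assumes "\<tau> \<in> tests_with D \<Omega>"
  shows "compact (test_region \<tau>)" "test_region \<tau> \<subseteq> \<Omega>"
proof -
  have "fst \<tau> \<in> {T. T \<subseteq> D \<times> \<rat> \<times> insert None (Some ` D) \<and> finite T \<and> (\<forall>(a, \<rho>, c)\<in>T. cball a \<rho> \<subseteq> \<Omega>)}"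
    using assms unfolding tests_with_def by (rule SigmaE) simp
  then have "finite (fst \<tau>)" "\<forall>(a, \<rho>, c)\<in>fst \<tau>. cball a \<rho> \<subseteq> \<Omega>" by blast+
  then show "compact (test_region \<tau>)" "test_region \<tau> \<subseteq> \<Omega>"
    unfolding test_region_def by (auto intro!: compact_UN)
qed

lemma test_neighbourhood_at:
  assumes "open \<Omega>" and f: "f \<in> mero_lu \<Omega>" and z: "z \<in> \<Omega>"
    and D: "\<And>U. open U \<Longrightarrow> U \<noteq> {} \<Longrightarrow> \<exists>d\<in>D. d \<in> U" and "\<epsilon> > 0"
  obtains a \<rho> c where "(a, \<rho>, c) \<in> D \<times> \<rat> \<times> insert None (Some ` D)" "cball a \<rho> \<subseteq> \<Omega>" "z \<in> ball a \<rho>"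
    "\<And>w. w \<in> cball a \<rho> \<Longrightarrow> chordal c (f w) \<le> \<epsilon>"
proof -
  have "continuous_on \<Omega> (\<lambda>z. stereo (f z))" by (rule continuous_on_stereo_mero_lu[OF f \<open>open \<Omega>\<close>])
  then obtain d where d: "d > 0" "\<And>w. w \<in> \<Omega> \<Longrightarrow> dist w z < d \<Longrightarrow> chordal (f w) (f z) < \<epsilon>/2"
    using z \<open>\<epsilon> > 0\<close> unfolding continuous_on_iff chordal_eq_dist by (meson half_gt_zero)
  obtain d' where d': "d' > 0" "ball z d' \<subseteq> \<Omega>" using \<open>open \<Omega>\<close> z openE by blast
  obtain \<rho> where \<rho>: "\<rho> \<in> \<rat>" "0 < \<rho>" "\<rho> < min d d' / 2"
    using Rats_dense_in_real[of 0 "min d d' / 2"] d(1) d'(1) by auto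
  obtain a where a: "a \<in> D" "a \<in> ball z \<rho>" using D[of "ball z \<rho>"] \<rho> by auto
  have near: "w \<in> \<Omega>" "dist w z < d" if "w \<in> cball a \<rho>" for w
  proof -
    have "dist w z < 2 * \<rho>" using that a dist_triangle[of w z a] by (simp add: dist_commute)
    then have "dist w z < d'" "dist w z < d" using \<rho>(3) by auto
    then show "w \<in> \<Omega>" "dist w z < d" using d'(2) by (auto simp: dist_commute)
  qed
  obtain c where c: "c \<in> insert None (Some ` D)" "chordal c (f z) < \<epsilon>/2"
  proof (cases "f z")
    case None
    then show ?thesis using that[of None] \<open>\<epsilon> > 0\<close> by simp
  next
    case (Some u)
    obtain v where v: "v \<in> D" "v \<in> ball u (\<epsilon>/2)" using D[of "ball u (\<epsilon>/2)"] \<open>\<epsilon> > 0\<close> by auto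
    have "chordal (Some v) (f z) < \<epsilon>/2"
      using chordal_Some_le[of v u] v(2) unfolding Some by (simp add: dist_norm norm_minus_commute del: chordal.simps)
    then show ?thesis using that[of "Some v"] v by blast
  qed
  show ?thesis
  proof (rule that[of a \<rho> c])
    show "chordal c (f w) \<le> \<epsilon>" if "w \<in> cball a \<rho>" for w
      using chordal_triangle[of c "f w" "f z"] c(2) d(2)[OF near[OF that]] chordal_commute[of "f z" "f w"] by linarith
  qed (use a \<rho> c near in \<open>auto simp: dist_commute\<close>)
qed

text \<open>
The compact set in the description of a neighbourhood of \<open>f\<close> is covered by finitely many discs on
each of which \<open>f\<close> stays within half a tolerance of a constant.
\<close>

lemma tests_form_base:
  assumes "open \<Omega>" and f: "f \<in> mero_lu \<Omega>" and U: "mero_lu_open \<Omega> U" "f \<in> U"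
    and D: "\<And>U. open U \<Longrightarrow> U \<noteq> {} \<Longrightarrow> \<exists>d\<in>D. d \<in> U"
  obtains \<tau> where "\<tau> \<in> tests_with D \<Omega>" "passes_test \<tau> f" "\<And>g. g \<in> mero_lu \<Omega> \<Longrightarrow> passes_test \<tau> g \<Longrightarrow> g \<in> U"
proof -
  obtain K \<epsilon> where K: "compact K" "K \<subseteq> \<Omega>" "\<epsilon> > 0"
      "\<And>g. g \<in> mero_lu \<Omega> \<Longrightarrow> (\<forall>z\<in>K. chordal (f z) (g z) < \<epsilon>) \<Longrightarrow> g \<in> U"
    using U unfolding mero_lu_open_def by metis
  obtain m :: nat where m: "1 / (real m + 1) < \<epsilon>/2"
    using reals_Archimedean[of "\<epsilon>/2"] K(3) by (auto simp: inverse_eq_divide add.commute)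
  define \<eta> where "\<eta> = 1 / (real m + 1) / 2"
  have \<eta>: "\<eta> > 0" by (simp add: \<eta>_def)
  have "\<exists>t. t \<in> D \<times> \<rat> \<times> insert None (Some ` D) \<and> cball (fst t) (fst (snd t)) \<subseteq> \<Omega> \<and> z \<in> ball (fst t) (fst (snd t)) \<and>
      (\<forall>w\<in>cball (fst t) (fst (snd t)). chordal (snd (snd t)) (f w) \<le> \<eta>)" if "z \<in> K" for z
  proof -
    have "z \<in> \<Omega>" using that K by blast
    from test_neighbourhood_at[OF \<open>open \<Omega>\<close> f this D \<eta>] obtain a \<rho> c where
      "(a, \<rho>, c) \<in> D \<times> \<rat> \<times> insert None (Some ` D)" "cball a \<rho> \<subseteq> \<Omega>" "z \<in> ball a \<rho>"
      "\<And>w. w \<in> cball a \<rho> \<Longrightarrow> chordal c (f w) \<le> \<eta>" by metis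
    then show ?thesis by (intro exI[of _ "(a, \<rho>, c)"]) auto
  qed
  then obtain t where t: "\<And>z. z \<in> K \<Longrightarrow> t z \<in> D \<times> \<rat> \<times> insert None (Some ` D)"
      "\<And>z. z \<in> K \<Longrightarrow> cball (fst (t z)) (fst (snd (t z))) \<subseteq> \<Omega>"
      "\<And>z. z \<in> K \<Longrightarrow> z \<in> ball (fst (t z)) (fst (snd (t z)))"
      "\<And>z w. z \<in> K \<Longrightarrow> w \<in> cball (fst (t z)) (fst (snd (t z))) \<Longrightarrow> chordal (snd (snd (t z))) (f w) \<le> \<eta>"
    by metis
  obtain C where C: "C \<subseteq> K" "finite C" "K \<subseteq> (\<Union>z\<in>C. ball (fst (t z)) (fst (snd (t z))))"
    by (rule compactE_image[OF K(1), of K "\<lambda>z. ball (fst (t z)) (fst (snd (t z)))"]) (use t(3) in auto)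
  define \<tau> where "\<tau> = (t ` C, m)"
  have mem: "(a, \<rho>, c) \<in> t ` C \<Longrightarrow> \<exists>z\<in>C. t z = (a, \<rho>, c)" for a \<rho> c by (metis imageE)
  show ?thesis
  proof (rule that[of \<tau>])
    have "cball a \<rho> \<subseteq> \<Omega>" if ac: "(a, \<rho>, c) \<in> t ` C" for a \<rho> c
    proof -
      obtain z where "z \<in> C" "t z = (a, \<rho>, c)" using mem[OF ac] by blast
      then show ?thesis using t(2)[of z] C(1) by auto
    qed
    moreover have "t ` C \<subseteq> D \<times> \<rat> \<times> insert None (Some ` D)" using t(1) C(1) by blast
    moreover have "finite (t ` C)" using C(2) by simp
    ultimately have "t ` C \<in> {T. T \<subseteq> D \<times> \<rat> \<times> insert None (Some ` D) \<and> finite T \<and> (\<forall>(a, \<rho>, c)\<in>T. cball a \<rho> \<subseteq> \<Omega>)}"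
      by blast
    then show "\<tau> \<in> tests_with D \<Omega>" unfolding tests_with_def \<tau>_def by blast
    have "chordal c (f w) \<le> 1 / (real m + 1) - \<eta>" if ac: "(a, \<rho>, c) \<in> t ` C" and w: "w \<in> cball a \<rho>" for a \<rho> c w
    proof -
      obtain z where "z \<in> C" "t z = (a, \<rho>, c)" using mem[OF ac] by blast
      then have "chordal c (f w) \<le> \<eta>" using t(4)[of z w] C(1) w by auto
      moreover have "\<eta> + \<eta> = 1 / (real m + 1)" unfolding \<eta>_def by (rule field_sum_of_halves)
      ultimately show ?thesis by linarith
    qed
    then show "passes_test \<tau> f" unfolding \<tau>_def using \<eta> by (intro passes_testI[of \<eta>]) (simp_all only: fst_conv snd_conv)
  next
    fix g assume g: "g \<in> mero_lu \<Omega>" "passes_test \<tau> g"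
    obtain \<delta> where \<delta>: "\<delta> > 0" "\<And>a \<rho> c z. (a, \<rho>, c) \<in> t ` C \<Longrightarrow> z \<in> cball a \<rho> \<Longrightarrow>
        chordal c (g z) \<le> 1 / (real m + 1) - \<delta>"
      using passes_testE[OF g(2)] unfolding \<tau>_def fst_conv snd_conv by blast
    show "g \<in> U"
    proof (rule K(4)[OF g(1)], rule ballI)
      fix w assume "w \<in> K"
      then obtain z where z: "z \<in> C" "w \<in> ball (fst (t z)) (fst (snd (t z)))" using C(3) by blast
      obtain a \<rho> c where tz: "t z = (a, \<rho>, c)" by (cases "t z")
      have w: "w \<in> cball a \<rho>" using z(2) tz by simp
      have "chordal c (g w) \<le> 1 / (real m + 1) - \<delta>" 
        by (rule \<delta>(2)[OF _ w, of c]) (use z(1) tz in \<open>metis imageI\<close>)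
      moreover have "chordal c (f w) \<le> \<eta>" using t(4)[of z w] z C(1) tz w by auto
      moreover have "\<eta> < 1 / (real m + 1)" by (simp add: \<eta>_def field_simps)
      ultimately show "chordal (f w) (g w) < \<epsilon>"
        using chordal_triangle[of "f w" "g w" c] chordal_commute[of "f w" c] \<delta>(1) m by linarith
    qed
  qed
qed

section \<open>Universality\<close>

text \<open>
The Riemann map of a proper simply connected domain, or a dilation if \<open>\<Omega>\<close> is the plane,
reparametrised so that \<open>K\<close> lies in the image of the closed unit disc.
\<close>

lemma disc_exhaustion:
  assumes "open \<Omega>" "\<Omega> \<noteq> {}" "simply_connected \<Omega>" "compact K" "K \<subseteq> \<Omega>"
  obtains \<psi> r where "r > 1" "\<psi> holomorphic_on ball 0 r" "inj_on \<psi> (ball 0 r)" "\<psi> ` ball 0 r \<subseteq> \<Omega>" "K \<subseteq> \<psi> ` cball 0 1"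
proof -
  have "\<Omega> = UNIV \<or> (\<exists>f g. f holomorphic_on \<Omega> \<and> g holomorphic_on ball 0 1 \<and>
           (\<forall>z \<in> \<Omega>. f z \<in> ball 0 1 \<and> g (f z) = z) \<and>
           (\<forall>z \<in> ball 0 1. g z \<in> \<Omega> \<and> f (g z) = z))"
    using Riemann_mapping_theorem[of \<Omega>] assms by blast
  then show ?thesis
  proof
    assume UN: "\<Omega> = UNIV"
    obtain B where B: "B > 0" "\<And>z. z \<in> K \<Longrightarrow> cmod z \<le> B"
      using compact_imp_bounded[OF assms(4)] unfolding bounded_pos by blast
    show ?thesis
    proof (rule that[of 2 "\<lambda>x. complex_of_real B * x"])
      show "K \<subseteq> (\<lambda>x. complex_of_real B * x) ` cball 0 1"
        using scaled_ball_image(2)[OF B(1), of 1] B(2) by auto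
    qed (use UN B(1) in \<open>auto intro!: holomorphic_intros simp: inj_on_def\<close>)
  next
    assume "\<exists>f g. f holomorphic_on \<Omega> \<and> g holomorphic_on ball 0 1 \<and>
           (\<forall>z \<in> \<Omega>. f z \<in> ball 0 1 \<and> g (f z) = z) \<and>
           (\<forall>z \<in> ball 0 1. g z \<in> \<Omega> \<and> f (g z) = z)"
    then obtain f g where fg: "f holomorphic_on \<Omega>" "g holomorphic_on ball 0 1"
        "\<And>z. z \<in> \<Omega> \<Longrightarrow> f z \<in> ball 0 1" "\<And>z. z \<in> \<Omega> \<Longrightarrow> g (f z) = z"
        "\<And>z. z \<in> ball 0 1 \<Longrightarrow> g z \<in> \<Omega>" "\<And>z. z \<in> ball 0 1 \<Longrightarrow> f (g z) = z" by blast
    have "compact (f ` K)"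
      using fg(1) assms(4,5) by (meson compact_continuous_image continuous_on_subset holomorphic_on_imp_continuous_on)
    moreover have "f ` K \<subseteq> ball 0 1" using fg(3) assms(5) by blast
    ultimately obtain s where s: "0 < s" "s < 1" "f ` K \<subseteq> cball 0 s"
    proof -
      obtain x where x: "0 \<le> x" "x < 1" "f ` K \<subseteq> cball 0 x"
      proof (cases "K = {}")
        case True then show ?thesis using that[of 0] by simp
      next
        case False
        have "continuous_on (f ` K) cmod" by (intro continuous_intros)
        then obtain y where y: "y \<in> f ` K" "\<And>w. w \<in> f ` K \<Longrightarrow> cmod w \<le> cmod y"
          using continuous_attains_sup[OF \<open>compact (f ` K)\<close>, of cmod] False by blast
        show ?thesis
        proof (rule that[of "cmod y"])
          show "f ` K \<subseteq> cball 0 (cmod y)" using y(2) by auto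
          show "cmod y < 1" using y(1) \<open>f ` K \<subseteq> ball 0 1\<close> by (metis dist_0_norm mem_ball subsetD)
        qed simp
      qed
      have "cball 0 x \<subseteq> cball (0::complex) ((1 + x) / 2)" using x by auto
      then have "f ` K \<subseteq> cball 0 ((1 + x) / 2)" using x(3) by blast
      then show ?thesis using that[of "(1 + x) / 2"] x by simp
    qed
    show ?thesis
    proof (rule that[of "1 / s" "\<lambda>x. g (complex_of_real s * x)"])
      have im: "(\<lambda>x. complex_of_real s * x) ` ball 0 (1 / s) = ball 0 1" "(\<lambda>x. complex_of_real s * x) ` cball 0 1 = cball 0 s"
        using scaled_ball_image(1)[OF s(1), of "1 / s"] scaled_ball_image(2)[OF s(1), of 1] s(1) by simp_all
      have "(g \<circ> (\<lambda>x. complex_of_real s * x)) holomorphic_on ball 0 (1 / s)"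
      proof (rule holomorphic_on_compose)
        show "g holomorphic_on (\<lambda>x. complex_of_real s * x) ` ball 0 (1 / s)" unfolding im by (rule fg(2))
      qed (intro holomorphic_intros)
      then show "(\<lambda>x. g (complex_of_real s * x)) holomorphic_on ball 0 (1 / s)" by (simp add: o_def)
      have "inj_on g (ball 0 1)" using fg(6) by (rule inj_on_inverseI)
      then have "inj_on g ((\<lambda>x. complex_of_real s * x) ` ball 0 (1 / s))" unfolding im .
      then have "inj_on (g \<circ> (\<lambda>x. complex_of_real s * x)) (ball 0 (1 / s))"
      proof (rule comp_inj_on[rotated])
        show "inj_on (\<lambda>x. complex_of_real s * x) (ball 0 (1 / s))" using s(1) by (simp add: inj_on_def)
      qed
      then show "inj_on (\<lambda>x. g (complex_of_real s * x)) (ball 0 (1 / s))" by (simp add: o_def)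
      have img: "(\<lambda>x. g (complex_of_real s * x)) ` A = g ` ((\<lambda>x. complex_of_real s * x) ` A)" for A
        by (simp add: image_image)
      show "(\<lambda>x. g (complex_of_real s * x)) ` ball 0 (1 / s) \<subseteq> \<Omega>" unfolding img im using fg(5) by blast
      show "K \<subseteq> (\<lambda>x. g (complex_of_real s * x)) ` cball 0 1"
      proof
        fix z assume z: "z \<in> K"
        then have "g (f z) = z" "f z \<in> cball 0 s" using fg(4) assms(5) s(3) by blast+
        then show "z \<in> (\<lambda>x. g (complex_of_real s * x)) ` cball 0 1" unfolding img im by (metis imageI)
      qed
    qed (use s in auto)
  qed
qed

text \<open>
Run-away sequences are only required to move \<open>K\<close> off itself for one index. Enlarging \<open>K\<close> by the
images of one of its points under the first \<open>N\<close> maps rules out the indices below \<open>N\<close>.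
\<close>

lemma run_away_injective:
  assumes run: "run_away \<Omega> \<phi>" and inj: "eventually_injective \<Omega> \<phi>" and self: "\<And>n. \<phi> n ` \<Omega> \<subseteq> \<Omega>"
    and K: "compact K" "K \<subseteq> \<Omega>" "K \<noteq> {}"
  obtains n where "\<phi> n ` K \<inter> K = {}" "inj_on (\<phi> n) K"
proof -
  obtain N where N: "\<And>n. n \<ge> N \<Longrightarrow> inj_on (\<phi> n) K" using inj K unfolding eventually_injective_def by blast
  obtain z0 where z0: "z0 \<in> K" using K by blast
  define K' where "K' = K \<union> (\<lambda>j. \<phi> j z0) ` {..<N}"
  have "compact ((\<lambda>j. \<phi> j z0) ` {..<N})" by (rule finite_imp_compact) simp
  then have K': "compact K'" unfolding K'_def by (rule compact_Un[OF K(1)])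
  have "K' \<subseteq> \<Omega>" using K z0 self unfolding K'_def by blast
  then obtain n where n: "\<phi> n ` K' \<inter> K' = {}" using run K' unfolding run_away_def by blast
  have "n \<ge> N"
  proof (rule ccontr)
    assume "\<not> n \<ge> N"
    then have "\<phi> n z0 \<in> K'" by (auto simp: K'_def)
    moreover have "\<phi> n z0 \<in> \<phi> n ` K'" using z0 by (auto simp: K'_def)
    ultimately show False using n by blast
  qed
  moreover have "\<phi> n ` K \<inter> K = {}" using n by (auto simp: K'_def)
  ultimately show ?thesis using that N by blast
qed

lemma mero_lu_glue:
  assumes "open A" "open B" "A \<inter> B = {}" and f: "f \<in> mero_lu A" and g: "g \<in> mero_lu B"
  shows "(\<lambda>z\<in>A \<union> B. if z \<in> A then f z else g z) \<in> mero_lu (A \<union> B)" (is "?h \<in> _")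
proof (rule mero_lu_if_locally_univalent_at)
  fix z assume "z \<in> A \<union> B"
  then show "locally_univalent_at ?h z"
  proof
    assume z: "z \<in> A"
    have "\<forall>\<^sub>F w in nhds z. f w = ?h w"
      using eventually_nhds_in_open[OF \<open>open A\<close> z] by eventually_elim simp
    then show ?thesis
      using locally_univalent_at_cong[OF mero_lu_imp_locally_univalent_at[OF \<open>open A\<close> f z]] by blast
  next
    assume z: "z \<in> B"
    have "\<forall>\<^sub>F w in nhds z. g w = ?h w"
      using eventually_nhds_in_open[OF \<open>open B\<close> z] by eventually_elim (use assms(3) in auto)
    then show ?thesis
      using locally_univalent_at_cong[OF mero_lu_imp_locally_univalent_at[OF \<open>open B\<close> g z]] by blast
  qed
qed (use assms in auto)

text \<open>
The approximation step: \<open>F\<close> is \<open>f\<close> near a disc \<open>\<psi>(cball 0 1)\<close> that contains \<open>K\<close> and the test region,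
and \<open>g o \<phi>_n^-1\<close> near the image of that disc under \<open>\<phi>_n\<close>. The Runge theorem replaces \<open>F\<close> by a
function on the whole plane.
\<close>

lemma additively_dense_test:
  assumes \<Omega>: "open \<Omega>" "\<Omega> \<noteq> {}" "simply_connected \<Omega>"
    and self: "\<And>\<psi>. \<psi> \<in> \<Phi> \<Longrightarrow> lu_self_map \<Omega> \<psi>" and \<phi>: "\<And>n. \<phi> n \<in> \<Phi>"
    and run: "run_away \<Omega> \<phi>" and inj: "eventually_injective \<Omega> \<phi>"
    and \<tau>: "\<tau> \<in> tests_with D \<Omega>" and g: "g \<in> mero_lu \<Omega>" "passes_test \<tau> g"
  shows "additively_dense \<Omega> {G \<in> mero_lu \<Omega>. \<exists>\<psi>\<in>\<Phi>. passes_test \<tau> (compose \<Omega> G \<psi>)}"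
  unfolding additively_dense_def
proof (intro ballI allI impI)
  fix f K and \<epsilon> :: real
  assume f: "f \<in> mero_lu \<Omega>" and K: "compact K" "K \<subseteq> \<Omega>" and "\<epsilon> > 0"
  obtain \<delta> where \<delta>: "\<delta> > 0" "\<And>h. (\<And>z. z \<in> test_region \<tau> \<Longrightarrow> chordal (g z) (h z) < \<delta>) \<Longrightarrow> passes_test \<tau> h"
    using passes_test_stable[OF g(2)] by blast
  obtain \<psi> r where \<psi>: "r > 1" "\<psi> holomorphic_on ball 0 r" "inj_on \<psi> (ball 0 r)" "\<psi> ` ball 0 r \<subseteq> \<Omega>"
      and cov: "K \<union> test_region \<tau> \<subseteq> \<psi> ` cball 0 1"
  proof (rule disc_exhaustion[OF \<Omega>])
    show "compact (K \<union> test_region \<tau>)" "K \<union> test_region \<tau> \<subseteq> \<Omega>" using K test_region_props[OF \<tau>] by auto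
  qed blast
  define s where "s = (1 + r) / 2"
  have s: "1 < s" "s < r" using \<psi>(1) by (auto simp: s_def)
  have sub: "ball 0 s \<subseteq> ball (0::complex) r" "cball 0 s \<subseteq> ball (0::complex) r" using s by auto
  have \<psi>s: "\<psi> holomorphic_on ball 0 s" "inj_on \<psi> (ball 0 s)"
    using \<psi>(2,3) sub by (auto intro: holomorphic_on_subset inj_on_subset)
  define C where "C = \<psi> ` cball 0 s"
  have C: "compact C" "C \<subseteq> \<Omega>" "C \<noteq> {}"
  proof -
    show "compact C"
      unfolding C_def using \<psi>(2) sub(2)
      by (meson compact_cball compact_continuous_image continuous_on_subset holomorphic_on_imp_continuous_on)
    show "C \<subseteq> \<Omega>" unfolding C_def using \<psi>(4) sub(2) by blast
    show "C \<noteq> {}" unfolding C_def using s by auto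
  qed
  have lu: "lu_self_map \<Omega> (\<phi> n)" for n using self \<phi> by blast
  obtain n where n: "\<phi> n ` C \<inter> C = {}" "inj_on (\<phi> n) C"
    by (rule run_away_injective[OF run inj _ C]) (use lu in \<open>auto simp: lu_self_map_def\<close>)
  define W where "W = \<psi> ` ball 0 s"
  have WC: "W \<subseteq> C" unfolding W_def C_def by auto
  have W: "open W" "W \<subseteq> \<Omega>"
    using open_mapping_thm3[OF \<psi>s(1) open_ball \<psi>s(2)] WC C(2) unfolding W_def by auto
  have \<phi>W: "\<phi> n holomorphic_on W" "inj_on (\<phi> n) W"
    using lu[of n] W(2) n(2) WC by (auto simp: lu_self_map_def intro: holomorphic_on_subset inj_on_subset)
  define V where "V = \<phi> n ` W"
  have oV: "open V" unfolding V_def by (rule open_mapping_thm3[OF \<phi>W(1) W(1) \<phi>W(2)])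
  have WV: "W \<inter> V = {}" unfolding V_def using n(1) WC by blast
  obtain \<iota> where \<iota>: "\<iota> holomorphic_on V" "\<And>z. z \<in> W \<Longrightarrow> deriv (\<phi> n) z * deriv \<iota> (\<phi> n z) = 1"
      "\<And>z. z \<in> W \<Longrightarrow> \<iota> (\<phi> n z) = z"
    unfolding V_def by (rule holomorphic_has_inverse[OF \<phi>W(1) W(1) \<phi>W(2)]) blast
  have gV: "compose V g \<iota> \<in> mero_lu V"
  proof (rule mero_lu_compose[OF g(1) \<iota>(1)])
    show "\<iota> ` V \<subseteq> \<Omega>" using \<iota>(3) W(2) by (auto simp: V_def)
    show "deriv \<iota> z \<noteq> 0" if "z \<in> V" for z using that \<iota>(2) unfolding V_def by (metis imageE mult_zero_right zero_neq_one)
  qed (use oV \<Omega> in auto)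
  define F where "F = (\<lambda>z\<in>W \<union> V. if z \<in> W then restrict f W z else compose V g \<iota> z)"
  have F: "F \<in> mero_lu (W \<union> V)"
    unfolding F_def by (rule mero_lu_glue[OF W(1) oV WV mero_lu_restrict[OF f W(2,1) \<Omega>(1)] gV])
  have FW: "F z = f z" if "z \<in> W" for z using that by (simp add: F_def)
  have FV: "F (\<phi> n z) = g z" if "z \<in> W" for z
  proof -
    have "\<phi> n z \<in> V" "\<phi> n z \<notin> W" using that WV by (auto simp: V_def)
    then show ?thesis using \<iota>(3)[OF that] by (simp add: F_def compose_def)
  qed
  have img: "(\<phi> n \<circ> \<psi>) ` A = \<phi> n ` \<psi> ` A" for A by (simp add: image_comp)
  have \<theta>: "(\<phi> n \<circ> \<psi>) holomorphic_on ball 0 s" "inj_on (\<phi> n \<circ> \<psi>) (ball 0 s)"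
    using holomorphic_on_compose[OF \<psi>s(1)] comp_inj_on[OF \<psi>s(2)] \<phi>W unfolding W_def by auto
  have min: "min \<epsilon> \<delta> > 0" using \<open>\<epsilon> > 0\<close> \<delta>(1) by simp
  obtain G e \<rho> where G: "G \<in> mero_lu UNIV" "1 < \<rho>" "\<rho> \<le> s"
    "e holomorphic_on \<psi> ` ball 0 \<rho> \<union> (\<phi> n \<circ> \<psi>) ` ball 0 \<rho>"
    "\<And>z. z \<in> \<psi> ` ball 0 \<rho> \<union> (\<phi> n \<circ> \<psi>) ` ball 0 \<rho> \<Longrightarrow> G z = map_option (\<lambda>u. u + e z) (F z)"
    "\<And>z. z \<in> \<psi> ` cball 0 1 \<union> (\<phi> n \<circ> \<psi>) ` cball 0 1 \<Longrightarrow> cmod (e z) < min \<epsilon> \<delta>"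
  proof (rule lu_runge_two_discs[OF s(1) \<psi>s \<theta> _ _ min])
    show "\<psi> ` ball 0 s \<inter> (\<phi> n \<circ> \<psi>) ` ball 0 s = {}" using WV unfolding img V_def W_def .
    show "F \<in> mero_lu (\<psi> ` ball 0 s \<union> (\<phi> n \<circ> \<psi>) ` ball 0 s)" using F unfolding img V_def W_def .
  qed blast
  have b1: "cball 0 1 \<subseteq> ball (0::complex) \<rho>" "ball 0 \<rho> \<subseteq> ball (0::complex) s" using G(2,3) by auto
  define G' where "G' = restrict G \<Omega>"
  have G'M: "G' \<in> mero_lu \<Omega>" unfolding G'_def by (rule mero_lu_restrict[OF G(1)]) (use \<Omega> in auto)
  have "passes_test \<tau> (compose \<Omega> G' (\<phi> n))"
  proof (rule \<delta>(2))
    fix z assume z: "z \<in> test_region \<tau>"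
    then obtain x where x: "x \<in> cball 0 1" "z = \<psi> x" using cov by blast
    have zW: "z \<in> W" using x b1 unfolding W_def by blast
    then have z\<Omega>: "z \<in> \<Omega>" "\<phi> n z \<in> \<Omega>" using W(2) lu[of n] by (auto simp: lu_self_map_def)
    have im1: "\<phi> n z \<in> (\<phi> n \<circ> \<psi>) ` cball 0 1" "\<phi> n z \<in> (\<phi> n \<circ> \<psi>) ` ball 0 \<rho>"
      using x b1(1) by auto
    have "compose \<Omega> G' (\<phi> n) z = map_option (\<lambda>u. u + e (\<phi> n z)) (g z)"
      using G(5)[of "\<phi> n z"] im1 FV[OF zW] z\<Omega> by (simp add: compose_def G'_def)
    then have "chordal (g z) (compose \<Omega> G' (\<phi> n) z) \<le> cmod (e (\<phi> n z))" using chordal_add_le by simp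
    also have "\<dots> < \<delta>" using G(6)[of "\<phi> n z"] im1 by simp
    finally show "chordal (g z) (compose \<Omega> G' (\<phi> n) z) < \<delta>" .
  qed
  then have "G' \<in> {G \<in> mero_lu \<Omega>. \<exists>\<psi>\<in>\<Phi>. passes_test \<tau> (compose \<Omega> G \<psi>)}" using G'M \<phi> by blast
  moreover have "open (\<psi> ` ball 0 \<rho>)"
    by (rule open_mapping_thm3) (use \<psi>s b1(2) in \<open>auto intro: holomorphic_on_subset inj_on_subset\<close>)
  moreover have "K \<subseteq> \<psi> ` ball 0 \<rho>" using cov b1(1) by blast
  moreover have "e holomorphic_on \<psi> ` ball 0 \<rho>" using G(4) by (rule holomorphic_on_subset) blast
  moreover have "\<forall>z\<in>\<psi> ` ball 0 \<rho>. G' z = map_option (\<lambda>u. u + e z) (f z)"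
  proof
    fix z assume z: "z \<in> \<psi> ` ball 0 \<rho>"
    then have "z \<in> W" using b1(2) unfolding W_def by blast
    then show "G' z = map_option (\<lambda>u. u + e z) (f z)" using G(5)[of z] z FW W(2) by (auto simp: G'_def)
  qed
  moreover have "\<forall>z\<in>K. cmod (e z) < \<epsilon>" using G(6) cov by fastforce
  ultimately show "\<exists>G\<in>{G \<in> mero_lu \<Omega>. \<exists>\<psi>\<in>\<Phi>. passes_test \<tau> (compose \<Omega> G \<psi>)}. \<exists>e W. open W \<and> K \<subseteq> W \<and>
      e holomorphic_on W \<and> (\<forall>z\<in>W. G z = map_option (\<lambda>u. u + e z) (f z)) \<and> (\<forall>z\<in>K. cmod (e z) < \<epsilon>)"
    by blast
qed

lemma mero_lu_open_test:
  assumes self: "\<And>\<psi>. \<psi> \<in> \<Phi> \<Longrightarrow> lu_self_map \<Omega> \<psi>" and \<tau>: "\<tau> \<in> tests_with D \<Omega>"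
  shows "mero_lu_open \<Omega> {G \<in> mero_lu \<Omega>. \<exists>\<psi>\<in>\<Phi>. passes_test \<tau> (compose \<Omega> G \<psi>)}"
  unfolding mero_lu_open_def
proof (intro conjI ballI)
  fix G assume "G \<in> {G \<in> mero_lu \<Omega>. \<exists>\<psi>\<in>\<Phi>. passes_test \<tau> (compose \<Omega> G \<psi>)}"
  then obtain \<psi> where \<psi>: "\<psi> \<in> \<Phi>" "passes_test \<tau> (compose \<Omega> G \<psi>)" by blast
  obtain \<delta> where \<delta>: "\<delta> > 0"
      "\<And>h. (\<And>z. z \<in> test_region \<tau> \<Longrightarrow> chordal (compose \<Omega> G \<psi> z) (h z) < \<delta>) \<Longrightarrow> passes_test \<tau> h"
    using passes_test_stable[OF \<psi>(2)] by blast
  have lu: "\<psi> holomorphic_on \<Omega>" "\<psi> ` \<Omega> \<subseteq> \<Omega>" using self[OF \<psi>(1)] by (auto simp: lu_self_map_def)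
  note tr = test_region_props[OF \<tau>]
  show "\<exists>K \<epsilon>. compact K \<and> K \<subseteq> \<Omega> \<and> \<epsilon> > 0 \<and> (\<forall>g\<in>mero_lu \<Omega>. (\<forall>z\<in>K. chordal (G z) (g z) < \<epsilon>) \<longrightarrow>
      g \<in> {G \<in> mero_lu \<Omega>. \<exists>\<psi>\<in>\<Phi>. passes_test \<tau> (compose \<Omega> G \<psi>)})"
  proof (intro exI[of _ "\<psi> ` test_region \<tau>"] exI[of _ \<delta>] conjI ballI impI)
    show "compact (\<psi> ` test_region \<tau>)"
      using lu(1) tr by (meson compact_continuous_image continuous_on_subset holomorphic_on_imp_continuous_on)
    show "\<psi> ` test_region \<tau> \<subseteq> \<Omega>" using lu(2) tr(2) by blast
    fix g assume g: "g \<in> mero_lu \<Omega>" "\<forall>z\<in>\<psi> ` test_region \<tau>. chordal (G z) (g z) < \<delta>"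
    have "passes_test \<tau> (compose \<Omega> g \<psi>)"
    proof (rule \<delta>(2))
      fix z assume z: "z \<in> test_region \<tau>"
      then have "z \<in> \<Omega>" using tr(2) by blast
      then show "chordal (compose \<Omega> G \<psi> z) (compose \<Omega> g \<psi> z) < \<delta>" using g(2) z by (simp add: compose_def)
    qed
    then show "g \<in> {G \<in> mero_lu \<Omega>. \<exists>\<psi>\<in>\<Phi>. passes_test \<tau> (compose \<Omega> G \<psi>)}" using g(1) \<psi>(1) by blast
  qed (rule \<delta>(1))
qed blast

lemma mero_lu_open_passes:
  assumes "\<tau> \<in> tests_with D \<Omega>"
  shows "mero_lu_open \<Omega> {g \<in> mero_lu \<Omega>. passes_test \<tau> g}"
  unfolding mero_lu_open_def
proof (intro conjI ballI)
  fix f assume "f \<in> {g \<in> mero_lu \<Omega>. passes_test \<tau> g}"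
  then obtain \<delta> where "\<delta> > 0" "\<And>h. (\<And>z. z \<in> test_region \<tau> \<Longrightarrow> chordal (f z) (h z) < \<delta>) \<Longrightarrow> passes_test \<tau> h"
    using passes_test_stable by blast
  then show "\<exists>K \<epsilon>. compact K \<and> K \<subseteq> \<Omega> \<and> \<epsilon> > 0 \<and> (\<forall>g\<in>mero_lu \<Omega>. (\<forall>z\<in>K. chordal (f z) (g z) < \<epsilon>) \<longrightarrow>
      g \<in> {g \<in> mero_lu \<Omega>. passes_test \<tau> g})"
    using test_region_props[OF assms] by (intro exI[of _ "test_region \<tau>"] exI[of _ \<delta>]) auto
qed blast

lemma universal_iff_tests:
  assumes "open \<Omega>" and self: "\<And>\<psi>. \<psi> \<in> \<Phi> \<Longrightarrow> lu_self_map \<Omega> \<psi>"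
    and D: "\<And>U. open U \<Longrightarrow> U \<noteq> {} \<Longrightarrow> \<exists>d\<in>D. d \<in> U"
  shows "universal_mero_lu \<Omega> \<Phi> G \<longleftrightarrow> G \<in> mero_lu \<Omega> \<and>
    (\<forall>\<tau>\<in>tests_with D \<Omega>. (\<exists>g\<in>mero_lu \<Omega>. passes_test \<tau> g) \<longrightarrow> (\<exists>\<psi>\<in>\<Phi>. passes_test \<tau> (compose \<Omega> G \<psi>)))"
    (is "_ \<longleftrightarrow> _ \<and> ?T")
proof -
  let ?S = "{compose \<Omega> G \<psi> |\<psi>. \<psi> \<in> \<Phi>}"
  have comp: "compose \<Omega> G \<psi> \<in> mero_lu \<Omega>" if "G \<in> mero_lu \<Omega>" "\<psi> \<in> \<Phi>" for \<psi>
    using self[OF that(2)] mero_lu_compose[OF that(1)] \<open>open \<Omega>\<close> by (auto simp: lu_self_map_def)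
  have "mero_lu_topology \<Omega> closure_of ?S = topspace (mero_lu_topology \<Omega>) \<longleftrightarrow> ?T" if G: "G \<in> mero_lu \<Omega>"
  proof
    assume cl: "mero_lu_topology \<Omega> closure_of ?S = topspace (mero_lu_topology \<Omega>)"
    show ?T
    proof (intro ballI impI)
      fix \<tau> assume \<tau>: "\<tau> \<in> tests_with D \<Omega>" and "\<exists>g\<in>mero_lu \<Omega>. passes_test \<tau> g"
      then obtain g where g: "g \<in> mero_lu \<Omega>" "passes_test \<tau> g" by blast
      then have "g \<in> mero_lu_topology \<Omega> closure_of ?S" by (simp add: cl topspace_mero_lu_topology)
      then have meets: "\<exists>y. y \<in> ?S \<and> y \<in> V" if "g \<in> V" "openin (mero_lu_topology \<Omega>) V" for V
        using that unfolding in_closure_of by simp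
      have "openin (mero_lu_topology \<Omega>) {g \<in> mero_lu \<Omega>. passes_test \<tau> g}"
        unfolding openin_mero_lu_topology by (rule mero_lu_open_passes[OF \<tau>])
      then obtain y where "y \<in> ?S" "passes_test \<tau> y"
        using meets[of "{g \<in> mero_lu \<Omega>. passes_test \<tau> g}"] g by auto
      then show "\<exists>\<psi>\<in>\<Phi>. passes_test \<tau> (compose \<Omega> G \<psi>)" by auto
    qed
  next
    assume T: ?T
    have "f \<in> mero_lu_topology \<Omega> closure_of ?S" if f: "f \<in> mero_lu \<Omega>" for f
      unfolding in_closure_of topspace_mero_lu_topology openin_mero_lu_topology
    proof (intro conjI allI impI f)
      fix U assume U: "f \<in> U \<and> mero_lu_open \<Omega> U"
      obtain \<tau> where \<tau>: "\<tau> \<in> tests_with D \<Omega>" "passes_test \<tau> f"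
          "\<And>g. g \<in> mero_lu \<Omega> \<Longrightarrow> passes_test \<tau> g \<Longrightarrow> g \<in> U"
      proof (rule tests_form_base[OF \<open>open \<Omega>\<close> f])
        show "mero_lu_open \<Omega> U" "f \<in> U" using U by auto
        show "\<exists>d\<in>D. d \<in> V" if "open V" "V \<noteq> {}" for V using D that by blast
      qed blast
      then obtain \<psi> where "\<psi> \<in> \<Phi>" "passes_test \<tau> (compose \<Omega> G \<psi>)" using T f by blast
      then show "\<exists>y. y \<in> ?S \<and> y \<in> U" using \<tau>(3) comp[OF G] by blast
    qed
    then show "mero_lu_topology \<Omega> closure_of ?S = topspace (mero_lu_topology \<Omega>)"
      using closure_of_subset_topspace[of "mero_lu_topology \<Omega>" ?S] unfolding topspace_mero_lu_topology by blast
  qed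
  then show ?thesis unfolding universal_mero_lu_def by blast
qed

lemma identity_in_mero_lu:
  assumes "open \<Omega>"
  shows "(\<lambda>z\<in>\<Omega>. Some z) \<in> mero_lu \<Omega>"
proof -
  have "locally_univalent_at (\<lambda>z. Some z) z" for z
    unfolding locally_univalent_at_def
    by (intro exI[of _ 1] conjI exI[of _ "\<lambda>z. z"]) auto
  then have "(\<lambda>z. Some z) \<in> mero_lu UNIV" by (intro mero_lu_if_locally_univalent_at) auto
  then have "restrict (\<lambda>z. Some z) \<Omega> \<in> mero_lu \<Omega>" by (rule mero_lu_restrict) (use assms in auto)
  then show ?thesis .
qed

theorem theorem2p12:
  fixes \<Omega> :: "complex set"
    and \<Phi> :: "(complex \<Rightarrow> complex) set"
    and \<phi> :: "nat \<Rightarrow> complex \<Rightarrow> complex"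
  assumes "open \<Omega>" and "connected \<Omega>" and "\<Omega> \<noteq> {}" and "simply_connected \<Omega>"
    and "\<And>\<psi>. \<psi> \<in> \<Phi> \<Longrightarrow> lu_self_map \<Omega> \<psi>"
    and "\<And>n. \<phi> n \<in> \<Phi>"
    and "run_away \<Omega> \<phi>"
    and "eventually_injective \<Omega> \<phi>"
  shows "(\<exists>G. universal_mero_lu \<Omega> \<Phi> G) \<and>
         gdelta_in (mero_lu_topology \<Omega>) {G. universal_mero_lu \<Omega> \<Phi> G} \<and>
         mero_lu_topology \<Omega> closure_of {G. universal_mero_lu \<Omega> \<Phi> G}
           = topspace (mero_lu_topology \<Omega>)"
proof -
  let ?X = "mero_lu_topology \<Omega>" and ?Univ = "{G. universal_mero_lu \<Omega> \<Phi> G}"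
  obtain D :: "complex set" where D: "countable D" "\<And>U. open U \<Longrightarrow> U \<noteq> {} \<Longrightarrow> \<exists>d\<in>D. d \<in> U"
    using countable_dense_setE by blast
  define I where "I = {\<tau> \<in> tests_with D \<Omega>. \<exists>g\<in>mero_lu \<Omega>. passes_test \<tau> g}"
  define U where "U = (\<lambda>\<tau>. {G \<in> mero_lu \<Omega>. \<exists>\<psi>\<in>\<Phi>. passes_test \<tau> (compose \<Omega> G \<psi>)})"
  have I: "countable I" unfolding I_def using countable_tests_with[OF D(1), of \<Omega>] by (rule countable_subset[rotated]) blast
  have id: "(\<lambda>z\<in>\<Omega>. Some z) \<in> mero_lu \<Omega>" by (rule identity_in_mero_lu[OF assms(1)])
  have "({}, 0) \<in> I" unfolding I_def tests_with_def passes_test_def using id by (auto intro!: exI[of _ "1::real"])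
  then have "I \<noteq> {}" by blast
  have U: "mero_lu_open \<Omega> (U \<tau>)" "additively_dense \<Omega> (U \<tau>)" if "\<tau> \<in> I" for \<tau>
    using that unfolding I_def U_def
    by (auto intro: mero_lu_open_test[OF assms(5)] additively_dense_test[OF assms(1,3-8)])
  have univ: "?Univ = (\<Inter>\<tau>\<in>I. U \<tau>)"
  proof -
    have "universal_mero_lu \<Omega> \<Phi> G \<longleftrightarrow> G \<in> mero_lu \<Omega> \<and> (\<forall>\<tau>\<in>I. \<exists>\<psi>\<in>\<Phi>. passes_test \<tau> (compose \<Omega> G \<psi>))" for G
    proof -
      have "universal_mero_lu \<Omega> \<Phi> G \<longleftrightarrow> G \<in> mero_lu \<Omega> \<and>
        (\<forall>\<tau>\<in>tests_with D \<Omega>. (\<exists>g\<in>mero_lu \<Omega>. passes_test \<tau> g) \<longrightarrow> (\<exists>\<psi>\<in>\<Phi>. passes_test \<tau> (compose \<Omega> G \<psi>)))"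
        by (rule universal_iff_tests[OF assms(1)]) (use assms(5) D(2) in blast)+
      then show ?thesis unfolding I_def by blast
    qed
    moreover have "G \<in> (\<Inter>\<tau>\<in>I. U \<tau>) \<longleftrightarrow> G \<in> mero_lu \<Omega> \<and> (\<forall>\<tau>\<in>I. \<exists>\<psi>\<in>\<Phi>. passes_test \<tau> (compose \<Omega> G \<psi>))" for G
      using \<open>I \<noteq> {}\<close> by (auto simp: U_def)
    ultimately show ?thesis by (simp add: set_eq_iff)
  qed
  have dense: "\<exists>G\<in>?Univ. \<forall>z\<in>L. chordal (f z) (G z) < \<epsilon>"
    if f: "f \<in> mero_lu \<Omega>" and L: "compact L" "L \<subseteq> \<Omega>" "\<epsilon> > 0" for f L \<epsilon>
  proof -
    have "from_nat_into I j \<in> I" for j using \<open>I \<noteq> {}\<close> by (rule from_nat_into)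
    then obtain G where G: "G \<in> mero_lu \<Omega>" "\<And>j. G \<in> U (from_nat_into I j)" "\<And>z. z \<in> L \<Longrightarrow> chordal (f z) (G z) < \<epsilon>"
      using baire_mero_lu[OF assms(1) _ _ f L, of "\<lambda>j. U (from_nat_into I j)"] U by metis
    have "G \<in> U \<tau>" if "\<tau> \<in> I" for \<tau>
      using G(2) from_nat_into_surj[OF I that] by metis
    then show ?thesis using univ G(3) by blast
  qed
  have "gdelta_in ?X (\<Inter> (U ` I))"
    by (rule gdelta_in_Inter) (use I \<open>I \<noteq> {}\<close> U(1) in \<open>auto intro!: open_imp_gdelta_in simp: openin_mero_lu_topology\<close>)
  then have "gdelta_in ?X ?Univ" unfolding univ by simp
  moreover have "?X closure_of ?Univ = topspace ?X"
  proof -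
    have "f \<in> ?X closure_of ?Univ" if f: "f \<in> mero_lu \<Omega>" for f
      unfolding in_closure_of topspace_mero_lu_topology openin_mero_lu_topology
    proof (intro conjI allI impI f)
      fix V assume V: "f \<in> V \<and> mero_lu_open \<Omega> V"
      then obtain K \<epsilon> where K: "compact K" "K \<subseteq> \<Omega>" "\<epsilon> > 0"
          "\<And>g. g \<in> mero_lu \<Omega> \<Longrightarrow> (\<forall>z\<in>K. chordal (f z) (g z) < \<epsilon>) \<Longrightarrow> g \<in> V"
        unfolding mero_lu_open_def by metis
      obtain G where G: "universal_mero_lu \<Omega> \<Phi> G" "\<forall>z\<in>K. chordal (f z) (G z) < \<epsilon>"
        using dense[OF f K(1-3)] by blast
      then have "G \<in> mero_lu \<Omega>" by (simp add: universal_mero_lu_def)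
      then show "\<exists>y. y \<in> ?Univ \<and> y \<in> V" using K(4) G by blast
    qed
    then show ?thesis
      using closure_of_subset_topspace[of ?X ?Univ] unfolding topspace_mero_lu_topology by blast
  qed
  moreover have "\<exists>G. universal_mero_lu \<Omega> \<Phi> G"
    using dense[OF id, of "{}" 1] by auto
  ultimately show ?thesis by blast
qed

end
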